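(* Let $D\geq 1$ be an integer and let $G$ be a loopless multigraph with a vertex weighting $w:V(G)\to\{1,\dots,D+2\}$; define the capacity $c(v)=D+2-w(v)$. For a vertex weighting $\rho$ and edge weight $\rho_e$, set $\rho(A)=\sum_{v\in A}\rho(v)-\rho_e\,|E(G[A])|$ for $A\subseteq V(G)$ (edges counted with multiplicity). Then: 1. If $D\geq 1$ and $G$ is a $(D,\mathrm{F})$-critical weighted multigraph with $|V(G)|\geq 3$, then $\rho(V(G))\leq -2$, where $\rho(v)=2D+1+2c(v)$ and $\rho_e=2(D+1)$. 2. If $D\geq 2$ and $G$ is a $(D,\mathrm{F})$-critical weighted simple graph with $|V(G)|\geq 3$, then $\rho(V(G))\leq -3$, where $\rho(v)=3D+2+3c(v)$ and $\rho_e=3(D+1)$. 3. If $D\geq 1$ is odd and $G$ is a $(D,\mathrm{F})_e$-critical weighted multigraph with $|V(G)|\geq 3$, then $\rho(V(G))\leq -2$, where $\rho(v)=2D+1+2c(v)$ and $\rho_e=2(D+1)$. 4. If $D\geq 2$ is even and $G$ is a $(D,\mathrm{F})_e$-critical weighted multigraph with $|V(G)|\geq 3$, then $\rho(V(G))\leq -2$, where $\rho(v)=2D+2c(v)$ if $c(v)\leq \frac{D-2}{2}$, $\rho(v)=2D+2c(v)-1$ if $c(v)\geq \frac D2$, and $\rho_e=2D+1$.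
   Context: A forest is an acyclic multigraph; a pair of parallel edges counts as a cycle, so forests have no multiple edges. For a multigraph $G$ with weighting $w:V(G)\to\{1,\dots,D+2\}$: a $(D,\mathrm{F})$-coloring is a partition $(M,F)$ of $V(G)$ such that $G[M]$ and $G[F]$ are forests and for every $v\in M$, $w(v)+|N(v)\cap M|\leq D+1$. A $(D,\mathrm{F})_e$-coloring is a partition $(M,F)$ of $V(G)$ such that $G[M]$ and $G[F]$ are forests and every connected component $C$ of $G[M]$ satisfies $\sum_{v\in V(C)}w(v)\leq D+1$. (With $w\equiv 1$ these reduce to: $G[M]$ has maximum degree at most $D$, respectively every component of $G[M]$ has at most $D$ edges.) A weighted multigraph is $(D,\mathrm{F})$-critical (respectively $(D,\mathrm{F})_e$-critical) if it has no such coloring but every proper subgraph, with the inherited weights, has one. *)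

theory Defs
  imports Main
begin

text \<open>
  Undirected multigraphs: parallel edges are distinct edges with the same set of ends, and a
  loop would be an edge whose set of ends is a singleton.
\<close>

record ('v, 'e) multigraph =
  verts :: "'v set"
  edges :: "'e set"
  ends :: "'e \<Rightarrow> 'v set"

definition loopless_multigraph :: "('v, 'e) multigraph \<Rightarrow> bool" where
  "loopless_multigraph G \<longleftrightarrow>
     finite (verts G) \<and> finite (edges G) \<and>
     (\<forall>e \<in> edges G. ends G e \<subseteq> verts G \<and> card (ends G e) = 2)"

definition no_parallel_edges :: "('v, 'e) multigraph \<Rightarrow> bool" where
  "no_parallel_edges G \<longleftrightarrow> inj_on (ends G) (edges G)"

definition simple_graph :: "('v, 'e) multigraph \<Rightarrow> bool" where
  "simple_graph G \<longleftrightarrow> loopless_multigraph G \<and> no_parallel_edges G"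

definition subgraph :: "('v, 'e) multigraph \<Rightarrow> ('v, 'e) multigraph \<Rightarrow> bool" where
  "subgraph H G \<longleftrightarrow>
     verts H \<subseteq> verts G \<and> edges H \<subseteq> edges G \<and>
     (\<forall>e \<in> edges H. ends H e = ends G e \<and> ends H e \<subseteq> verts H)"

text \<open>
  Properness compares vertex and edge sets rather than records, since the values of
  \<^const>\<open>ends\<close> outside the edge set are irrelevant.
\<close>

definition proper_subgraph :: "('v, 'e) multigraph \<Rightarrow> ('v, 'e) multigraph \<Rightarrow> bool" where
  "proper_subgraph H G \<longleftrightarrow> subgraph H G \<and> (verts H \<noteq> verts G \<or> edges H \<noteq> edges G)"

definition induced :: "('v, 'e) multigraph \<Rightarrow> 'v set \<Rightarrow> ('v, 'e) multigraph" where
  "induced G A =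
     \<lparr>verts = verts G \<inter> A, edges = {e \<in> edges G. ends G e \<subseteq> A}, ends = ends G\<rparr>"

definition adjacency :: "('v, 'e) multigraph \<Rightarrow> ('v \<times> 'v) set" where
  "adjacency G =
     {(u, v). u \<in> verts G \<and> v \<in> verts G \<and> (\<exists>e \<in> edges G. ends G e = {u, v})}"

definition neighbors :: "('v, 'e) multigraph \<Rightarrow> 'v \<Rightarrow> 'v set" where
  "neighbors G v = {u. (v, u) \<in> adjacency G}"

definition component_vertex_sets :: "('v, 'e) multigraph \<Rightarrow> 'v set set" where
  "component_vertex_sets G = (\<lambda>v. {u. (v, u) \<in> (adjacency G)\<^sup>*}) ` verts G"

text \<open>
  The edge \<open>es ! i\<close> joins \<open>vs ! i\<close> to its cyclic successor; length 2 is a pair of parallel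
  edges and length 1 a loop.
\<close>

definition is_cycle :: "('v, 'e) multigraph \<Rightarrow> 'v list \<Rightarrow> 'e list \<Rightarrow> bool" where
  "is_cycle G vs es \<longleftrightarrow>
     vs \<noteq> [] \<and> length es = length vs \<and> distinct vs \<and> distinct es \<and>
     set vs \<subseteq> verts G \<and> set es \<subseteq> edges G \<and>
     (\<forall>i < length vs. ends G (es ! i) = {vs ! i, vs ! (Suc i mod length vs)})"

definition forest :: "('v, 'e) multigraph \<Rightarrow> bool" where
  "forest G \<longleftrightarrow> \<not> (\<exists>vs es. is_cycle G vs es)"

definition forest_partition :: "('v, 'e) multigraph \<Rightarrow> 'v set \<Rightarrow> 'v set \<Rightarrow> bool" where
  "forest_partition G M F \<longleftrightarrow>
     M \<union> F = verts G \<and> M \<inter> F = {} \<and> forest (induced G M) \<and> forest (induced G F)"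

definition DF_coloring ::
  "nat \<Rightarrow> ('v \<Rightarrow> nat) \<Rightarrow> ('v, 'e) multigraph \<Rightarrow> 'v set \<Rightarrow> 'v set \<Rightarrow> bool" where
  "DF_coloring D w G M F \<longleftrightarrow>
     forest_partition G M F \<and> (\<forall>v \<in> M. w v + card (neighbors G v \<inter> M) \<le> D + 1)"

definition DFe_coloring ::
  "nat \<Rightarrow> ('v \<Rightarrow> nat) \<Rightarrow> ('v, 'e) multigraph \<Rightarrow> 'v set \<Rightarrow> 'v set \<Rightarrow> bool" where
  "DFe_coloring D w G M F \<longleftrightarrow>
     forest_partition G M F \<and>
     (\<forall>C \<in> component_vertex_sets (induced G M). (\<Sum>v\<in>C. w v) \<le> D + 1)"

definition DF_critical :: "nat \<Rightarrow> ('v \<Rightarrow> nat) \<Rightarrow> ('v, 'e) multigraph \<Rightarrow> bool" where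
  "DF_critical D w G \<longleftrightarrow>
     \<not> (\<exists>M F. DF_coloring D w G M F) \<and>
     (\<forall>H. proper_subgraph H G \<longrightarrow> (\<exists>M F. DF_coloring D w H M F))"

definition DFe_critical :: "nat \<Rightarrow> ('v \<Rightarrow> nat) \<Rightarrow> ('v, 'e) multigraph \<Rightarrow> bool" where
  "DFe_critical D w G \<longleftrightarrow>
     \<not> (\<exists>M F. DFe_coloring D w G M F) \<and>
     (\<forall>H. proper_subgraph H G \<longrightarrow> (\<exists>M F. DFe_coloring D w H M F))"

definition capacity :: "nat \<Rightarrow> ('v \<Rightarrow> nat) \<Rightarrow> 'v \<Rightarrow> int" where
  "capacity D w v = int D + 2 - int (w v)"

definition potential :: "('v, 'e) multigraph \<Rightarrow> ('v \<Rightarrow> int) \<Rightarrow> int \<Rightarrow> 'v set \<Rightarrow> int" where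
  "potential G \<rho> \<rho>\<^sub>e A = (\<Sum>v\<in>A. \<rho> v) - \<rho>\<^sub>e * int (card (edges (induced G A)))"

end

theory Submission imports Defs begin

text \<open>
  Induct on the number of vertices and suppose that a critical graph has potential above the
  claimed bound. Gap lemma: color a proper vertex set \<open>A\<close> of least potential, with some
  capacity held in reserve at one vertex \<open>y\<close>, shrink its \<open>F\<close>-part to one vertex of weight
  \<open>D + 2\<close> (to two adjacent ones for simple graphs), force the outside neighbors of its
  \<open>M\<close>-part into \<open>F\<close>, and color the rest; the coloring exists unless \<open>A\<close> has large potential.
  Hence every small perturbation of a proper subgraph is still colorable. Raising the weights
  of the neighbors of a degree-three vertex \<open>v\<close> and coloring \<open>G - v\<close> excludes such \<open>v\<close>
  with large capacity, and summing \<open>2 * \<rho>(v) - \<rho>\<^sub>e * deg v\<close> over the vertices finishes all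
  cases but one. When \<open>D + 1 = 2 * H\<close> and \<open>M\<close>-components are bounded (or \<open>D = 1\<close>),
  degree-three vertices of weight \<open>H\<close> survive; their neighbors have degree at least four,
  and a neighbor of degree four and weight one has at most two of them, so a discharging
  argument leaves a single five-vertex configuration, which is colorable.
\<close>

section \<open>Forests as edge sets\<close>

definition acyc :: "'e set \<Rightarrow> ('e \<Rightarrow> 'v set) \<Rightarrow> bool" where
  "acyc E g \<longleftrightarrow> (\<forall>S\<subseteq>E. S \<noteq> {} \<longrightarrow> (\<exists>v. card {e\<in>S. v \<in> g e} = 1))"

definition edges_in :: "'e set \<Rightarrow> ('e \<Rightarrow> 'v set) \<Rightarrow> 'v set \<Rightarrow> 'e set" where
  "edges_in E g A = {e\<in>E. g e \<subseteq> A}"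

definition wf_graph :: "'v set \<Rightarrow> 'e set \<Rightarrow> ('e \<Rightarrow> 'v set) \<Rightarrow> bool" where
  "wf_graph V E g \<longleftrightarrow> finite V \<and> finite E \<and> (\<forall>e\<in>E. g e \<subseteq> V \<and> card (g e) = 2)"

lemma card2_other:
  assumes "card A = 2" "v \<in> A"
  obtains v' where "A = {v, v'}" "v' \<noteq> v"
proof -
  obtain x y where xy: "A = {x, y}" "x \<noteq> y" using assms(1) by (auto simp: card_2_iff)
  show ?thesis
  proof (cases "v = x")
    case True then show ?thesis using that[of y] xy by simp
  next
    case False
    then have "v = y" using assms(2) xy by simp
    then show ?thesis using that[of x] xy by (simp add: insert_commute)
  qed
qed

lemma acyc_mono: "acyc E g \<Longrightarrow> E' \<subseteq> E \<Longrightarrow> (\<And>e. e \<in> E' \<Longrightarrow> g' e = g e) \<Longrightarrow> acyc E' g'"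
  unfolding acyc_def
proof (intro allI impI)
  fix S assume a: "\<forall>S\<subseteq>E. S \<noteq> {} \<longrightarrow> (\<exists>v. card {e \<in> S. v \<in> g e} = 1)" "E' \<subseteq> E"
    and eq: "\<And>e. e \<in> E' \<Longrightarrow> g' e = g e" and S: "S \<subseteq> E'" "S \<noteq> {}"
  then obtain v where v: "card {e \<in> S. v \<in> g e} = 1" by (meson subset_trans)
  have "{e \<in> S. v \<in> g' e} = {e \<in> S. v \<in> g e}" using S eq by auto
  then show "\<exists>v. card {e \<in> S. v \<in> g' e} = 1" using v by metis
qed

lemma acycE:
  assumes "acyc E g" "S \<subseteq> E" "S \<noteq> {}"
  obtains v where "card {e\<in>S. v \<in> g e} = 1"
  using assms unfolding acyc_def by blast

lemma acyc_leaf_other: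
  assumes "acyc E g" "S \<subseteq> E" "S \<noteq> {}" "finite S" "\<And>e. e \<in> S \<Longrightarrow> card (g e) = 2"
  shows "\<exists>v. v \<noteq> a \<and> card {e\<in>S. v \<in> g e} = 1"
  using assms(2-)
proof (induction "card S" arbitrary: S a rule: less_induct)
  case less
  obtain v where v: "card {e\<in>S. v \<in> g e} = 1" using acycE[OF assms(1) less.prems(1,2)] .
  show ?case
  proof (cases "v = a")
    case False then show ?thesis using v by blast
  next
    case True
    obtain e where e: "{e\<in>S. v \<in> g e} = {e}" using v card_1_singletonE by blast
    have eS: "e \<in> S" "v \<in> g e" using e by auto
    have "card (g e) = 2" using less.prems(4) eS by auto
    then obtain v' where v': "g e = {v, v'}" "v' \<noteq> v"
      using eS(2) card2_other by metis
    show ?thesis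
    proof (cases "S = {e}")
      case True
      then have "{x\<in>S. v' \<in> g x} = {e}" using v' by auto
      then have "card {x\<in>S. v' \<in> g x} = 1" by simp
      then show ?thesis using v'(2) \<open>v = a\<close> by blast
    next
      case False
      let ?S = "S - {e}"
      have ne: "?S \<noteq> {}" using False eS by auto
      have "card ?S < card S" using eS less.prems(3) by (meson card_Diff1_less)
      then obtain x where x: "x \<noteq> v'" "card {e\<in>?S. x \<in> g e} = 1"
        using less.hyps[of ?S v'] ne less.prems by auto
      have "x \<noteq> v"
      proof
        assume "x = v"
        then have "{y\<in>?S. x \<in> g y} = {}" using e by auto
        then have "card {y\<in>?S. x \<in> g y} = 0" by (simp only: card.empty)
      then show False using x(2) by linarith
      qed
      then have "{y\<in>S. x \<in> g y} = {y\<in>?S. x \<in> g y}" using v' x(1) by auto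
      then have "card {y\<in>S. x \<in> g y} = 1" using x(2) by simp
      then show ?thesis using \<open>x \<noteq> v\<close> \<open>v = a\<close> by blast
    qed
  qed
qed

lemma card_1_no: "card {e\<in>S. v \<in> g e} \<noteq> 1 \<Longrightarrow> finite S \<Longrightarrow> e \<in> S \<Longrightarrow> v \<in> g e \<Longrightarrow> \<exists>e'\<in>S. e' \<noteq> e \<and> v \<in> g e'"
proof (rule ccontr)
  assume a: "card {e\<in>S. v \<in> g e} \<noteq> 1" "e \<in> S" "v \<in> g e" "\<not> (\<exists>e'\<in>S. e' \<noteq> e \<and> v \<in> g e')"
  then have "{e\<in>S. v \<in> g e} = {e}" by auto
  then show False using a(1) by simp
qed

lemma is_cycle_two_edges:
  assumes "is_cycle G vs es" "loopless_multigraph G" "e \<in> set es" "v \<in> ends G e"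
  shows "\<exists>e'\<in>set es. e' \<noteq> e \<and> v \<in> ends G e'"
proof -
  let ?n = "length vs"
  have c: "vs \<noteq> []" "length es = ?n" "distinct vs" "distinct es" "set es \<subseteq> edges G"
    "\<And>i. i < ?n \<Longrightarrow> ends G (es ! i) = {vs ! i, vs ! (Suc i mod ?n)}"
    using assms(1) unfolding is_cycle_def by auto
  have n0: "?n > 0" using c by simp
  have two: "card (ends G x) = 2" if "x \<in> set es" for x
    using assms(2) c(5) that unfolding loopless_multigraph_def by auto
  have n2: "?n \<ge> 2"
  proof (rule ccontr)
    assume "\<not> ?n \<ge> 2"
    then have "?n = 1" using n0 by linarith
    then have "ends G (es ! 0) = {vs ! 0}" using c(6)[of 0] by simp
    moreover have "es ! 0 \<in> set es" using c(2) \<open>?n = 1\<close> by simp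
    ultimately show False using two by fastforce
  qed
  obtain i where i: "i < ?n" "e = es ! i" using assms(3) c(2) by (metis in_set_conv_nth)
  have suc_ne: "Suc i mod ?n \<noteq> i"
  proof (cases "Suc i < ?n")
    case False
    then have "Suc i = ?n" using i(1) by simp
    then show ?thesis using n2 by auto
  qed auto
  from assms(4) have "v = vs ! i \<or> v = vs ! (Suc i mod ?n)" using c(6)[OF i(1)] i by auto
  then show ?thesis
  proof
    assume v: "v = vs ! i"
    define j where "j = (i + ?n - 1) mod ?n"
    have j: "j < ?n" using n0 unfolding j_def by simp
    have sj: "Suc j mod ?n = i"
    proof -
      have "Suc j mod ?n = Suc (i + ?n - 1) mod ?n" unfolding j_def by (rule mod_Suc_eq)
      also have "Suc (i + ?n - 1) = i + ?n" using n0 by simp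
      finally show ?thesis using i(1) by simp
    qed
    have "j \<noteq> i" using sj suc_ne by auto
    then have "es ! j \<noteq> e" using i j c(2,4) by (simp add: nth_eq_iff_index_eq)
    moreover have "v \<in> ends G (es ! j)" using c(6)[OF j] sj v by simp
    ultimately show ?thesis using j c(2) by (metis nth_mem)
  next
    assume v: "v = vs ! (Suc i mod ?n)"
    define j where "j = Suc i mod ?n"
    have j: "j < ?n" using n0 unfolding j_def by simp
    have "j \<noteq> i" unfolding j_def by (rule suc_ne)
    then have "es ! j \<noteq> e" using i j c(2,4) by (simp add: nth_eq_iff_index_eq)
    moreover have "v \<in> ends G (es ! j)" using c(6)[OF j] v j_def by simp
    ultimately show ?thesis using j c(2) by (metis nth_mem)
  qed
qed

definition is_path :: "'e set \<Rightarrow> ('e \<Rightarrow> 'v set) \<Rightarrow> 'v list \<Rightarrow> 'e list \<Rightarrow> bool" where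
  "is_path S g vs es \<longleftrightarrow> distinct vs \<and> set es \<subseteq> S \<and> length vs = Suc (length es) \<and>
     (\<forall>i < length es. g (es ! i) = {vs ! i, vs ! Suc i})"

lemma cycle_of_min_degree_two:
  assumes fin: "finite V" "finite S" and S: "S \<noteq> {}"
    and two: "\<And>e. e \<in> S \<Longrightarrow> g e \<subseteq> V \<and> card (g e) = 2"
    and deg: "\<And>v e. e \<in> S \<Longrightarrow> v \<in> g e \<Longrightarrow> \<exists>e'\<in>S. e' \<noteq> e \<and> v \<in> g e'"
  shows "\<exists>vs es. vs \<noteq> [] \<and> length es = length vs \<and> distinct vs \<and> distinct es \<and> set vs \<subseteq> V \<and> set es \<subseteq> S \<and>
     (\<forall>i < length vs. g (es ! i) = {vs ! i, vs ! (Suc i mod length vs)})"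
proof -
  let ?P = "\<lambda>n. \<exists>vs es. is_path S g vs es \<and> set vs \<subseteq> V \<and> length es = n"
  obtain e0 where e0: "e0 \<in> S" using S by auto
  obtain a b where ab: "g e0 = {a,b}" "a \<noteq> b" using two[OF e0] by (auto simp: card_2_iff)
  have P1: "?P 1"
    by (rule exI[of _ "[a,b]"], rule exI[of _ "[e0]"]) (use ab e0 two[OF e0] in \<open>auto simp: is_path_def\<close>)
  have bd: "n \<le> card V" if "?P n" for n
  proof -
    from that obtain vs es where "is_path S g vs es" "set vs \<subseteq> V" "length es = n" by auto
    then have "Suc n = card (set vs)" by (simp add: is_path_def distinct_card)
    also have "\<dots> \<le> card V" using \<open>set vs \<subseteq> V\<close> fin by (simp add: card_mono)
    finally show ?thesis by simp
  qed
  define n where "n = (GREATEST n. ?P n)"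
  have n: "?P n" "\<And>m. ?P m \<Longrightarrow> m \<le> n"
    unfolding n_def using GreatestI_nat[of ?P 1 "card V", OF P1 bd] Greatest_le_nat[of ?P _ "card V", OF _ bd]
    by simp_all
  obtain vs es where p: "is_path S g vs es" "set vs \<subseteq> V" "length es = n" using n(1) by blast
  have n1: "n \<ge> 1" using n(2) P1 by blast
  have pp: "distinct vs" "set es \<subseteq> S" "length vs = Suc n" "\<And>i. i < n \<Longrightarrow> g (es ! i) = {vs ! i, vs ! Suc i}"
    using p unfolding is_path_def by auto
  define t where "t = vs ! n"
  let ?l = "es ! (n - 1)"
  have l: "?l \<in> S" using pp(2) p(3) n1 by (metis One_nat_def Suc_le_eq diff_less nth_mem subsetD zero_less_one)
  have tl: "t \<in> g ?l" using pp(4)[of "n-1"] n1 t_def by simp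
  obtain e' where e': "e' \<in> S" "e' \<noteq> ?l" "t \<in> g e'" using deg[OF l tl] by auto
  obtain t' where t': "g e' = {t, t'}" "t' \<noteq> t" using two[OF e'(1)] e'(3) card2_other by metis
  have tV: "t' \<in> V" using two[OF e'(1)] t' by auto
  have "t' \<in> set vs"
  proof (rule ccontr)
    assume a: "t' \<notin> set vs"
    have "is_path S g (vs @ [t']) (es @ [e'])"
      unfolding is_path_def using pp a e' p(3) t' t_def
      by (auto simp: nth_append less_Suc_eq)
    then have "?P (Suc n)" using p tV by (intro exI[of _ "vs @ [t']"] exI[of _ "es @ [e']"]) auto
    then show False using n(2) by fastforce
  qed
  then obtain j where j: "j < Suc n" "t' = vs ! j" using pp(3) by (metis in_set_conv_nth)
  have jn: "j < n" using j t' t_def by (metis less_antisym)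
  have tnot: "t \<notin> g (es ! i)" if "i < n - 1" for i
    using pp(4)[of i] that pp(1,3) t_def by (auto simp: nth_eq_iff_index_eq)
  have e'not: "e' \<noteq> es ! i" if "i < n" for i
  proof (cases "i = n - 1")
    case False
    then have "i < n - 1" using that by linarith
    then show ?thesis using tnot e' by metis
  qed (use e' in simp)
  have dist: "distinct es"
  proof (rule distinct_conv_nth[THEN iffD2], intro allI impI)
    fix i k assume ik: "i < length es" "k < length es" "i \<noteq> k"
    show "es ! i \<noteq> es ! k"
    proof
      assume "es ! i = es ! k"
      then have "{vs ! i, vs ! Suc i} = {vs ! k, vs ! Suc k}" using pp(4) ik p(3) by metis
      moreover have "i < Suc n" "k < Suc n" "Suc i < Suc n" "Suc k < Suc n" using ik p(3) by auto
      ultimately show False using ik(3) pp(1,3)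
        by (auto simp: doubleton_eq_iff nth_eq_iff_index_eq)
    qed
  qed
  let ?vs = "drop j vs" and ?es = "drop j es @ [e']"
  have "e' \<notin> set es" using e'not p(3) by (metis in_set_conv_nth)
  then have d: "distinct ?es" using dist by (auto dest: in_set_dropD)
  have len: "length ?es = length ?vs" using pp(3) p(3) jn by simp
  have "g (?es ! i) = {?vs ! i, ?vs ! (Suc i mod length ?vs)}" if i: "i < length ?vs" for i
  proof (cases "j + i < n")
    case True
    then have "i < length (drop j es)" using p(3) by simp
    then have "?es ! i = es ! (j + i)" using p(3) jn by (simp add: nth_append)
    then have "g (?es ! i) = {vs ! (j+i), vs ! Suc (j+i)}" using pp(4)[OF True] by simp
    moreover have "Suc i mod length ?vs = Suc i" using True pp(3) by simp
    ultimately show ?thesis using pp(3) jn by simp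
  next
    case False
    then have ni: "j + i = n" using i pp(3) by simp
    then have "i = length (drop j es)" using p(3) by simp
    then have "?es ! i = e'" by (metis nth_append_length)
    moreover have "Suc i = length ?vs" using ni pp(3) jn by simp
    then have "Suc i mod length ?vs = 0" by (metis mod_self)
    ultimately show ?thesis using t' ni pp(3) jn j t_def by simp
  qed
  then show ?thesis using d len jn pp(1,2,3) p(2) e'
    by (intro exI[of _ ?vs] exI[of _ ?es]) (auto dest: in_set_dropD)
qed

lemma forest_iff_acyc:
  assumes "loopless_multigraph G"
  shows "forest G \<longleftrightarrow> acyc (edges G) (ends G)"
proof
  assume f: "forest G"
  show "acyc (edges G) (ends G)"
    unfolding acyc_def
  proof (intro allI impI, rule ccontr)
    fix S assume S: "S \<subseteq> edges G" "S \<noteq> {}" and n: "\<not> (\<exists>v. card {e \<in> S. v \<in> ends G e} = 1)"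
    have fin: "finite S" using S assms finite_subset unfolding loopless_multigraph_def by blast
    have dg: "\<exists>e'\<in>S. e' \<noteq> e \<and> v \<in> ends G e'" if "e \<in> S" "v \<in> ends G e" for v e
      using card_1_no[of S v "ends G" e] n fin that by blast
    have "\<exists>vs es. vs \<noteq> [] \<and> length es = length vs \<and> distinct vs \<and> distinct es \<and> set vs \<subseteq> verts G \<and> set es \<subseteq> S \<and>
     (\<forall>i < length vs. ends G (es ! i) = {vs ! i, vs ! (Suc i mod length vs)})"
      by (rule cycle_of_min_degree_two[OF _ fin S(2)])
         (use S assms dg in \<open>auto simp: loopless_multigraph_def\<close>)
    then show False using f S unfolding forest_def is_cycle_def by (meson subset_trans)
  qed
next
  assume a: "acyc (edges G) (ends G)"
  show "forest G"
    unfolding forest_def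
  proof
    assume "\<exists>vs es. is_cycle G vs es"
    then obtain vs es where c: "is_cycle G vs es" by auto
    then have "set es \<subseteq> edges G" "set es \<noteq> {}" unfolding is_cycle_def by auto
    then obtain v where "card {e\<in>set es. v \<in> ends G e} = 1" using acycE[OF a] by metis
    then obtain e where e: "{e\<in>set es. v \<in> ends G e} = {e}" using card_1_singletonE by blast
    then show False using is_cycle_two_edges[OF c assms, of e v] by auto
  qed
qed

definition pot :: "int \<Rightarrow> (nat \<Rightarrow> int) \<Rightarrow> 'e set \<Rightarrow> ('e \<Rightarrow> 'v set) \<Rightarrow> ('v \<Rightarrow> nat) \<Rightarrow> 'v set \<Rightarrow> int" where
  "pot \<epsilon> f E g w A = (\<Sum>v\<in>A. f (w v)) - \<epsilon> * int (card (edges_in E g A))"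

definition between :: "'e set \<Rightarrow> ('e \<Rightarrow> 'v set) \<Rightarrow> 'v set \<Rightarrow> 'v set \<Rightarrow> 'e set" where
  "between E g B C = {ed\<in>E. \<exists>b\<in>B. \<exists>c\<in>C. g ed = {b, c}}"

section \<open>Contraction of a colored vertex set\<close>

text \<open>
  \<open>X\<close> replaces the \<open>F\<close>-part \<open>FA\<close> of a colored set \<open>A\<close> with complement \<open>W\<close>: forests on
  \<open>X\<close> together with a part of \<open>W\<close> give forests on \<open>FA\<close> together with that part, and \<open>X\<close>, whose
  vertices will have potential \<open>\<epsilon> - 1\<close>, loses no edges that are relevant for potentials
  except for the constant \<open>px\<close>.
\<close>

definition forest_transfer ::
  "'e set \<Rightarrow> ('e \<Rightarrow> 'v set) \<Rightarrow> 'v set \<Rightarrow> 'v set \<Rightarrow> 'v set \<Rightarrow> 'e set \<Rightarrow> ('e \<Rightarrow> 'v set) \<Rightarrow> bool" where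
  "forest_transfer E g W FA X E' g' \<longleftrightarrow>
     (\<forall>F'\<subseteq>W. acyc (edges_in E' g' (F' \<union> X)) g' \<longrightarrow>
        (\<forall>S\<subseteq>edges_in E g (F' \<union> FA). S \<noteq> {} \<longrightarrow> (\<forall>ed\<in>S. g ed \<inter> F' \<noteq> {}) \<longrightarrow>
           (\<exists>v\<in>F'. card {ed\<in>S. v \<in> g ed} = 1)))"

definition count_transfer ::
  "int \<Rightarrow> int \<Rightarrow> 'e set \<Rightarrow> ('e \<Rightarrow> 'v set) \<Rightarrow> 'v set \<Rightarrow> 'v set \<Rightarrow> 'v set \<Rightarrow> 'e set \<Rightarrow> ('e \<Rightarrow> 'v set) \<Rightarrow> bool" where
  "count_transfer \<epsilon> px E g W FA X E' g' \<longleftrightarrow>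
     (\<forall>B\<subseteq>W. \<forall>X'\<subseteq>X. X' \<noteq> {} \<longrightarrow>
        px - \<epsilon> * int (card (edges_in E g B)) - \<epsilon> * int (card (between E g B FA)) \<le>
        (\<epsilon> - 1) * int (card X') - \<epsilon> * int (card (edges_in E' g' (B \<union> X'))))"

definition contraction ::
  "int \<Rightarrow> int \<Rightarrow> 'v set \<Rightarrow> 'e set \<Rightarrow> ('e \<Rightarrow> 'v set) \<Rightarrow> 'v set \<Rightarrow> 'v set \<Rightarrow> 'v set \<Rightarrow> 'e set \<Rightarrow> ('e \<Rightarrow> 'v set) \<Rightarrow> bool" where
  "contraction \<epsilon> px V E g A FA X E' g' \<longleftrightarrow>
     X \<subseteq> A \<and> card X < card A \<and> wf_graph (V - A \<union> X) E' g' \<and>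
     edges_in E' g' (V - A) = edges_in E g (V - A) \<and> (\<forall>ed\<in>edges_in E g (V - A). g' ed = g ed) \<and>
     forest_transfer E g (V - A) FA X E' g' \<and> count_transfer \<epsilon> px E g (V - A) FA X E' g'"

lemma edges_in_mono: "A \<subseteq> B \<Longrightarrow> edges_in E g A \<subseteq> edges_in E g B"
  by (auto simp: edges_in_def)

lemma edges_in_sub: "edges_in E g A \<subseteq> E"
  by (auto simp: edges_in_def)

lemma wf_graph_finE: "wf_graph V E g \<Longrightarrow> finite E"
  by (auto simp: wf_graph_def)

lemma acyc_join:
  assumes wf: "\<And>ed. ed \<in> E \<Longrightarrow> card (g ed) = 2" "finite E"
    and M: "M1 \<inter> M2 = {}" "acyc (edges_in E g M1) g" "acyc (edges_in E g M2) g"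
    and one: "\<And>a b. a \<in> E \<Longrightarrow> b \<in> E \<Longrightarrow> g a \<subseteq> M1 \<union> M2 \<Longrightarrow> g b \<subseteq> M1 \<union> M2 \<Longrightarrow> g a \<inter> M1 \<noteq> {} \<Longrightarrow> g a \<inter> M2 \<noteq> {} \<Longrightarrow>
       g b \<inter> M1 \<noteq> {} \<Longrightarrow> g b \<inter> M2 \<noteq> {} \<Longrightarrow> a = b"
  shows "acyc (edges_in E g (M1 \<union> M2)) g"
  unfolding acyc_def
proof (intro allI impI)
  fix S assume S: "S \<subseteq> edges_in E g (M1 \<union> M2)" "S \<noteq> {}"
  let ?cr = "{ed\<in>S. g ed \<inter> M1 \<noteq> {} \<and> g ed \<inter> M2 \<noteq> {}}"
  have finS: "finite S" using S wf(2) by (meson edges_in_sub finite_subset)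
  have oneS: "\<And>a b. a \<in> S \<Longrightarrow> b \<in> S \<Longrightarrow> g a \<inter> M1 \<noteq> {} \<Longrightarrow> g a \<inter> M2 \<noteq> {} \<Longrightarrow> g b \<inter> M1 \<noteq> {} \<Longrightarrow> g b \<inter> M2 \<noteq> {} \<Longrightarrow> a = b"
    using one S by (simp add: edges_in_def subset_iff)
  have key: "\<exists>v. card {ed\<in>S. v \<in> g ed} = 1"
    if N: "acyc (edges_in E g N) g" "N \<inter> N' = {}" "N \<union> N' = M1 \<union> M2" "S \<inter> edges_in E g N \<noteq> {}"
      and N1: "\<And>a b. a \<in> S \<Longrightarrow> b \<in> S \<Longrightarrow> g a \<inter> N \<noteq> {} \<Longrightarrow> g a \<inter> N' \<noteq> {} \<Longrightarrow> g b \<inter> N \<noteq> {} \<Longrightarrow> g b \<inter> N' \<noteq> {} \<Longrightarrow> a = b" for N N'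
  proof -
    have "\<exists>y. \<forall>ed\<in>S. \<forall>v\<in>N. v \<noteq> y \<longrightarrow> v \<in> g ed \<longrightarrow> g ed \<subseteq> N"
    proof (cases "\<exists>a\<in>S. g a \<inter> N \<noteq> {} \<and> g a \<inter> N' \<noteq> {}")
      case True
      then obtain a where a: "a \<in> S" "g a \<inter> N \<noteq> {}" "g a \<inter> N' \<noteq> {}" by auto
      then obtain y where y: "y \<in> g a" "y \<in> N" by auto
      have ca: "card (g a) = 2" using a S wf(1) by (auto simp: edges_in_def)
      obtain y' where y': "g a = {y, y'}" "y' \<noteq> y" using card2_other[OF ca y(1)] by metis
      have "y' \<in> N'" using a y y' N(2) by auto
      have "g ed \<subseteq> N" if "ed \<in> S" "v \<in> N" "v \<noteq> y" "v \<in> g ed" for ed v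
      proof (rule ccontr)
        assume "\<not> g ed \<subseteq> N"
        moreover have "g ed \<subseteq> N \<union> N'" using that S N(3) by (auto simp: edges_in_def)
        ultimately have "g ed \<inter> N' \<noteq> {}" by auto
        then have "ed = a" using N1[of ed a] a that by auto
        then show False using that y' \<open>y' \<in> N'\<close> N(2) by auto
      qed
      then show ?thesis by blast
    next
      case False
      have "g ed \<subseteq> N" if "ed \<in> S" "v \<in> N" "v \<in> g ed" for ed v
      proof -
        have "g ed \<inter> N' = {}" using False that by blast
        moreover have "g ed \<subseteq> N \<union> N'" using that S N(3) by (auto simp: edges_in_def)
        ultimately show ?thesis by auto
      qed
      then show ?thesis by blast
    qed
    then obtain y where y: "\<And>ed v. ed \<in> S \<Longrightarrow> v \<in> N \<Longrightarrow> v \<noteq> y \<Longrightarrow> v \<in> g ed \<Longrightarrow> g ed \<subseteq> N" by blast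
    let ?T = "S \<inter> edges_in E g N"
    obtain v where v: "v \<noteq> y" "card {ed\<in>?T. v \<in> g ed} = 1"
      using acyc_leaf_other[OF N(1), of ?T y] N(4) finS wf(1) by (auto simp: edges_in_def)
    then obtain ed where "{ed\<in>?T. v \<in> g ed} = {ed}" using card_1_singletonE by blast
    then have "v \<in> N" by (auto simp: edges_in_def)
    then have "{ed\<in>S. v \<in> g ed} = {ed\<in>?T. v \<in> g ed}"
      using y[OF _ \<open>v \<in> N\<close> v(1)] S by (auto simp: edges_in_def)
    then have "card {ed\<in>S. v \<in> g ed} = 1" using v(2) by simp
    then show ?thesis by blast
  qed
  show "\<exists>v. card {ed\<in>S. v \<in> g ed} = 1"
  proof (cases "S \<inter> edges_in E g M1 = {} \<and> S \<inter> edges_in E g M2 = {}")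
    case False
    then show ?thesis
    proof (cases "S \<inter> edges_in E g M1 = {}")
      case True
      show ?thesis
      proof (rule key[OF M(3), of M1])
        show "S \<inter> edges_in E g M2 \<noteq> {}" using False True by auto
        show "M2 \<inter> M1 = {}" "M2 \<union> M1 = M1 \<union> M2" using M(1) by auto
      qed (rule oneS, assumption+)
    next
      case False
      then show ?thesis
        by (rule key[OF M(2) M(1) refl _ oneS])
    qed
  next
    case True
    have cr: "g a \<inter> M1 \<noteq> {} \<and> g a \<inter> M2 \<noteq> {}" if "a \<in> S" for a
    proof -
      have "a \<in> E" "g a \<subseteq> M1 \<union> M2" using that S by (auto simp: edges_in_def)
      moreover have "\<not> g a \<subseteq> M1" "\<not> g a \<subseteq> M2" using that True calculation(1) by (auto simp: edges_in_def)
      ultimately show ?thesis by blast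
    qed
    obtain a where a: "a \<in> S" using S by auto
    then obtain y where "y \<in> g a" using cr by auto
    moreover have "b = a" if "b \<in> S" for b using oneS[OF that a] cr[OF that] cr[OF a] by blast
    ultimately have "{ed\<in>S. y \<in> g ed} = {a}" using a by blast
    then have "card {ed\<in>S. y \<in> g ed} = 1" by simp
    then show ?thesis by blast
  qed
qed

lemma acyc_leaf:
  assumes "acyc (edges_in E g F) g" "card {ed\<in>E. v \<in> g ed \<and> g ed \<subseteq> insert v F} \<le> 1" "finite E"
  shows "acyc (edges_in E g (insert v F)) g"
  unfolding acyc_def
proof (intro allI impI)
  fix S assume S: "S \<subseteq> edges_in E g (insert v F)" "S \<noteq> {}"
  show "\<exists>v. card {ed\<in>S. v \<in> g ed} = 1"
  proof (cases "\<exists>ed\<in>S. v \<in> g ed")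
    case True
    have "{ed\<in>S. v \<in> g ed} \<subseteq> {ed\<in>E. v \<in> g ed \<and> g ed \<subseteq> insert v F}" using S by (auto simp: edges_in_def)
    then have "card {ed\<in>S. v \<in> g ed} \<le> card {ed\<in>E. v \<in> g ed \<and> g ed \<subseteq> insert v F}"
      using assms(3) by (intro card_mono) auto
    then have "card {ed\<in>S. v \<in> g ed} \<le> 1" using assms(2) by linarith
    moreover have "card {ed\<in>S. v \<in> g ed} \<noteq> 0"
    proof -
      have "finite S" using S assms(3) by (meson edges_in_sub finite_subset)
      then show ?thesis using True by auto
    qed
    ultimately show ?thesis by (intro exI[of _ v]) linarith
  next
    case False
    then have "S \<subseteq> edges_in E g F" using S by (auto simp: edges_in_def)
    then show ?thesis using acycE[OF assms(1) _ S(2)] by blast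
  qed
qed

lemma acyc_subdivide:
  assumes "acyc (insert a S) g'" "\<And>ed. ed \<in> S \<Longrightarrow> g' ed = g ed \<and> v \<notin> g ed"
    and "g' a = {p, q}" "a \<notin> S" "p \<noteq> q" "v \<noteq> p" "v \<noteq> q"
    and "g a1 = {v, p}" "g a2 = {v, q}" "finite S"
  shows "acyc (insert a1 (insert a2 S)) g"
  unfolding acyc_def
proof (intro allI impI)
  fix T assume T: "T \<subseteq> insert a1 (insert a2 S)" "T \<noteq> {}"
  have a12: "a1 \<noteq> a2" using assms by (auto simp: doubleton_eq_iff)
  have n12: "a1 \<notin> S" "a2 \<notin> S" using assms(2)[of a1] assms(2)[of a2] assms(8,9) by auto
  show "\<exists>v. card {ed\<in>T. v \<in> g ed} = 1"
  proof (cases "a1 \<in> T \<and> a2 \<in> T")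
    case False
    show ?thesis
    proof (cases "a1 \<in> T \<or> a2 \<in> T")
      case True
      then obtain b where b: "b \<in> T" "b = a1 \<or> b = a2" by auto
      then have "{ed\<in>T. v \<in> g ed} = {b}" using False T assms(2,8,9) by auto
      then have "card {ed\<in>T. v \<in> g ed} = 1" by simp
      then show ?thesis by blast
    next
      case False
      then have TS: "T \<subseteq> S" using T by auto
      then obtain x where "card {ed\<in>T. x \<in> g' ed} = 1"
        using acycE[OF assms(1), of T] T(2) subset_insertI2[OF TS, of a] by blast
      moreover have "{ed\<in>T. x \<in> g' ed} = {ed\<in>T. x \<in> g ed}" using TS assms(2) by auto
      ultimately have "card {ed\<in>T. x \<in> g ed} = 1" by simp
      then show ?thesis by blast
    qed
  next
    case True
    define T' where "T' = insert a (T \<inter> S)"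
    have "T' \<subseteq> insert a S" "T' \<noteq> {}" unfolding T'_def by auto
    then obtain x where x: "card {ed\<in>T'. x \<in> g' ed} = 1" using acycE[OF assms(1)] by blast
    then obtain b where b: "{ed\<in>T'. x \<in> g' ed} = {b}" using card_1_singletonE by blast
    then have "b \<in> T'" "x \<in> g' b" by blast+
    then have xv: "x \<noteq> v" using assms(2)[of b] assms(3,6,7) unfolding T'_def by auto
    have eqS: "{ed\<in>T\<inter>S. x \<in> g' ed} = {ed\<in>T\<inter>S. x \<in> g ed}" using assms(2) by auto
    have fin0: "finite (T \<inter> S)" using assms(10) by auto
    have fin: "finite {ed\<in>T. ed \<in> S \<and> P ed}" for P by (rule finite_subset[OF _ fin0]) auto
    have Teq: "T = insert a1 (insert a2 (T \<inter> S))" using True T by auto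
    have c: "card {ed\<in>T. x \<in> g ed} = card {ed\<in>T\<inter>S. x \<in> g ed} + (if x = p \<or> x = q then 1 else 0)"
    proof -
      have "{ed\<in>T. x \<in> g ed} = {ed\<in>T\<inter>S. x \<in> g ed} \<union> (if x = p then {a1} else if x = q then {a2} else {})"
        (is "_ = ?K \<union> ?Z")
        using Teq xv assms(5,8,9) by auto
      moreover have "card (?K \<union> ?Z) = card ?K + card ?Z"
        by (rule card_Un_disjoint) (use fin n12 in auto)
      ultimately show ?thesis by simp
    qed
    have c': "card {ed\<in>T'. x \<in> g' ed} = card {ed\<in>T\<inter>S. x \<in> g' ed} + (if x = p \<or> x = q then 1 else 0)"
    proof -
      have "{ed\<in>T'. x \<in> g' ed} = {ed\<in>T\<inter>S. x \<in> g' ed} \<union> (if x = p \<or> x = q then {a} else {})"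
        (is "_ = ?K \<union> ?Z")
        unfolding T'_def using assms(3) by auto
      moreover have "card (?K \<union> ?Z) = card ?K + card ?Z"
        by (rule card_Un_disjoint) (use fin assms(4) in auto)
      ultimately show ?thesis by simp
    qed
    show ?thesis using x c c' eqS by (intro exI[of _ x]) simp
  qed
qed

section \<open>Critical graphs and potentials\<close>

text \<open>
  \<open>f n\<close> is the potential of a vertex of weight \<open>n\<close>, \<open>\<epsilon>\<close> the weight of an edge, and \<open>h k\<close>
  bounds the loss when a weight is raised by \<open>k\<close>, truncated at \<open>D + 2\<close> (a vertex of that
  weight is forced into \<open>F\<close>). The goal is potential at most \<open>- \<tau>\<close> for critical graphs, and
  proper subsets with at least two vertices are to have potential above \<open>gmax\<close>. The class
  \<open>cls\<close> is that of all multigraphs or of simple graphs; \<open>big\<close> describes the sets that can be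
  contracted within the class.
\<close>

locale potential_scheme =
  fixes D :: nat and \<epsilon> \<tau> gmax px :: int and f h :: "nat \<Rightarrow> int"
    and cls :: "'v set \<Rightarrow> 'e set \<Rightarrow> ('e \<Rightarrow> 'v set) \<Rightarrow> bool"
    and big :: "'e set \<Rightarrow> ('e \<Rightarrow> 'v set) \<Rightarrow> 'v set \<Rightarrow> bool"
  assumes f_top: "f (D + 2) = \<epsilon> - 1"
    and f_bounds: "1 \<le> n \<Longrightarrow> n \<le> D + 2 \<Longrightarrow> \<epsilon> - 1 \<le> f n \<and> f n \<le> 2 * \<epsilon> - 1"
    and f_raise: "1 \<le> n \<Longrightarrow> n \<le> D + 2 \<Longrightarrow> f n - f (min (n + k) (D + 2)) \<le> h k"
    and h_nonneg: "0 \<le> h k" and h_top: "h (D + 2) \<le> \<epsilon>"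
    and eps: "2 \<le> \<epsilon>" and tau: "2 \<le> \<tau>" and px: "0 \<le> px" "gmax \<le> px" "gmax \<le> \<epsilon> - 1"
    and cls_sub: "cls V E g \<Longrightarrow> V' \<subseteq> V \<Longrightarrow> E' \<subseteq> E \<Longrightarrow> cls V' E' g"
    and contr: "wf_graph V E g \<Longrightarrow> cls V E g \<Longrightarrow> A \<subseteq> V \<Longrightarrow> big E g A \<Longrightarrow> FA \<subseteq> A \<Longrightarrow>
        \<exists>X E' g'. contraction \<epsilon> px V E g A FA X E' g' \<and> cls (V - A \<union> X) E' g'"
    and big_pot: "wf_graph V E g \<Longrightarrow> cls V E g \<Longrightarrow> A \<subseteq> V \<Longrightarrow> \<forall>v\<in>V. 1 \<le> w v \<and> w v \<le> D + 2 \<Longrightarrow> 2 \<le> card A \<Longrightarrow>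
        pot \<epsilon> f E g w A \<le> gmax \<Longrightarrow> big E g A"

text \<open>
  \<open>good\<close> is the condition on the \<open>M\<close>-part; \<open>comb ky kz\<close> means that two good parts with
  reserves \<open>ky\<close> at \<open>y\<close> and \<open>kz\<close> at \<open>z\<close> may be joined by an edge \<open>yz\<close>.
\<close>

locale good_scheme =
  fixes D :: nat and good :: "'e set \<Rightarrow> ('e \<Rightarrow> 'v set) \<Rightarrow> ('v \<Rightarrow> nat) \<Rightarrow> 'v set \<Rightarrow> bool"
    and comb :: "nat \<Rightarrow> nat \<Rightarrow> bool"
  assumes comb0: "comb 0 (D + 2)"
    and good_mono: "good E g w M \<Longrightarrow> finite M \<Longrightarrow> M' \<subseteq> M \<Longrightarrow>
        (\<And>ed. ed \<in> E' \<Longrightarrow> g' ed \<subseteq> M' \<Longrightarrow> ed \<in> E \<and> g ed = g' ed) \<Longrightarrow>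
        (\<And>v. v \<in> M' \<Longrightarrow> w' v \<le> w v) \<Longrightarrow> good E' g' w' M'"
    and good_bound: "good E g w M \<Longrightarrow> finite M \<Longrightarrow> v \<in> M \<Longrightarrow> w v \<le> D + 1"
    and good_single: "(\<And>ed. ed \<in> E \<Longrightarrow> card (g ed) = 2) \<Longrightarrow> w v \<le> D + 1 \<Longrightarrow> good E g w {v}"
    and good_empty: "good E g w {}"
    and good_union: "finite M1 \<Longrightarrow> finite M2 \<Longrightarrow> M1 \<inter> M2 = {} \<Longrightarrow> good E g w M1 \<Longrightarrow> good E g w M2 \<Longrightarrow>
        (\<And>ed. ed \<in> E \<Longrightarrow> g ed \<subseteq> M1 \<union> M2 \<Longrightarrow> g ed \<subseteq> M1 \<or> g ed \<subseteq> M2) \<Longrightarrow> good E g w (M1 \<union> M2)"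
    and good_join: "finite M1 \<Longrightarrow> finite M2 \<Longrightarrow> M1 \<inter> M2 = {} \<Longrightarrow> y \<in> M1 \<Longrightarrow> z \<in> M2 \<Longrightarrow> comb ky kz \<Longrightarrow>
        good E g (w(y := w y + ky)) M1 \<Longrightarrow> good E g (w(z := w z + kz)) M2 \<Longrightarrow>
        (\<And>ed. ed \<in> E \<Longrightarrow> g ed \<subseteq> M1 \<union> M2 \<Longrightarrow> g ed \<subseteq> M1 \<or> g ed \<subseteq> M2 \<or> g ed = {y, z}) \<Longrightarrow> good E g w (M1 \<union> M2)"

locale forest_coloring = potential_scheme D \<epsilon> \<tau> gmax px f h cls big + good_scheme D good comb
  for D :: nat and \<epsilon> \<tau> gmax px :: int and f h :: "nat \<Rightarrow> int"
    and cls :: "'v set \<Rightarrow> 'e set \<Rightarrow> ('e \<Rightarrow> 'v set) \<Rightarrow> bool"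
    and big :: "'e set \<Rightarrow> ('e \<Rightarrow> 'v set) \<Rightarrow> 'v set \<Rightarrow> bool"
    and good :: "'e set \<Rightarrow> ('e \<Rightarrow> 'v set) \<Rightarrow> ('v \<Rightarrow> nat) \<Rightarrow> 'v set \<Rightarrow> bool"
    and comb :: "nat \<Rightarrow> nat \<Rightarrow> bool" +
  assumes pick: "1 \<le> \<gamma> \<Longrightarrow> \<gamma> \<le> gmax \<Longrightarrow> \<exists>ky kz. comb ky kz \<and> h ky < \<gamma> + \<tau> \<and> h kz \<le> \<epsilon> - \<gamma>"
begin

abbreviation "po \<equiv> pot \<epsilon> f"

definition colors :: "'e set \<Rightarrow> ('e \<Rightarrow> 'v set) \<Rightarrow> ('v \<Rightarrow> nat) \<Rightarrow> 'v set \<Rightarrow> 'v set \<Rightarrow> 'v set \<Rightarrow> bool" where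
  "colors E g w V M F \<longleftrightarrow> M \<union> F = V \<and> M \<inter> F = {} \<and> acyc (edges_in E g M) g \<and> acyc (edges_in E g F) g \<and> good E g w M"

definition col :: "'e set \<Rightarrow> ('e \<Rightarrow> 'v set) \<Rightarrow> ('v \<Rightarrow> nat) \<Rightarrow> 'v set \<Rightarrow> bool" where
  "col E g w V \<longleftrightarrow> (\<exists>M F. colors E g w V M F)"

definition range :: "('v \<Rightarrow> nat) \<Rightarrow> 'v set \<Rightarrow> bool" where
  "range w V \<longleftrightarrow> (\<forall>v\<in>V. 1 \<le> w v \<and> w v \<le> D + 2)"

definition crit :: "'v set \<Rightarrow> 'e set \<Rightarrow> ('e \<Rightarrow> 'v set) \<Rightarrow> ('v \<Rightarrow> nat) \<Rightarrow> bool" where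
  "crit V E g w \<longleftrightarrow> \<not> col E g w V \<and>
     (\<forall>V' E'. V' \<subseteq> V \<longrightarrow> E' \<subseteq> E \<longrightarrow> (\<forall>ed\<in>E'. g ed \<subseteq> V') \<longrightarrow> V' \<noteq> V \<or> E' \<noteq> E \<longrightarrow> col E' g w V')"

definition IH :: "nat \<Rightarrow> bool" where
  "IH n \<longleftrightarrow> (\<forall>V E g w. wf_graph V E g \<longrightarrow> cls V E g \<longrightarrow> range w V \<longrightarrow> card V < n \<longrightarrow> crit V E g w \<longrightarrow> po E g w V \<le> - \<tau>)"

lemma good_weaken:
  assumes "good E g w M" "finite M" "M' \<subseteq> M" "\<And>v. v \<in> M' \<Longrightarrow> w' v \<le> w v"
  shows "good E g w' M'"
proof (rule good_mono[OF assms(1-3) _ assms(4)])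
qed auto

lemma contraction_extend:
  assumes wf: "wf_graph V E g" and A: "A \<subseteq> V"
    and cA: "colors E g w A MA FA" "good E g (w(y := w y + ky)) MA"
    and yz: "comb ky kz" "y \<in> A" "z \<in> V - A"
    and con: "contraction \<epsilon> px V E g A FA X E' g'"
    and w'X: "\<And>v. v \<in> X \<Longrightarrow> w' v \<ge> D + 2"
    and w'1: "\<And>v. v \<in> V - A \<Longrightarrow> w v \<le> w' v"
    and w'2: "\<And>v ed m. v \<in> V - A \<Longrightarrow> ed \<in> E \<Longrightarrow> m \<in> MA \<Longrightarrow> g ed = {v, m} \<Longrightarrow>
        w' v \<ge> D + 2 \<or> (v = z \<and> m = y \<and> w' v \<ge> min (w v + kz) (D + 2) \<and>
          (\<forall>ed'\<in>E. \<forall>m'\<in>MA. g ed' = {z, m'} \<longrightarrow> ed' = ed))"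
    and col: "colors E' g' w' (V - A \<union> X) M' F'"
  shows "\<exists>M F. colors E g w V M F \<and> M \<inter> A = MA \<and> F \<inter> A = FA"
proof -
  have con': "X \<subseteq> A" "edges_in E' g' (V - A) = edges_in E g (V - A)"
     "\<And>ed. ed \<in> edges_in E g (V - A) \<Longrightarrow> g' ed = g ed" "wf_graph (V - A \<union> X) E' g'"
     "forest_transfer E g (V - A) FA X E' g'"
    using con by (simp_all add: contraction_def)
  have cM: "M' \<union> F' = V - A \<union> X" "M' \<inter> F' = {}" "acyc (edges_in E' g' M') g'" "acyc (edges_in E' g' F') g'" "good E' g' w' M'"
    using col unfolding colors_def by auto
  have cMA: "MA \<union> FA = A" "MA \<inter> FA = {}" "acyc (edges_in E g MA) g" "acyc (edges_in E g FA) g" "good E g w MA"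
    using cA unfolding colors_def by auto
  have finV: "finite V" "finite E" using wf by (auto simp: wf_graph_def)
  have fin: "finite MA" "finite M'" using cMA cM A finV con' by (auto intro: finite_subset simp: wf_graph_def)
  have bd: "w' v \<le> D + 1" if "v \<in> M'" for v using good_bound[OF cM(5) fin(2) that] .
  have XF: "X \<subseteq> F'" using cM(1) w'X bd by fastforce
  have M'W: "M' \<subseteq> V - A" using cM XF by auto
  define FW where "FW = F' - X"
  have FW: "FW \<subseteq> V - A" "F' = FW \<union> X" using cM XF unfolding FW_def by auto
  have card2: "\<And>ed. ed \<in> E \<Longrightarrow> card (g ed) = 2" using wf by (auto simp: wf_graph_def)
  have eqE: "edges_in E' g' N = edges_in E g N" "\<And>ed. ed \<in> edges_in E g N \<Longrightarrow> g' ed = g ed" if "N \<subseteq> V - A" for N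
  proof -
    show 1: "g' ed = g ed" if "ed \<in> edges_in E g N" for ed
      by (rule con'(3), rule subsetD[OF edges_in_mono[OF \<open>N \<subseteq> V - A\<close>] that])
    have "ed \<in> edges_in E' g' N \<longleftrightarrow> ed \<in> edges_in E g N" for ed
    proof
      assume a: "ed \<in> edges_in E' g' N"
      have "ed \<in> edges_in E' g' (V - A)" by (rule subsetD[OF edges_in_mono[OF that] a])
      then have "ed \<in> edges_in E g (V - A)" unfolding con'(2) .
      then show "ed \<in> edges_in E g N" using a con'(3)[of ed] by (simp add: edges_in_def)
    next
      assume a: "ed \<in> edges_in E g N"
      have "ed \<in> edges_in E g (V - A)" by (rule subsetD[OF edges_in_mono[OF that] a])
      then have "ed \<in> edges_in E' g' (V - A)" unfolding con'(2) .
      then show "ed \<in> edges_in E' g' N" using a 1[OF a] by (simp add: edges_in_def)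
    qed
    then show "edges_in E' g' N = edges_in E g N" by blast
  qed
  have acM': "acyc (edges_in E g M') g"
    by (rule acyc_mono[OF cM(3)]) (use eqE[OF M'W] in auto)
  have gM': "good E g w'' M'" if "\<And>v. v \<in> M' \<Longrightarrow> w'' v \<le> w' v" for w''
  proof (rule good_mono[OF cM(5) fin(2) subset_refl _ that])
    fix ed assume "ed \<in> E" "g ed \<subseteq> M'"
    then have "ed \<in> edges_in E g M'" by (auto simp: edges_in_def)
    then show "ed \<in> E' \<and> g' ed = g ed" using eqE[OF M'W] by (auto simp: edges_in_def)
  qed auto
  have cross: "g ed = {z, y} \<and> z \<in> M' \<and> y \<in> MA \<and> w' z \<ge> w z + kz \<and> (\<forall>ed'\<in>E. \<forall>m'\<in>MA. g ed' = {z, m'} \<longrightarrow> ed' = ed)"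
    if ed: "ed \<in> E" "g ed \<inter> MA \<noteq> {}" "g ed \<inter> M' \<noteq> {}" for ed
  proof -
    obtain v m where vm: "v \<in> M'" "m \<in> MA" "v \<in> g ed" "m \<in> g ed" using ed by auto
    have "v \<noteq> m" using vm M'W cMA(1) by auto
    then have gv: "g ed = {v, m}" using card2[OF ed(1)] vm card2_other by (metis insert_iff singletonD)
    then have "v = z \<and> m = y \<and> w' v \<ge> min (w v + kz) (D + 2) \<and> (\<forall>ed'\<in>E. \<forall>m'\<in>MA. g ed' = {z, m'} \<longrightarrow> ed' = ed)"
      using w'2[of v ed m] bd[OF vm(1)] vm M'W ed by auto
    moreover from this have "w' v \<ge> w v + kz" using bd[OF vm(1)] by auto
    ultimately show ?thesis using gv vm by auto
  qed
  have disj: "MA \<inter> M' = {}" using M'W cMA(1) by auto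
  have acM: "acyc (edges_in E g (MA \<union> M')) g"
  proof (rule acyc_join[OF card2 finV(2) disj cMA(3) acM'])
    fix a b assume "a \<in> E" "b \<in> E" "g a \<inter> MA \<noteq> {}" "g a \<inter> M' \<noteq> {}" "g b \<inter> MA \<noteq> {}" "g b \<inter> M' \<noteq> {}"
    then show "a = b" using cross[of a] cross[of b] by metis
  qed
  have gM: "good E g w (MA \<union> M')"
  proof (cases "\<exists>ed\<in>E. g ed \<inter> MA \<noteq> {} \<and> g ed \<inter> M' \<noteq> {}")
    case True
    then obtain ed where ed: "ed \<in> E" "g ed \<inter> MA \<noteq> {}" "g ed \<inter> M' \<noteq> {}" by auto
    note c = cross[OF ed]
    show ?thesis
    proof (rule good_join[OF fin disj _ _ yz(1) cA(2)])
      show "good E g (w(z := w z + kz)) M'" by (rule gM') (use c w'1 M'W in auto)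
      fix ed' assume "ed' \<in> E" "g ed' \<subseteq> MA \<union> M'"
      then show "g ed' \<subseteq> MA \<or> g ed' \<subseteq> M' \<or> g ed' = {y, z}"
        using cross[of ed'] by (cases "g ed' \<inter> MA \<noteq> {} \<and> g ed' \<inter> M' \<noteq> {}") auto
    qed (use c in auto)
  next
    case False
    show ?thesis
      by (rule good_union[OF fin disj cMA(5) gM']) (use False w'1 M'W in blast)+
  qed
  have acF: "acyc (edges_in E g (FA \<union> FW)) g"
    unfolding acyc_def
  proof (intro allI impI)
    fix S assume S: "S \<subseteq> edges_in E g (FA \<union> FW)" "S \<noteq> {}"
    let ?T = "{ed\<in>S. g ed \<inter> FW \<noteq> {}}"
    show "\<exists>v. card {ed \<in> S. v \<in> g ed} = 1"
    proof (cases "?T = {}")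
      case True
      then have "S \<subseteq> edges_in E g FA" using S by (auto simp: edges_in_def)
      then show ?thesis using acycE[OF cMA(4) _ S(2)] by blast
    next
      case False
      have "?T \<subseteq> edges_in E g (FW \<union> FA)" using S by (auto simp: Un_commute)
      then obtain v where v: "v \<in> FW" "card {ed\<in>?T. v \<in> g ed} = 1"
        using con'(5) FW(1) cM(4) FW(2) False unfolding forest_transfer_def by blast
      have "{ed\<in>?T. v \<in> g ed} = {ed\<in>S. v \<in> g ed}" using v(1) by auto
      then have "card {ed\<in>S. v \<in> g ed} = 1" using v(2) by simp
      then show ?thesis by blast
    qed
  qed
  have "MA \<union> M' \<union> (FA \<union> FW) = V" using cMA(1) cM(1) A FW XF con'(1) unfolding FW_def by blast
  moreover have "(MA \<union> M') \<inter> (FA \<union> FW) = {}" using cMA(1,2) cM(2) M'W FW by blast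
  ultimately have "colors E g w V (MA \<union> M') (FA \<union> FW)" unfolding colors_def using acM gM acF by blast
  moreover have "(MA \<union> M') \<inter> A = MA" "(FA \<union> FW) \<inter> A = FA" using cMA(1) M'W FW by auto
  ultimately show ?thesis by blast
qed

end

lemma finite_edges_in: "finite E \<Longrightarrow> finite (edges_in E g A)"
  by (simp add: edges_in_def)

lemma finite_between: "finite E \<Longrightarrow> finite (between E g A B)"
  by (simp add: between_def)

lemma card_between_sum:
  assumes "finite B" "finite E" "B \<inter> C = {}"
  shows "card (between E g B C) = (\<Sum>v\<in>B. card (between E g {v} C))"
proof -
  have "between E g B C = (\<Union>v\<in>B. between E g {v} C)" by (auto simp: between_def)
  also have "card \<dots> = (\<Sum>v\<in>B. card (between E g {v} C))"
  proof (rule card_UN_disjoint)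
    show "\<forall>i\<in>B. \<forall>j\<in>B. i \<noteq> j \<longrightarrow> between E g {i} C \<inter> between E g {j} C = {}"
      using assms(3) by (auto simp: between_def doubleton_eq_iff)
  qed (use assms finite_between in auto)
  finally show ?thesis .
qed

lemma card_edges_in_Un:
  assumes wf: "\<And>ed. ed \<in> E \<Longrightarrow> card (g ed) = 2" "finite E" and "A \<inter> B = {}" "MA \<union> FA = A" "MA \<inter> FA = {}"
  shows "card (edges_in E g (A \<union> B)) = card (edges_in E g A) + card (edges_in E g B)
      + card (between E g B MA) + card (between E g B FA)"
proof -
  have eq: "edges_in E g (A \<union> B) = (edges_in E g A \<union> edges_in E g B) \<union> (between E g B MA \<union> between E g B FA)"
  proof (intro equalityI subsetI)
    fix ed assume a: "ed \<in> edges_in E g (A \<union> B)"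
    then have c: "card (g ed) = 2" "g ed \<subseteq> A \<union> B" "ed \<in> E" using wf by (auto simp: edges_in_def)
    show "ed \<in> (edges_in E g A \<union> edges_in E g B) \<union> (between E g B MA \<union> between E g B FA)"
    proof (cases "g ed \<subseteq> A \<or> g ed \<subseteq> B")
      case False
      then obtain a b where ab: "a \<in> g ed" "b \<in> g ed" "a \<in> A" "b \<in> B" using c(2) by blast
      then have "a \<noteq> b" using assms(3) by auto
      then have "g ed = {b, a}" using c(1) ab card2_other by (metis insert_iff singletonD)
      then show ?thesis using ab c(3) assms(4) by (auto simp: between_def)
    qed (use c in \<open>auto simp: edges_in_def\<close>)
  next
    fix ed assume "ed \<in> (edges_in E g A \<union> edges_in E g B) \<union> (between E g B MA \<union> between E g B FA)"
    then show "ed \<in> edges_in E g (A \<union> B)" using assms(4) by (auto simp: edges_in_def between_def)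
  qed
  have ne: "g ed \<noteq> {}" if "ed \<in> E" for ed using wf(1)[OF that] by auto
  have "edges_in E g A \<inter> edges_in E g B = {}" using assms(3) ne by (fastforce simp: edges_in_def)
  moreover have "between E g B MA \<inter> between E g B FA = {}"
    using assms(3-5) by (auto simp: between_def doubleton_eq_iff)
  moreover have "(edges_in E g A \<union> edges_in E g B) \<inter> (between E g B MA \<union> between E g B FA) = {}"
    using assms(3,4) by (auto simp: between_def edges_in_def)
  ultimately show ?thesis unfolding eq
    using wf(2) by (simp add: card_Un_disjoint finite_edges_in finite_between)
qed

context forest_coloring begin

text \<open>
  Outside vertices with a neighbor in \<open>MA\<close> are forced into \<open>F\<close>, except for \<open>z\<close> if \<open>yz\<close> is its only
  edge to \<open>MA\<close>.
\<close>

definition cweight :: "'e set \<Rightarrow> ('e \<Rightarrow> 'v set) \<Rightarrow> ('v \<Rightarrow> nat) \<Rightarrow> 'v set \<Rightarrow> 'v set \<Rightarrow> 'v \<Rightarrow> 'v \<Rightarrow> nat \<Rightarrow> 'v \<Rightarrow> nat" where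
  "cweight E g w MA X y z kz v = (if v \<in> X then D + 2 else if between E g {v} MA = {} then w v
     else if v = z \<and> (\<exists>ed. between E g {v} MA = {ed} \<and> g ed = {z, y}) then min (w v + kz) (D + 2) else D + 2)"

lemma range_cweight: "range w V \<Longrightarrow> A \<subseteq> V \<Longrightarrow> X \<subseteq> A \<Longrightarrow> range (cweight E g w MA X y z kz) (V - A \<union> X)"
  by (auto simp: range_def cweight_def)

lemma pot_contract:
  fixes y z :: "'v" and kz :: nat
  assumes wf: "wf_graph V E g" and r: "range w V" and A: "A \<subseteq> V" "MA \<union> FA = A" "MA \<inter> FA = {}"
    and con: "contraction \<epsilon> px V E g A FA X E' g'" and B': "B' \<subseteq> V - A \<union> X"
  defines "w' \<equiv> cweight E g w MA X y z kz"
  shows "B' \<inter> X \<noteq> {} \<Longrightarrow> po E g w (A \<union> (B' - X)) \<le> po E g w A + po E' g' w' B' - px"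
    and "B' \<inter> X = {} \<Longrightarrow> po E g w (A \<union> B') \<le> po E g w A + po E' g' w' B' - \<epsilon> * int (card (between E g B' FA))"
    and "B' \<inter> X = {} \<Longrightarrow> z \<in> B' \<Longrightarrow> ed \<in> E \<Longrightarrow> g ed = {y, z} \<Longrightarrow> y \<in> A \<Longrightarrow>
        po E g w (A \<union> B') \<le> po E g w A + po E' g' w' B' - (\<epsilon> - h kz)"
proof -
  define B where "B = B' - X"
  have con': "X \<subseteq> A" "edges_in E' g' (V - A) = edges_in E g (V - A)"
     "\<And>ed. ed \<in> edges_in E g (V - A) \<Longrightarrow> g' ed = g ed" "wf_graph (V - A \<union> X) E' g'"
     "count_transfer \<epsilon> px E g (V - A) FA X E' g'"
    using con by (simp_all add: contraction_def)
  have fin: "finite V" "finite E" using wf by (auto simp: wf_graph_def)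
  have BW: "B \<subseteq> V - A" using B' con'(1) unfolding B_def by auto
  have finB: "finite B" using BW fin by (meson finite_Diff finite_subset)
  have card2: "\<And>ed. ed \<in> E \<Longrightarrow> card (g ed) = 2" using wf by (auto simp: wf_graph_def)
  have disj: "A \<inter> B = {}" using BW by auto
  define m where "m v = card (between E g {v} MA)" for v
  have fb: "finite (between E g S T)" for S T using finite_between[OF fin(2)] .
  have wB: "1 \<le> w v \<and> w v \<le> D + 2" if "v \<in> B" for v using r BW that by (auto simp: range_def)
  have cost: "f (w v) - f (w' v) \<le> \<epsilon> * int (m v)" if v: "v \<in> B" for v
  proof (cases "between E g {v} MA = {}")
    case True
    then show ?thesis using v con'(1) BW unfolding w'_def cweight_def m_def by auto
  next
    case False
    then have m1: "m v \<ge> 1" unfolding m_def using fb by (simp add: Suc_leI card_gt_0_iff)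
    have "1 \<le> w' v \<and> w' v \<le> D + 2" using wB[OF v] unfolding w'_def cweight_def by auto
    then have "f (w v) - f (w' v) \<le> \<epsilon>" using f_bounds[of "w v"] f_bounds[of "w' v"] wB[OF v] by force
    also have "\<epsilon> \<le> \<epsilon> * int (m v)" using m1 eps by (simp add: mult_le_cancel_left1)
    finally show ?thesis .
  qed
  have sm: "int (card (between E g B MA)) = (\<Sum>v\<in>B. int (m v))"
  proof -
    have "B \<inter> MA = {}" using disj A(2) by auto
    then show ?thesis using card_between_sum[OF finB fin(2), of MA g] unfolding m_def by simp
  qed
  have sumcost: "(\<Sum>v\<in>B. f (w v)) \<le> (\<Sum>v\<in>B. f (w' v)) + \<epsilon> * int (card (between E g B MA))"
  proof -
    have "(\<Sum>v\<in>B. f (w v)) \<le> (\<Sum>v\<in>B. f (w' v) + \<epsilon> * int (m v))"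
      by (rule sum_mono) (use cost in force)
    then show ?thesis by (simp add: sm sum.distrib sum_distrib_left)
  qed
  have potA: "po E g w (A \<union> B) = po E g w A + (\<Sum>v\<in>B. f (w v)) - \<epsilon> * int (card (edges_in E g B))
      - \<epsilon> * int (card (between E g B MA)) - \<epsilon> * int (card (between E g B FA))"
  proof -
    have "(\<Sum>v\<in>A\<union>B. f (w v)) = (\<Sum>v\<in>A. f (w v)) + (\<Sum>v\<in>B. f (w v))"
      by (rule sum.union_disjoint) (use finB disj A fin in \<open>auto intro: finite_subset\<close>)
    moreover have "card (edges_in E g (A \<union> B)) = card (edges_in E g A) + card (edges_in E g B)
      + card (between E g B MA) + card (between E g B FA)"
      by (rule card_edges_in_Un[OF card2 fin(2) disj A(2,3)])
    ultimately show ?thesis by (simp add: pot_def algebra_simps)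
  qed
  show 1: "po E g w (A \<union> (B' - X)) \<le> po E g w A + po E' g' w' B' - px" if "B' \<inter> X \<noteq> {}"
  proof -
    define X' where "X' = B' \<inter> X"
    have X': "X' \<subseteq> X" "X' \<noteq> {}" "B \<inter> X' = {}" "B' = B \<union> X'" unfolding X'_def B_def using that by auto
    have finX: "finite X'" using X' con'(1) A fin by (meson finite_subset)
    have "px - \<epsilon> * int (card (edges_in E g B)) - \<epsilon> * int (card (between E g B FA))
       \<le> (\<epsilon> - 1) * int (card X') - \<epsilon> * int (card (edges_in E' g' (B \<union> X')))"
      using con'(5) BW X' unfolding count_transfer_def by blast
    moreover have "(\<Sum>v\<in>X'. f (w' v)) = (\<epsilon> - 1) * int (card X')"
    proof -
      have "(\<Sum>v\<in>X'. f (w' v)) = (\<Sum>v\<in>X'. \<epsilon> - 1)"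
        by (rule sum.cong) (use X'(1) f_top in \<open>auto simp: w'_def cweight_def\<close>)
      then show ?thesis by simp
    qed
    moreover have "po E' g' w' B' = (\<Sum>v\<in>B. f (w' v)) + (\<Sum>v\<in>X'. f (w' v)) - \<epsilon> * int (card (edges_in E' g' (B \<union> X')))"
      unfolding pot_def X'(4) using sum.union_disjoint[OF finB finX X'(3)] by simp
    ultimately show ?thesis using potA sumcost unfolding B_def by linarith
  qed
  assume BX: "B' \<inter> X = {}"
  then have BB: "B = B'" unfolding B_def by auto
  have eqE: "edges_in E' g' B = edges_in E g B"
  proof -
    have "ed \<in> edges_in E' g' B \<longleftrightarrow> ed \<in> edges_in E g B" for ed
    proof
      assume a: "ed \<in> edges_in E' g' B"
      have "ed \<in> edges_in E' g' (V - A)" by (rule subsetD[OF edges_in_mono[OF BW] a])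
      then have "ed \<in> edges_in E g (V - A)" unfolding con'(2) .
      then show "ed \<in> edges_in E g B" using a con'(3)[of ed] by (simp add: edges_in_def)
    next
      assume a: "ed \<in> edges_in E g B"
      have b: "ed \<in> edges_in E g (V - A)" by (rule subsetD[OF edges_in_mono[OF BW] a])
      then have "ed \<in> edges_in E' g' (V - A)" unfolding con'(2) .
      then show "ed \<in> edges_in E' g' B" using a con'(3)[OF b] by (simp add: edges_in_def)
    qed
    then show ?thesis by blast
  qed
  have potB: "po E' g' w' B' = (\<Sum>v\<in>B. f (w' v)) - \<epsilon> * int (card (edges_in E g B))"
    unfolding pot_def BB[symmetric] eqE by simp
  show "po E g w (A \<union> B') \<le> po E g w A + po E' g' w' B' - \<epsilon> * int (card (between E g B' FA))"
    using potA potB sumcost BB by simp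
  assume z: "z \<in> B'" "ed \<in> E" "g ed = {y, z}" "y \<in> A"
  have zB: "z \<in> B" using z BB by simp
  let ?j = "card (between E g {z} FA)"
  have jle: "int (card (between E g B FA)) \<ge> int ?j"
    using zB fb by (intro of_nat_mono card_mono) (auto simp: between_def)
  have zA: "z \<notin> A" using zB disj by auto
  have zcost: "f (w z) - f (w' z) \<le> \<epsilon> * int (m z) + \<epsilon> * int ?j - (\<epsilon> - h kz)"
  proof (cases "between E g {z} MA = {}")
    case True
    then have "y \<in> FA" using z A(2) by (auto simp: between_def)
    then have "ed \<in> between E g {z} FA" using z by (auto simp: between_def)
    then have "?j \<ge> 1" using fb by (metis One_nat_def Suc_leI card_gt_0_iff empty_iff)
    then have "\<epsilon> * int ?j \<ge> \<epsilon>" using eps by (simp add: mult_le_cancel_left1)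
    moreover have "f (w' z) = f (w z)" using True zA con'(1) unfolding w'_def cweight_def by auto
    moreover have "\<epsilon> * int (m z) \<ge> 0" using eps by simp
    ultimately show ?thesis using h_nonneg[of kz] by linarith
  next
    case False
    show ?thesis
    proof (cases "\<exists>ed. between E g {z} MA = {ed} \<and> g ed = {z, y}")
      case True
      then have "m z = 1" unfolding m_def by force
      moreover have "w' z = min (w z + kz) (D + 2)" using True False zA con'(1) unfolding w'_def cweight_def by auto
      moreover have "f (w z) - f (min (w z + kz) (D + 2)) \<le> h kz" using f_raise wB[OF zB] by blast
      moreover have "\<epsilon> * int ?j \<ge> 0" using eps by simp
      ultimately show ?thesis by simp
    next
      case nex: False
      have "1 \<le> w' z \<and> w' z \<le> D + 2" using wB[OF zB] unfolding w'_def cweight_def by auto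
      then have c: "f (w z) - f (w' z) \<le> \<epsilon>" using f_bounds[of "w z"] f_bounds[of "w' z"] wB[OF zB] by force
      have m1: "m z \<ge> 1" unfolding m_def using fb False by (simp add: Suc_leI card_gt_0_iff)
      have "m z + ?j \<ge> 2"
      proof (cases "y \<in> FA")
        case True
        then have "ed \<in> between E g {z} FA" using z by (auto simp: between_def)
        then have "?j \<ge> 1" using fb by (metis One_nat_def Suc_leI card_gt_0_iff empty_iff)
        then show ?thesis using m1 by linarith
      next
        case False
        then have ed: "ed \<in> between E g {z} MA" using z A(2) by (auto simp: between_def)
        then have "between E g {z} MA \<noteq> {ed}" using nex z(3) by (metis insert_commute)
        then have "m z \<noteq> 1" unfolding m_def using ed by (metis card_1_singletonE singletonD)
        then show ?thesis using m1 by linarith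
      qed
      then have "2 \<le> int (m z) + int ?j" by linarith
      then have "\<epsilon> * 2 \<le> \<epsilon> * (int (m z) + int ?j)" using eps by (intro mult_left_mono) auto
      then show ?thesis using c h_nonneg[of kz] by (simp add: algebra_simps)
    qed
  qed
  have "(\<Sum>v\<in>B. f (w v)) = f (w z) + (\<Sum>v\<in>B-{z}. f (w v))" "(\<Sum>v\<in>B. f (w' v)) = f (w' z) + (\<Sum>v\<in>B-{z}. f (w' v))"
    "(\<Sum>v\<in>B. int (m v)) = int (m z) + (\<Sum>v\<in>B-{z}. int (m v))"
    using sum.remove[OF finB zB] by auto
  moreover have "(\<Sum>v\<in>B-{z}. f (w v)) \<le> (\<Sum>v\<in>B-{z}. f (w' v) + \<epsilon> * int (m v))"
    by (rule sum_mono) (use cost in force)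
  then have "(\<Sum>v\<in>B-{z}. f (w v)) \<le> (\<Sum>v\<in>B-{z}. f (w' v)) + \<epsilon> * (\<Sum>v\<in>B-{z}. int (m v))"
    by (simp add: sum.distrib sum_distrib_left)
  ultimately have "(\<Sum>v\<in>B. f (w v)) \<le> (\<Sum>v\<in>B. f (w' v)) + \<epsilon> * int (card (between E g B MA)) + \<epsilon> * int ?j - (\<epsilon> - h kz)"
    using zcost sm by (simp add: distrib_left)
  moreover have "\<epsilon> * int ?j \<le> \<epsilon> * int (card (between E g B FA))"
    using jle eps by (intro mult_left_mono) auto
  ultimately show "po E g w (A \<union> B') \<le> po E g w A + po E' g' w' B' - (\<epsilon> - h kz)"
    using potA potB BB by simp
qed

end

lemma sum_degree:
  assumes "wf_graph V E g"
  shows "(\<Sum>v\<in>V. card {ed\<in>E. v \<in> g ed}) = 2 * card E"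
proof -
  have "(\<Sum>v\<in>V. card {ed\<in>E. v \<in> g ed}) = (\<Sum>ed\<in>E. 2)"
  proof (rule sum_multicount_gen)
    show "\<forall>ed\<in>E. card {v \<in> V. v \<in> g ed} = 2"
    proof
      fix ed assume "ed \<in> E"
      then have "{v \<in> V. v \<in> g ed} = g ed" "card (g ed) = 2" using assms by (auto simp: wf_graph_def)
      then show "card {v \<in> V. v \<in> g ed} = 2" by simp
    qed
  qed (use assms in \<open>auto simp: wf_graph_def\<close>)
  then show ?thesis by simp
qed

lemma edges_in_idem: "A \<subseteq> B \<Longrightarrow> edges_in (edges_in E g B) g A = edges_in E g A"
  by (auto simp: edges_in_def)

lemma edges_in_all: "wf_graph V E g \<Longrightarrow> edges_in E g V = E"
  by (auto simp: edges_in_def wf_graph_def)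

lemma wf_graph_edges_in: "wf_graph V E g \<Longrightarrow> A \<subseteq> V \<Longrightarrow> wf_graph A (edges_in E g A) g"
  by (auto simp: edges_in_def wf_graph_def intro: finite_subset)

context forest_coloring begin

lemma pot_edges_in: "B \<subseteq> A \<Longrightarrow> po (edges_in E g A) g w B = po E g w B"
  by (simp add: pot_def edges_in_idem)

lemma colors_edges_in:
  assumes "colors (edges_in E g A) g w A M F" "finite A"
  shows "colors E g w A M F"
proof -
  have s: "M \<subseteq> A" "F \<subseteq> A" using assms(1) by (auto simp: colors_def)
  have "good E g w M"
    by (rule good_mono[of "edges_in E g A" g w M]) (use assms s in \<open>auto simp: colors_def edges_in_def intro: finite_subset\<close>)
  then show ?thesis using assms(1) s by (simp add: colors_def edges_in_idem)
qed

lemma colors_weaken: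
  assumes "colors E g w A M F" "finite A" "\<And>v. v \<in> A \<Longrightarrow> w' v \<le> w v"
  shows "colors E g w' A M F"
proof -
  have M: "M \<subseteq> A" "good E g w M" using assms(1) by (auto simp: colors_def)
  have "good E g w' M"
    by (rule good_weaken[OF M(2) finite_subset[OF M(1) assms(2)] subset_refl]) (use M(1) assms(3) in blast)
  then show ?thesis using assms(1) by (simp add: colors_def)
qed

lemma col_empty:
  assumes "\<And>ed. ed \<in> E \<Longrightarrow> card (g ed) = 2"
  shows "col E g w {}"
proof -
  have "edges_in E g {} = {}" using assms by (force simp: edges_in_def)
  then show ?thesis unfolding col_def colors_def using good_empty by (auto simp: acyc_def)
qed

lemma crit_exists:
  assumes "wf_graph V E g" "\<not> col E g w V"
  shows "\<exists>V' E'. V' \<subseteq> V \<and> E' \<subseteq> E \<and> wf_graph V' E' g \<and> crit V' E' g w"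
  using assms
proof (induction "card V + card E" arbitrary: V E rule: less_induct)
  case less
  show ?case
  proof (cases "crit V E g w")
    case True then show ?thesis using less.prems by blast
  next
    case False
    then obtain V' E' where s: "V' \<subseteq> V" "E' \<subseteq> E" "\<forall>ed\<in>E'. g ed \<subseteq> V'" "V' \<noteq> V \<or> E' \<noteq> E" "\<not> col E' g w V'"
      using less.prems(2) unfolding crit_def by blast
    have fin: "finite V" "finite E" using less.prems(1) by (auto simp: wf_graph_def)
    have wf: "wf_graph V' E' g" using less.prems(1) s by (auto simp: wf_graph_def intro: finite_subset)
    have "card V' \<le> card V" "card E' \<le> card E" using s fin by (auto intro: card_mono)
    moreover have "V' \<noteq> V \<Longrightarrow> card V' < card V" "E' \<noteq> E \<Longrightarrow> card E' < card E"
      using s fin by (auto intro: psubset_card_mono)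
    ultimately have "card V' + card E' < card V + card E" using s(4) by linarith
    then show ?thesis using less.hyps[OF _ wf s(5)] s(1,2) by (meson subset_trans)
  qed
qed

lemma col_criterion:
  assumes "IH n" "wf_graph V E g" "cls V E g" "range w V" "card V < n"
    and pos: "\<And>B. B \<subseteq> V \<Longrightarrow> B \<noteq> {} \<Longrightarrow> - \<tau> < po E g w B"
  shows "col E g w V"
proof (rule ccontr)
  assume nc: "\<not> col E g w V"
  obtain V' E' where c: "V' \<subseteq> V" "E' \<subseteq> E" "wf_graph V' E' g" "crit V' E' g w"
    using crit_exists[OF assms(2) nc] by blast
  have fin: "finite V" "finite E" using assms(2) by (auto simp: wf_graph_def)
  have "card V' < n" using card_mono[OF fin(1) c(1)] assms(5) by linarith
  moreover have "cls V' E' g" using cls_sub assms(3) c by blast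
  moreover have "range w V'" using assms(4) c(1) by (auto simp: range_def)
  ultimately have p: "po E' g w V' \<le> - \<tau>" using assms(1) c unfolding IH_def by blast
  have "card E' \<le> card (edges_in E g V')"
    using c fin by (intro card_mono finite_edges_in) (auto simp: edges_in_def wf_graph_def)
  then have "\<epsilon> * int (card E') \<le> \<epsilon> * int (card (edges_in E g V'))" using eps by (intro mult_left_mono) auto
  then have "po E g w V' \<le> po E' g w V'" unfolding pot_def edges_in_all[OF c(3)] by simp
  moreover have "V' \<noteq> {}" using c(4) col_empty[of E' g w] c(3) unfolding crit_def by (auto simp: wf_graph_def)
  ultimately show False using pos[OF c(1)] p by linarith
qed

lemma crit_sub:
  assumes "crit V E g w" "wf_graph V E g" "A \<subseteq> V" "A \<noteq> V"
  shows "col E g w A"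
proof -
  have "col (edges_in E g A) g w A"
    using assms unfolding crit_def by (auto simp: edges_in_def)
  moreover have "finite A" using assms by (auto simp: wf_graph_def intro: finite_subset)
  ultimately show ?thesis using colors_edges_in unfolding col_def by blast
qed

lemma colors_Un:
  assumes wf: "\<And>ed. ed \<in> E \<Longrightarrow> card (g ed) = 2" "finite E" and fin: "finite A" "finite B" "A \<inter> B = {}"
    and c: "colors E g w A M1 F1" "colors E g w B M2 F2"
    and no: "\<And>ed. ed \<in> E \<Longrightarrow> g ed \<inter> A \<noteq> {} \<Longrightarrow> g ed \<inter> B \<noteq> {} \<Longrightarrow> False"
  shows "colors E g w (A \<union> B) (M1 \<union> M2) (F1 \<union> F2)"
proof -
  have s: "M1 \<subseteq> A" "F1 \<subseteq> A" "M2 \<subseteq> B" "F2 \<subseteq> B" using c by (auto simp: colors_def)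
  have fM: "finite M1" "finite M2" using s fin by (auto intro: finite_subset)
  have 1: "acyc (edges_in E g (M1 \<union> M2)) g"
    by (rule acyc_join[OF wf]) (use s fin(3) c no in \<open>(fastforce simp: colors_def)+\<close>)
  have 2: "acyc (edges_in E g (F1 \<union> F2)) g"
    by (rule acyc_join[OF wf]) (use s fin(3) c no in \<open>(fastforce simp: colors_def)+\<close>)
  have 3: "good E g w (M1 \<union> M2)"
  proof (rule good_union[OF fM])
    show "M1 \<inter> M2 = {}" using s fin(3) by auto
    fix ed assume a: "ed \<in> E" "g ed \<subseteq> M1 \<union> M2"
    show "g ed \<subseteq> M1 \<or> g ed \<subseteq> M2"
    proof (rule ccontr)
      assume "\<not> (g ed \<subseteq> M1 \<or> g ed \<subseteq> M2)"
      then have "g ed \<inter> M1 \<noteq> {}" "g ed \<inter> M2 \<noteq> {}" using a by blast+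
      then have "g ed \<inter> A \<noteq> {}" "g ed \<inter> B \<noteq> {}" using s by blast+
      then show False using no a(1) by blast
    qed
  qed (use c in \<open>auto simp: colors_def\<close>)
  show ?thesis using 1 2 3 c s fin(3) unfolding colors_def by blast
qed

lemma pot_raise:
  assumes "finite B" "range w B" "\<And>v. v \<in> B \<Longrightarrow> w' v = (if v \<in> N then min (w v + k) (D + 2) else w v)"
  shows "po E g w B - h k * int (card (B \<inter> N)) \<le> po E g w' B"
proof -
  have "(\<Sum>v\<in>B. f (w v)) \<le> (\<Sum>v\<in>B. f (w' v) + (if v \<in> N then h k else 0))"
  proof (rule sum_mono)
    fix v assume v: "v \<in> B"
    then have "1 \<le> w v" "w v \<le> D + 2" using assms(2) by (auto simp: range_def)
    then show "f (w v) \<le> f (w' v) + (if v \<in> N then h k else 0)"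
      using f_raise[of "w v" k] assms(3)[OF v] by auto
  qed
  also have "\<dots> = (\<Sum>v\<in>B. f (w' v)) + h k * int (card (B \<inter> N))"
    using assms(1) by (simp add: sum.distrib sum.If_cases Int_def)
  finally show ?thesis by (simp add: pot_def)
qed

lemma pot_single:
  assumes "\<And>ed. ed \<in> E \<Longrightarrow> card (g ed) = 2"
  shows "po E g w {v} = f (w v)"
proof -
  have "edges_in E g {v} = {}"
  proof -
    have "ed \<notin> edges_in E g {v}" for ed
    proof
      assume "ed \<in> edges_in E g {v}"
      then have "ed \<in> E" "card (g ed) \<le> card {v}" by (auto simp: edges_in_def intro!: card_mono[of "{v}", simplified])
      then show False using assms by force
    qed
    then show ?thesis by blast
  qed
  then show ?thesis by (simp add: pot_def)
qed

lemma gap: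
  assumes c: "crit V E g w" "wf_graph V E g" "cls V E g" "range w V" "- \<tau> < po E g w V" "IH (card V)"
    and A: "A \<subseteq> V" "A \<noteq> V" "2 \<le> card A"
  shows "gmax < po E g w A"
proof (rule ccontr)
  assume "\<not> gmax < po E g w A"
  then have Ag: "po E g w A \<le> gmax" by simp
  have fin: "finite V" "finite E" using c(2) by (auto simp: wf_graph_def)
  have card2: "\<And>ed. ed \<in> E \<Longrightarrow> card (g ed) = 2" using c(2) by (auto simp: wf_graph_def)
  let ?S = "{B. B \<subseteq> V \<and> B \<noteq> V \<and> B \<noteq> {}}"
  have "finite ?S" "?S \<noteq> {}" using fin A by (auto intro!: exI[of _ A])
  then obtain A1 where A1: "A1 \<in> ?S" "\<And>B. B \<in> ?S \<Longrightarrow> po E g w A1 \<le> po E g w B"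
    using arg_min_if_finite[of ?S "\<lambda>B. po E g w B"] by (meson not_le)
  have "\<exists>A0. A0 \<in> ?S \<and> (\<forall>B\<in>?S. po E g w A0 \<le> po E g w B) \<and> 2 \<le> card A0 \<and> po E g w A0 \<le> gmax"
  proof (cases "2 \<le> card A1")
    case True
    have "A \<in> ?S" using A by auto
    then have "po E g w A1 \<le> gmax" using A1(2)[of A] Ag by linarith
    then show ?thesis using A1 True by blast
  next
    case False
    moreover have "finite A1" using A1(1) fin(1) finite_subset by blast
    then have "card A1 \<noteq> 0" using A1(1) by auto
    ultimately have "card A1 = 1" by linarith
    then obtain v where v: "A1 = {v}" using card_1_singletonE by blast
    then have "\<epsilon> - 1 \<le> po E g w A1" using pot_single[of E g w v, OF card2] f_bounds[of "w v"] c(4) A1(1) by (auto simp: range_def)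
    then have "po E g w A \<le> po E g w A1" using Ag px by linarith
    moreover have "A \<in> ?S" using A by auto
    ultimately have "\<forall>B\<in>?S. po E g w A \<le> po E g w B" using A1(2) by (meson order_trans)
    then show ?thesis using A(3) Ag \<open>A \<in> ?S\<close> by blast
  qed
  then obtain A0 where A0: "A0 \<subseteq> V" "A0 \<noteq> V" "A0 \<noteq> {}" "2 \<le> card A0" "po E g w A0 \<le> gmax"
    and A0min: "\<And>B. B \<subseteq> V \<Longrightarrow> B \<noteq> V \<Longrightarrow> B \<noteq> {} \<Longrightarrow> po E g w A0 \<le> po E g w B" by blast
  define \<gamma> where "\<gamma> = po E g w A0"
  have finA: "finite A0" "finite (V - A0)" using A0 fin by (auto intro: finite_subset)
  have "\<exists>ed\<in>E. g ed \<inter> A0 \<noteq> {} \<and> g ed \<inter> (V - A0) \<noteq> {}"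
  proof (rule ccontr)
    assume no: "\<not> ?thesis"
    obtain M1 F1 where 1: "colors E g w A0 M1 F1" using crit_sub[OF c(1,2) A0(1,2)] unfolding col_def by blast
    have "V - A0 \<noteq> V" using A0 by auto
    then obtain M2 F2 where 2: "colors E g w (V - A0) M2 F2" using crit_sub[OF c(1,2), of "V - A0"] unfolding col_def by blast
    have "colors E g w (A0 \<union> (V - A0)) (M1 \<union> M2) (F1 \<union> F2)"
      by (rule colors_Un[OF card2 fin(2) finA _ 1 2]) (use no in auto)
    then show False using c(1) A0(1) unfolding crit_def col_def by (simp add: Un_absorb1)
  qed
  then obtain ed y z where yz: "ed \<in> E" "y \<in> g ed" "y \<in> A0" "z \<in> g ed" "z \<in> V - A0" by auto
  have ged: "g ed = {y, z}"
    using card2_other[OF card2[OF yz(1)] yz(2)] yz by (metis DiffE insert_iff singletonD)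
  have "\<exists>ky kz MA FA. comb ky kz \<and> h kz \<le> \<epsilon> - \<gamma> \<and> colors E g w A0 MA FA \<and> good E g (w(y := w y + ky)) MA"
  proof (cases "1 \<le> \<gamma>")
    case False
    obtain M1 F1 where 1: "colors E g w A0 M1 F1" using crit_sub[OF c(1,2) A0(1,2)] unfolding col_def by blast
    then have "good E g (w(y := w y + 0)) M1" by (simp add: colors_def)
    moreover have "h (D + 2) \<le> \<epsilon> - \<gamma>" using h_top False by linarith
    ultimately show ?thesis using comb0 1 by blast
  next
    case True
    then obtain ky kz where k: "comb ky kz" "h ky < \<gamma> + \<tau>" "h kz \<le> \<epsilon> - \<gamma>"
      using pick[of \<gamma>] A0(5) unfolding \<gamma>_def by blast
    define w1 where "w1 = w(y := min (w y + ky) (D + 2))"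
    have w1: "w1 v = (if v \<in> {y} then min (w v + ky) (D + 2) else w v)" for v unfolding w1_def by simp
    have rA: "range w A0" using c(4) A0(1) by (auto simp: range_def)
    have "col (edges_in E g A0) g w1 A0"
    proof (rule col_criterion[OF c(6) wf_graph_edges_in[OF c(2) A0(1)]])
      show "cls A0 (edges_in E g A0) g" using cls_sub[OF c(3) A0(1) edges_in_sub] .
      show "range w1 A0" using rA w1 by (auto simp: range_def)
      show "card A0 < card V" using A0(1,2) fin by (simp add: psubset_card_mono psubsetI)
      fix B assume B: "B \<subseteq> A0" "B \<noteq> {}"
      have "finite B" using B finA by (auto intro: finite_subset)
      have "po E g w B - h ky * int (card (B \<inter> {y})) \<le> po E g w1 B"
        by (rule pot_raise[OF \<open>finite B\<close>]) (use rA B w1 in \<open>auto simp: range_def\<close>)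
      moreover have "card (B \<inter> {y}) \<le> 1" by (metis card.empty card_mono finite.emptyI finite_insert inf_le2 is_singletonI is_singleton_altdef)
      then have "h ky * int (card (B \<inter> {y})) \<le> h ky * 1" using h_nonneg by (intro mult_left_mono) auto
      moreover have "\<gamma> \<le> po E g w B" unfolding \<gamma>_def using A0min[of B] B A0 by auto
      ultimately show "- \<tau> < po (edges_in E g A0) g w1 B" using k(2) pot_edges_in[OF B(1), of E g w1] by linarith
    qed
    then obtain MA FA where "colors (edges_in E g A0) g w1 A0 MA FA" unfolding col_def by blast
    then have m: "colors E g w1 A0 MA FA" using colors_edges_in finA(1) by blast
    have fMA: "finite MA" "good E g w1 MA" "MA \<subseteq> A0" using m finA by (auto simp: colors_def intro: finite_subset)
    have "good E g (w(y := w y + ky)) MA"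
    proof (rule good_weaken[OF fMA(2,1) subset_refl])
      fix v assume v: "v \<in> MA"
      show "(w(y := w y + ky)) v \<le> w1 v" using good_bound[OF fMA(2,1) v] unfolding w1_def by (auto split: if_splits)
    qed
    moreover have "colors E g w A0 MA FA"
      by (rule colors_weaken[OF m finA(1)]) (use rA w1 in \<open>auto simp: range_def\<close>)
    ultimately show ?thesis using k by blast
  qed
  then obtain ky kz MA FA where k: "comb ky kz" "h kz \<le> \<epsilon> - \<gamma>" and cA: "colors E g w A0 MA FA" "good E g (w(y := w y + ky)) MA"
    by blast
  have MFA: "MA \<union> FA = A0" "MA \<inter> FA = {}" using cA(1) by (auto simp: colors_def)
  have "big E g A0" using big_pot[OF c(2,3) A0(1)] c(4) A0(4,5) unfolding range_def by blast
  then obtain X E' g' where con: "contraction \<epsilon> px V E g A0 FA X E' g'" "cls (V - A0 \<union> X) E' g'"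
    using contr[OF c(2,3) A0(1)] MFA by blast
  have X: "X \<subseteq> A0" "card X < card A0" "wf_graph (V - A0 \<union> X) E' g'" using con(1) by (simp_all add: contraction_def)
  define w' where "w' = cweight E g w MA X y z kz"
  have rw': "range w' (V - A0 \<union> X)" unfolding w'_def by (rule range_cweight[OF c(4) A0(1) X(1)])
  have "\<not> col E' g' w' (V - A0 \<union> X)"
  proof
    assume "col E' g' w' (V - A0 \<union> X)"
    then obtain M' F' where col': "colors E' g' w' (V - A0 \<union> X) M' F'" unfolding col_def by blast
    have "\<exists>M F. colors E g w V M F \<and> M \<inter> A0 = MA \<and> F \<inter> A0 = FA"
    proof (rule contraction_extend[OF c(2) A0(1) cA k(1) yz(3,5) con(1) _ _ _ col'])
      show "D + 2 \<le> w' v" if "v \<in> X" for v using that unfolding w'_def cweight_def by simp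
      show "w v \<le> w' v" if "v \<in> V - A0" for v
        using that c(4) X(1) unfolding w'_def cweight_def range_def by auto
      fix v d m assume v: "v \<in> V - A0" "d \<in> E" "m \<in> MA" "g d = {v, m}"
      then have d: "d \<in> between E g {v} MA" by (auto simp: between_def)
      have vX: "v \<notin> X" using v X by auto
      show "D + 2 \<le> w' v \<or> v = z \<and> m = y \<and> min (w v + kz) (D + 2) \<le> w' v \<and> (\<forall>ed'\<in>E. \<forall>m'\<in>MA. g ed' = {z, m'} \<longrightarrow> ed' = d)"
      proof (cases "v = z \<and> (\<exists>d. between E g {v} MA = {d} \<and> g d = {z, y})")
        case False
        then show ?thesis using d vX unfolding w'_def cweight_def by auto
      next
        case True
        then have vz: "v = z" by simp
        obtain d' where d': "between E g {v} MA = {d'}" "g d' = {z, y}" using True by blast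
        then have dd: "d' = d" using d by auto
        then have my: "m = y" using d' v vz yz(3,5) by (auto simp: doubleton_eq_iff)
        have "ed' = d" if "ed' \<in> E" "m' \<in> MA" "g ed' = {z, m'}" for ed' m'
        proof -
          have "ed' \<in> between E g {v} MA" using that vz by (auto simp: between_def)
          then show ?thesis using d'(1) dd by auto
        qed
        moreover have "w' v = min (w v + kz) (D + 2)"
          unfolding w'_def cweight_def using True vX d by auto
        ultimately show ?thesis using vz my by auto
      qed
    qed
    then show False using c(1) unfolding crit_def col_def by blast
  qed
  moreover have "card (V - A0 \<union> X) < card V"
  proof -
    have "card (V - A0 \<union> X) \<le> card (V - A0) + card X" by (rule card_Un_le)
    also have "\<dots> < card (V - A0) + card A0" using X(2) by simp
    also have "\<dots> = card V" using A0(1) fin by (metis card_Diff_subset card_mono finA(1) le_add_diff_inverse2)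
    finally show ?thesis .
  qed
  ultimately obtain B' where B': "B' \<subseteq> V - A0 \<union> X" "B' \<noteq> {}" "po E' g' w' B' \<le> - \<tau>"
    using col_criterion[OF c(6) X(3) con(2) rw'] by (meson not_less)
  note pc = pot_contract[OF c(2,4) A0(1) MFA con(1) B'(1), where y = y and z = z and kz = kz, folded w'_def]
  show False
  proof (cases "B' \<inter> X = {}")
    case False
    have p: "po E g w (A0 \<union> (B' - X)) \<le> \<gamma> - \<tau> - px" using pc(1)[OF False] B'(3) unfolding \<gamma>_def by linarith
    have "A0 \<union> (B' - X) = V"
    proof (rule ccontr)
      assume "A0 \<union> (B' - X) \<noteq> V"
      moreover have "A0 \<union> (B' - X) \<subseteq> V" using A0(1) B'(1) X(1) by auto
      ultimately have "\<gamma> \<le> po E g w (A0 \<union> (B' - X))" unfolding \<gamma>_def using A0min A0(3) by auto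
      then show False using p px tau by linarith
    qed
    then show False using p c(5) A0(5) px unfolding \<gamma>_def by simp
  next
    case True
    have "\<epsilon> * int (card (between E g B' FA)) \<ge> 0" using eps by simp
    then have p: "po E g w (A0 \<union> B') \<le> \<gamma> - \<tau>" using pc(2)[OF True] B'(3) unfolding \<gamma>_def by linarith
    have V: "A0 \<union> B' = V"
    proof (rule ccontr)
      assume "A0 \<union> B' \<noteq> V"
      moreover have "A0 \<union> B' \<subseteq> V" using A0(1) B'(1) X(1) by auto
      ultimately have "\<gamma> \<le> po E g w (A0 \<union> B')" unfolding \<gamma>_def using A0min A0(3) by auto
      then show False using p tau by linarith
    qed
    then have "z \<in> B'" using yz(5) by auto
    then have "po E g w V \<le> \<gamma> - \<tau> - (\<epsilon> - h kz)"
      using pc(3)[OF True _ yz(1) ged yz(3)] B'(3) V unfolding \<gamma>_def by simp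
    then show False using k(2) c(5) by linarith
  qed
qed

end

definition star :: "'e set \<Rightarrow> ('e \<Rightarrow> 'v set) \<Rightarrow> 'v \<Rightarrow> 'v set \<Rightarrow> 'e set" where
  "star E g v A = {ed\<in>E. v \<in> g ed \<and> g ed \<subseteq> insert v A}"

lemma finite_star: "finite E \<Longrightarrow> finite (star E g v A)"
  by (simp add: star_def)

lemma edges_in_insert: "edges_in E g (insert v A) = edges_in E g A \<union> star E g v A"
  by (auto simp: edges_in_def star_def)

lemma star_Un:
  assumes "\<And>ed. ed \<in> E \<Longrightarrow> card (g ed) = 2" "v \<notin> A" "v \<notin> B" "A \<inter> B = {}" "finite E"
  shows "card (star E g v (A \<union> B)) = card (star E g v A) + card (star E g v B)"
proof -
  have "star E g v (A \<union> B) = star E g v A \<union> star E g v B"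
  proof (intro equalityI subsetI)
    fix ed assume a: "ed \<in> star E g v (A \<union> B)"
    then have "card (g ed) = 2" "v \<in> g ed" using assms(1) by (auto simp: star_def)
    then obtain u where "g ed = {v, u}" using card2_other by metis
    then show "ed \<in> star E g v A \<union> star E g v B" using a by (auto simp: star_def)
  qed (auto simp: star_def)
  moreover have "star E g v A \<inter> star E g v B = {}"
  proof (intro equals0I)
    fix ed assume a: "ed \<in> star E g v A \<inter> star E g v B"
    then have "card (g ed) = 2" "v \<in> g ed" using assms(1) by (auto simp: star_def)
    then obtain u where "g ed = {v, u}" "u \<noteq> v" using card2_other by metis
    then show False using a assms(4) by (auto simp: star_def)
  qed
  ultimately show ?thesis using assms(5) by (simp add: card_Un_disjoint finite_star)
qed

lemma star_all: "wf_graph V E g \<Longrightarrow> star E g v (V - {v}) = {ed\<in>E. v \<in> g ed}"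
  by (auto simp: star_def wf_graph_def)

context forest_coloring begin

lemma pot_insert:
  assumes "finite B" "v \<notin> B" "finite E" "\<And>ed. ed \<in> E \<Longrightarrow> card (g ed) = 2"
  shows "po E g w (insert v B) = po E g w B + f (w v) - \<epsilon> * int (card (star E g v B))"
proof -
  have "edges_in E g B \<inter> star E g v B = {}" using assms(2) by (auto simp: edges_in_def star_def)
  then have "card (edges_in E g (insert v B)) = card (edges_in E g B) + card (star E g v B)"
    unfolding edges_in_insert using assms(3) by (simp add: card_Un_disjoint finite_edges_in finite_star)
  then show ?thesis using assms(1,2) by (simp add: pot_def algebra_simps)
qed

lemma pot_insert_le:
  assumes "finite B" "v \<notin> B" "finite E" "\<And>ed. ed \<in> E \<Longrightarrow> card (g ed) = 2" "S \<subseteq> star E g v B"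
  shows "po E g w (insert v B) \<le> po E g w B + f (w v) - \<epsilon> * int (card S)"
proof -
  have "int (card S) \<le> int (card (star E g v B))" using card_mono[OF finite_star[OF assms(3)] assms(5)] by simp
  then have "\<epsilon> * int (card S) \<le> \<epsilon> * int (card (star E g v B))" using eps by (intro mult_left_mono) auto
  then show ?thesis using pot_insert[of B v E g w, OF assms(1-4)] by linarith
qed

lemma handshake:
  assumes "wf_graph V E g"
  shows "2 * po E g w V = (\<Sum>v\<in>V. 2 * f (w v) - \<epsilon> * int (card {ed\<in>E. v \<in> g ed}))"
proof -
  have "(\<Sum>v\<in>V. int (card {ed\<in>E. v \<in> g ed})) = 2 * int (card E)"
    using sum_degree[OF assms] by (simp flip: of_nat_sum)
  moreover have "(\<Sum>v\<in>V. 2 * f (w v) - \<epsilon> * int (card {ed\<in>E. v \<in> g ed}))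
     = 2 * (\<Sum>v\<in>V. f (w v)) - \<epsilon> * (\<Sum>v\<in>V. int (card {ed\<in>E. v \<in> g ed}))"
    by (simp only: sum_subtractf sum_distrib_left)
  ultimately show ?thesis unfolding pot_def edges_in_all[OF assms] by simp
qed

lemma colors_addF:
  assumes "colors E g w U M F" "v \<notin> U" "card (star E g v F) \<le> 1" "finite E"
  shows "colors E g w (insert v U) M (insert v F)"
proof -
  have "acyc (edges_in E g (insert v F)) g"
    by (rule acyc_leaf) (use assms in \<open>auto simp: colors_def star_def\<close>)
  then show ?thesis using assms(1,2) unfolding colors_def by blast
qed

lemma colors_addM:
  assumes c: "colors E g w U M F" and v: "v \<notin> U" and st: "star E g v M \<subseteq> {e0}" and fin: "finite E" "finite U"
    and card2: "\<And>ed. ed \<in> E \<Longrightarrow> card (g ed) = 2" and wv: "w v + kz \<le> D + 1"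
    and e0: "star E g v M = {e0} \<Longrightarrow> g e0 = {v, y} \<and> comb ky kz \<and> good E g (w(y := w y + ky)) M"
  shows "colors E g w (insert v U) (insert v M) F"
proof -
  have M: "M \<subseteq> U" "finite M" "v \<notin> M" "good E g w M" using c v fin by (auto simp: colors_def intro: finite_subset)
  have "card (star E g v M) \<le> card {e0}" using st by (intro card_mono) auto
  then have "acyc (edges_in E g (insert v M)) g"
    by (intro acyc_leaf) (use c fin in \<open>auto simp: colors_def star_def\<close>)
  moreover have "good E g w (insert v M)"
  proof (cases "star E g v M = {e0}")
    case True
    note e = e0[OF True]
    have ed0: "e0 \<in> E" "g e0 \<subseteq> insert v M" using True by (auto simp: star_def)
    have "y \<noteq> v" using card2[OF ed0(1)] e by auto
    then have "y \<in> M" using ed0 e by auto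
    have "good E g w (M \<union> {v})"
    proof (rule good_join[OF M(2) _ _ \<open>y \<in> M\<close> _ _ _ good_single[of E g, OF card2]])
      show "comb ky kz" "good E g (w(y := w y + ky)) M" using e by auto
      show "(w(v := w v + kz)) v \<le> D + 1" using wv by simp
      fix ed assume a: "ed \<in> E" "g ed \<subseteq> M \<union> {v}"
      show "g ed \<subseteq> M \<or> g ed \<subseteq> {v} \<or> g ed = {y, v}"
      proof (cases "v \<in> g ed")
        case True
        then have "ed \<in> star E g v M" using a by (auto simp: star_def)
        then have "ed = e0" using st by auto
        then show ?thesis using e by auto
      qed (use a in auto)
    qed (use M in auto)
    then show ?thesis by simp
  next
    case False
    then have em: "star E g v M = {}" using st by auto
    have "good E g w (M \<union> {v})"
    proof (rule good_union[OF M(2) _ _ M(4) good_single[of E g, OF card2]])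
      fix ed assume a: "ed \<in> E" "g ed \<subseteq> M \<union> {v}"
      show "g ed \<subseteq> M \<or> g ed \<subseteq> {v}"
      proof (cases "v \<in> g ed")
        case True
        then have "ed \<in> star E g v M" using a by (auto simp: star_def)
        then show ?thesis using em by auto
      qed (use a in auto)
    qed (use M wv in auto)
    then show ?thesis by simp
  qed
  ultimately show ?thesis using c v unfolding colors_def by blast
qed

lemma colors_addM0:
  assumes "colors E g w U M F" "v \<notin> U" "star E g v M = {}" "finite E" "finite U"
    "\<And>ed. ed \<in> E \<Longrightarrow> card (g ed) = 2" "w v \<le> D + 1"
  shows "colors E g w (insert v U) (insert v M) F"
  by (rule colors_addM[where kz = 0]) (use assms in auto)

lemma degree_split:
  assumes "wf_graph V E g" "v \<in> V" "colors E g w (V - {v}) M F"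
  shows "card {ed\<in>E. v \<in> g ed} = card (star E g v M) + card (star E g v F)"
proof -
  have "M \<union> F = V - {v}" "M \<inter> F = {}" using assms(3) by (auto simp: colors_def)
  moreover from this have "v \<notin> M" "v \<notin> F" by auto
  ultimately show ?thesis using star_Un[of E g v M F] star_all[OF assms(1), of v] assms(1)
    by (simp add: wf_graph_def)
qed

lemma crit_star:
  assumes "crit V E g w" "wf_graph V E g" "v \<in> V" "colors E g w (V - {v}) M F"
  shows "2 \<le> card (star E g v F)" and "w v \<le> D + 1 \<Longrightarrow> 1 \<le> card (star E g v M)"
proof -
  have V: "insert v (V - {v}) = V" using assms(3) by auto
  have nc: "\<not> col E g w V" using assms(1) by (simp add: crit_def)
  have fin: "finite E" "finite (V - {v})" using assms(2) by (auto simp: wf_graph_def)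
  show "2 \<le> card (star E g v F)"
  proof (rule ccontr)
    assume "\<not> ?thesis"
    then have "colors E g w (insert v (V - {v})) M (insert v F)"
      by (intro colors_addF[OF assms(4)]) (use fin in auto)
    then show False using nc V unfolding col_def by auto
  qed
  assume wv: "w v \<le> D + 1"
  show "1 \<le> card (star E g v M)"
  proof (rule ccontr)
    assume "\<not> ?thesis"
    then have "card (star E g v M) = 0" by linarith
    then have "star E g v M = {}" using finite_star[OF fin(1), of g v M] by simp
    then have "colors E g w (insert v (V - {v})) (insert v M) F"
      by (intro colors_addM0[OF assms(4)]) (use fin wv assms(2) in \<open>auto simp: wf_graph_def\<close>)
    then show False using nc V unfolding col_def by auto
  qed
qed

lemma crit_degree:
  assumes "crit V E g w" "wf_graph V E g" "v \<in> V"
  shows "2 \<le> card {ed\<in>E. v \<in> g ed}" and "w v \<le> D + 1 \<Longrightarrow> 3 \<le> card {ed\<in>E. v \<in> g ed}"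
proof -
  have "V - {v} \<noteq> V" using assms(3) by auto
  then obtain M F where c: "colors E g w (V - {v}) M F"
    using crit_sub[OF assms(1,2), of "V - {v}"] unfolding col_def by blast
  show "2 \<le> card {ed\<in>E. v \<in> g ed}" and "w v \<le> D + 1 \<Longrightarrow> 3 \<le> card {ed\<in>E. v \<in> g ed}"
    using crit_star[OF assms c] degree_split[OF assms(2,3) c] by linarith+
qed

lemma degree_three_obstruction:
  assumes c: "crit V E g w" "wf_graph V E g" "v \<in> V" "colors E g w (V - {v}) M F"
    and d: "card {ed\<in>E. v \<in> g ed} = 3" and k: "comb ky kz" "w v + kz \<le> D + 1"
  obtains z e0 where "z \<in> M" "e0 \<in> E" "g e0 = {v, z}" "star E g v M = {e0}" "card (star E g v F) = 2"
    "\<not> good E g (w(z := w z + ky)) M"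
proof -
  have fin: "finite E" "finite (V - {v})" using c(2) by (auto simp: wf_graph_def)
  have card2: "\<And>ed. ed \<in> E \<Longrightarrow> card (g ed) = 2" using c(2) by (auto simp: wf_graph_def)
  have "w v \<le> D + 1" using k(2) by simp
  then have "card (star E g v M) = 1" and F2: "card (star E g v F) = 2"
    using crit_star[OF c] degree_split[OF c(2-4)] d by linarith+
  then obtain e0 where e0: "star E g v M = {e0}" using card_1_singletonE by blast
  then have e0E: "e0 \<in> E" "v \<in> g e0" "g e0 \<subseteq> insert v M" by (auto simp: star_def)
  obtain z where z: "g e0 = {v, z}" "z \<noteq> v" using card2_other[OF card2[OF e0E(1)] e0E(2)] by metis
  have zM: "z \<in> M" using z e0E by auto
  have "\<not> good E g (w(z := w z + ky)) M"
  proof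
    assume "good E g (w(z := w z + ky)) M"
    then have "colors E g w (insert v (V - {v})) (insert v M) F"
      by (intro colors_addM[OF c(4) _ _ fin card2 k(2)]) (use e0 z k in auto)
    moreover have "insert v (V - {v}) = V" using c(3) by auto
    ultimately show False using c(1) unfolding crit_def col_def by auto
  qed
  then show ?thesis using that zM e0E(1) z(1) e0 F2 by blast
qed

definition raise :: "('v \<Rightarrow> nat) \<Rightarrow> 'v set \<Rightarrow> nat \<Rightarrow> 'v \<Rightarrow> nat" where
  "raise w N k v = (if v \<in> N then min (w v + k) (D + 2) else w v)"

lemma range_raise: "range w V \<Longrightarrow> range (raise w N k) V"
  by (auto simp: range_def raise_def)

lemma raise_good:
  assumes "good E g (raise w N k) M" "finite M" "z \<in> N"
  shows "good E g (w(z := w z + k)) M"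
proof (cases "range w M")
  case True
  show ?thesis
  proof (rule good_weaken[OF assms(1,2) subset_refl])
    fix v assume "v \<in> M"
    then show "(w(z := w z + k)) v \<le> raise w N k v"
      using good_bound[OF assms(1,2), of v] True assms(3) by (auto simp: raise_def range_def split: if_splits)
  qed
next
  case False
  show ?thesis
  proof (rule good_weaken[OF assms(1,2) subset_refl])
    fix v assume "v \<in> M"
    then show "(w(z := w z + k)) v \<le> raise w N k v"
      using good_bound[OF assms(1,2), of v] assms(3) by (auto simp: raise_def split: if_splits)
  qed
qed

lemma raise_obstruction:
  assumes c: "crit V E g w" "wf_graph V E g" "range w V" "v \<in> V" "colors E g (raise w N ky) (V - {v}) M F"
    and d: "card {ed\<in>E. v \<in> g ed} = 3" and k: "comb ky kz" "w v + kz \<le> D + 1"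
  obtains z e0 where "z \<in> M" "e0 \<in> E" "g e0 = {v, z}" "z \<notin> N" "star E g v M = {e0}" "card (star E g v F) = 2"
    "\<not> good E g (w(z := w z + ky)) M" "colors E g w (V - {v}) M F"
proof -
  have fin: "finite (V - {v})" using c(2) by (auto simp: wf_graph_def)
  have c': "colors E g w (V - {v}) M F"
    by (rule colors_weaken[OF c(5) fin]) (use c(3) in \<open>auto simp: raise_def range_def\<close>)
  obtain z e0 where z: "z \<in> M" "e0 \<in> E" "g e0 = {v, z}" "star E g v M = {e0}" "card (star E g v F) = 2"
    "\<not> good E g (w(z := w z + ky)) M"
    using degree_three_obstruction[OF c(1,2,4) c' d k] by metis
  have g: "good E g (raise w N ky) M" "finite M" using c(5) fin by (auto simp: colors_def intro: finite_subset)
  have "z \<notin> N" using raise_good[OF g] z(6) by auto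
  then show ?thesis using that z c' by blast
qed

lemma pot_raise':
  assumes "finite B" "range w B"
  shows "po E g w B - h k * int (card (B \<inter> N)) \<le> po E g (raise w N k) B"
  by (rule pot_raise[OF assms]) (simp add: raise_def)

lemma pot_single_gt:
  assumes "\<And>ed. ed \<in> E \<Longrightarrow> card (g ed) = 2" "range w {v}"
  shows "- \<tau> < po E g w {v}"
  using pot_single[of E g w v, OF assms(1)] f_bounds[of "w v"] assms(2) eps tau by (auto simp: range_def)

end

definition nbrs :: "'e set \<Rightarrow> ('e \<Rightarrow> 'v set) \<Rightarrow> 'v \<Rightarrow> 'v set" where
  "nbrs E g v = {u. \<exists>ed\<in>E. g ed = {v, u}}"

lemma nbrs_sub: "wf_graph V E g \<Longrightarrow> nbrs E g v \<subseteq> V - {v}"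
  by (fastforce simp: nbrs_def wf_graph_def)

lemma card_nbrs:
  assumes "wf_graph V E g"
  shows "card (nbrs E g v) \<le> card {ed\<in>E. v \<in> g ed}" "finite (nbrs E g v)"
proof -
  have "nbrs E g v \<subseteq> (\<lambda>ed. THE u. g ed = {v, u}) ` {ed\<in>E. v \<in> g ed}"
  proof
    fix u assume "u \<in> nbrs E g v"
    then obtain ed where ed: "ed \<in> E" "g ed = {v, u}" by (auto simp: nbrs_def)
    then have "(THE u. g ed = {v, u}) = u" by (auto simp: doubleton_eq_iff)
    then show "u \<in> (\<lambda>ed. THE u. g ed = {v, u}) ` {ed\<in>E. v \<in> g ed}" using ed by force
  qed
  moreover have "finite {ed\<in>E. v \<in> g ed}" using assms by (simp add: wf_graph_def)
  ultimately show "card (nbrs E g v) \<le> card {ed\<in>E. v \<in> g ed}" "finite (nbrs E g v)"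
    using surj_card_le finite_surj by blast+
qed

lemma star_nbrs:
  assumes "wf_graph V E g" "nbrs E g v \<subseteq> B"
  shows "star E g v B = {ed\<in>E. v \<in> g ed}"
proof -
  have "g ed \<subseteq> insert v B" if ed: "ed \<in> E" "v \<in> g ed" for ed
  proof -
    have "card (g ed) = 2" using ed assms(1) by (auto simp: wf_graph_def)
    then obtain u where "g ed = {v, u}" using card2_other ed(2) by metis
    then show ?thesis using ed assms(2) by (auto simp: nbrs_def)
  qed
  then show ?thesis by (auto simp: star_def)
qed

context forest_coloring begin

definition bad :: "'v set \<Rightarrow> 'e set \<Rightarrow> ('e \<Rightarrow> 'v set) \<Rightarrow> ('v \<Rightarrow> nat) \<Rightarrow> bool" where
  "bad V E g w \<longleftrightarrow> crit V E g w \<and> wf_graph V E g \<and> cls V E g \<and> range w V \<and> - \<tau> < po E g w V \<and> IH (card V)"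

lemma badD:
  assumes "bad V E g w"
  shows "crit V E g w" "wf_graph V E g" "cls V E g" "range w V" "- \<tau> < po E g w V" "IH (card V)"
    "finite V" "finite E" "\<And>ed. ed \<in> E \<Longrightarrow> card (g ed) = 2" "\<not> col E g w V"
  using assms by (auto simp: bad_def wf_graph_def crit_def)

lemma bad_gap: "bad V E g w \<Longrightarrow> A \<subseteq> V \<Longrightarrow> A \<noteq> V \<Longrightarrow> 2 \<le> card A \<Longrightarrow> gmax < po E g w A"
  using gap unfolding bad_def by blast

lemma main_induct:
  assumes step: "\<And>V E g w. \<not> bad V E g w"
    and "crit V E g w" "wf_graph V E g" "cls V E g" "range w V"
  shows "po E g w V \<le> - \<tau>"
  using assms(2-)
proof (induction "card V" arbitrary: V E g w rule: less_induct)
  case less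
  have "IH (card V)" unfolding IH_def using less.hyps by blast
  then show ?case using step[of V E g w] less.prems unfolding bad_def by force
qed

lemma bad_col:
  assumes b: "bad V E g w" and A: "A \<subseteq> V" "A \<noteq> V" and r: "range w' A"
    and pos: "\<And>B. B \<subseteq> A \<Longrightarrow> 2 \<le> card B \<Longrightarrow> - \<tau> < po E g w' B"
  shows "col E g w' A"
proof -
  note bd = badD[OF b]
  have fin: "finite A" using A bd(7) finite_subset by blast
  have "col (edges_in E g A) g w' A"
  proof (rule col_criterion[OF bd(6) wf_graph_edges_in[OF bd(2) A(1)] cls_sub[OF bd(3) A(1) edges_in_sub] r])
    show "card A < card V" using A bd(7) by (simp add: psubset_card_mono psubsetI)
    fix B assume B: "B \<subseteq> A" "B \<noteq> {}"
    have finB: "finite B" using B fin finite_subset by blast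
    show "- \<tau> < po (edges_in E g A) g w' B"
    proof (cases "2 \<le> card B")
      case True
      then show ?thesis using pos[OF B(1)] pot_edges_in[OF B(1), of E g w'] by simp
    next
      case False
      moreover have "card B \<noteq> 0" using B finB by simp
      ultimately have "card B = 1" by linarith
      then obtain v where v: "B = {v}" using card_1_singletonE by blast
      have "range w' {v}" using r B v by (auto simp: range_def)
      then have "- \<tau> < po E g w' {v}" using pot_single_gt[of E g, OF bd(9)] by blast
      then show ?thesis using v pot_edges_in[OF B(1), of E g w'] by simp
    qed
  qed
  then show ?thesis using colors_edges_in fin unfolding col_def by blast
qed

lemma raise_two:
  assumes b: "bad V E g w" and A: "A \<subseteq> V" "A \<noteq> V" and N: "card N \<le> 2" "finite N" and h2: "2 * h k < gmax + 1 + \<tau>"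
  shows "col E g (raise w N k) A"
proof (rule bad_col[OF b A])
  note bd = badD[OF b]
  show "range (raise w N k) A" using range_raise bd(4) A(1) by (auto simp: range_def)
  fix B assume B: "B \<subseteq> A" "2 \<le> card B"
  have "B \<subseteq> V" "B \<noteq> V" using B A by auto
  then have p: "gmax < po E g w B" using bad_gap[OF b] B by blast
  have "finite B" "range w B" using B A bd(4,7) by (auto simp: range_def intro: finite_subset)
  then have "po E g w B - h k * int (card (B \<inter> N)) \<le> po E g (raise w N k) B" by (rule pot_raise')
  moreover have "card (B \<inter> N) \<le> 2" using card_mono[OF N(2), of "B \<inter> N"] N(1) by simp
  then have "h k * int (card (B \<inter> N)) \<le> h k * 2" using h_nonneg by (intro mult_left_mono) auto
  ultimately show "- \<tau> < po E g (raise w N k) B" using p h2 by linarith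
qed

lemma raise_three:
  assumes b: "bad V E g w" and v: "v \<in> V" "card {ed\<in>E. v \<in> g ed} = 3"
    and h2: "2 * h k < gmax + 1 + \<tau>" and h3: "3 * h k < gmax + 1 + \<tau> + 3 * \<epsilon> - f (w v)"
      "3 * h k < po E g w V + \<tau> + 3 * \<epsilon> - f (w v)"
  shows "col E g (raise w (nbrs E g v) k) (V - {v})"
proof (rule bad_col[OF b])
  note bd = badD[OF b]
  let ?N = "nbrs E g v"
  have N: "card ?N \<le> 3" "finite ?N" using card_nbrs[OF bd(2), of v] v(2) by auto
  show "V - {v} \<subseteq> V" "V - {v} \<noteq> V" using v by auto
  show "range (raise w ?N k) (V - {v})" using range_raise bd(4) by (auto simp: range_def)
  fix B assume B: "B \<subseteq> V - {v}" "2 \<le> card B"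
  have BV: "B \<subseteq> V" "B \<noteq> V" "v \<notin> B" using B v by auto
  then have p: "gmax < po E g w B" using bad_gap[OF b] B by blast
  have fB: "finite B" "range w B" using BV bd(4,7) by (auto simp: range_def intro: finite_subset)
  then have pr: "po E g w B - h k * int (card (B \<inter> ?N)) \<le> po E g (raise w ?N k) B" by (rule pot_raise')
  show "- \<tau> < po E g (raise w ?N k) B"
  proof (cases "card (B \<inter> ?N) \<le> 2")
    case True
    then have "h k * int (card (B \<inter> ?N)) \<le> h k * 2" using h_nonneg by (intro mult_left_mono) auto
    then show ?thesis using p h2 pr by linarith
  next
    case False
    have "card (B \<inter> ?N) \<le> card ?N" using N(2) by (intro card_mono) auto
    then have c3: "card (B \<inter> ?N) = 3" "card ?N = 3" using False N(1) by auto
    then have "B \<inter> ?N = ?N" using N(2) by (intro card_subset_eq) auto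
    then have "star E g v B = {ed\<in>E. v \<in> g ed}" using star_nbrs[OF bd(2)] by blast
    then have ins: "po E g w (insert v B) = po E g w B + f (w v) - 3 * \<epsilon>"
      using pot_insert[of B v E g w, OF fB(1) BV(3) bd(8,9)] v(2) by simp
    have "h k * int (card (B \<inter> ?N)) = 3 * h k" using c3 by simp
    moreover have "3 * h k < po E g w (insert v B) + \<tau> + 3 * \<epsilon> - f (w v)"
    proof (cases "insert v B = V")
      case True then show ?thesis using h3(2) by simp
    next
      case False
      have "2 \<le> card (insert v B)" using B(2) fB(1) BV(3) by simp
      then have "gmax < po E g w (insert v B)" using bad_gap[OF b _ False] BV v by auto
      then show ?thesis using h3(1) by linarith
    qed
    ultimately show ?thesis using ins pr by linarith
  qed
qed

lemma no_light_three_vertex: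
  assumes b: "bad V E g w" and v: "v \<in> V" "card {ed\<in>E. v \<in> g ed} = 3"
    and k: "comb ky kz" "w v + kz \<le> D + 1"
    and h2: "2 * h ky < gmax + 1 + \<tau>" and h3: "3 * h ky < gmax + 1 + \<tau> + 3 * \<epsilon> - f (w v)"
      "3 * h ky < po E g w V + \<tau> + 3 * \<epsilon> - f (w v)"
  shows False
proof -
  note bd = badD[OF b]
  obtain M F where c: "colors E g (raise w (nbrs E g v) ky) (V - {v}) M F"
    using raise_three[OF b v h2 h3] unfolding col_def by blast
  show False
  proof (rule raise_obstruction[OF bd(1,2,4) v(1) c v(2) k])
    fix z e0 assume "e0 \<in> E" "g e0 = {v, z}" "z \<notin> nbrs E g v"
    then show False by (auto simp: nbrs_def)
  qed
qed

lemma crit_two: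
  assumes c: "crit V E g w" "wf_graph V E g"
  shows "2 \<le> card V" and "card V = 2 \<Longrightarrow> v \<in> V \<Longrightarrow> \<not> w v \<le> D + 1"
proof -
  have card2: "\<And>ed. ed \<in> E \<Longrightarrow> card (g ed) = 2" and fin: "finite V" "finite E" using c(2) by (auto simp: wf_graph_def)
  have nc: "\<not> col E g w V" using c(1) by (simp add: crit_def)
  have one: "colors E g w {u} {} {u}" for u
  proof -
    have "edges_in E g {u} = {}" "edges_in E g {} = {}"
    proof -
      have "card (g ed) \<le> 1" if "g ed \<subseteq> {u}" for ed using card_mono[OF _ that] by simp
      then show "edges_in E g {u} = {}" "edges_in E g {} = {}" using card2 by (force simp: edges_in_def)+
    qed
    then show ?thesis using good_empty by (auto simp: colors_def acyc_def)
  qed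
  have "V \<noteq> {}" using nc col_empty[of E g w] card2 by auto
  then have "card V \<noteq> 0" using fin by simp
  moreover have "card V \<noteq> 1"
  proof
    assume "card V = 1"
    then obtain u where "V = {u}" using card_1_singletonE by blast
    then show False using one[of u] nc unfolding col_def by blast
  qed
  ultimately show "2 \<le> card V" by linarith
  assume V: "card V = 2" "v \<in> V"
  show "\<not> w v \<le> D + 1"
  proof
    assume wv: "w v \<le> D + 1"
    obtain u where u: "V = {v, u}" "u \<noteq> v" using V card2_other by metis
    have "star E g v {} = {}"
    proof -
      have "card (g ed) \<le> 1" if "g ed \<subseteq> {v}" for ed using card_mono[OF _ that] by simp
      then show ?thesis using card2 by (force simp: star_def)
    qed
    then have "colors E g w (insert v {u}) (insert v {}) {u}"
      by (intro colors_addM0[OF one]) (use u fin card2 wv in auto)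
    then show False using nc u unfolding col_def by auto
  qed
qed

lemma no_bad_easy:
  assumes K: "\<And>n. 1 \<le> n \<Longrightarrow> n \<le> D + 1 \<Longrightarrow> - s < 2 * f n - 3 * \<epsilon> \<Longrightarrow>
      \<exists>ky kz. comb ky kz \<and> n + kz \<le> D + 1 \<and> 2 * h ky < gmax + 1 + \<tau> \<and>
        3 * h ky < gmax + 1 + \<tau> + 3 * \<epsilon> - f n \<and> 3 * h ky \<le> 3 * \<epsilon> - f n"
    and s: "s \<le> 2" and b: "bad V E g w"
  shows "2 * po E g w V \<le> - s * int (card V)"
proof -
  note bd = badD[OF b]
  have "2 * f (w v) - \<epsilon> * int (card {ed\<in>E. v \<in> g ed}) \<le> - s" if v: "v \<in> V" for v
  proof -
    let ?d = "card {ed\<in>E. v \<in> g ed}"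
    have r: "1 \<le> w v" "w v \<le> D + 2" using bd(4) v by (auto simp: range_def)
    have d: "2 \<le> ?d" "w v \<le> D + 1 \<Longrightarrow> 3 \<le> ?d" using crit_degree[OF bd(1,2) v] by auto
    have mul: "\<epsilon> * int a \<le> \<epsilon> * int ?d" if "a \<le> ?d" for a using that eps by (intro mult_left_mono) auto
    consider "w v = D + 2" | "w v \<le> D + 1" "?d = 3" | "w v \<le> D + 1" "?d \<ge> 4" using d r by linarith
    then show ?thesis
    proof cases
      case 1
      then show ?thesis using f_top mul[OF d(1)] s by simp
    next
      case 2
      show ?thesis
      proof (rule ccontr)
        assume "\<not> ?thesis"
        then have "- s < 2 * f (w v) - 3 * \<epsilon>" using 2 by simp
        then obtain ky kz where k: "comb ky kz" "w v + kz \<le> D + 1" "2 * h ky < gmax + 1 + \<tau>"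
          "3 * h ky < gmax + 1 + \<tau> + 3 * \<epsilon> - f (w v)" "3 * h ky \<le> 3 * \<epsilon> - f (w v)"
          using K[OF r(1) 2(1)] by blast
        have "3 * h ky < po E g w V + \<tau> + 3 * \<epsilon> - f (w v)" using k(5) bd(5) by linarith
        then show False using no_light_three_vertex[OF b v 2(2) k(1-4)] by blast
      qed
    next
      case 3
      then show ?thesis using f_bounds[OF r] mul[of 4] s by linarith
    qed
  qed
  then have "(\<Sum>v\<in>V. 2 * f (w v) - \<epsilon> * int (card {ed\<in>E. v \<in> g ed})) \<le> (\<Sum>v\<in>V. - s)"
    by (intro sum_mono)
  then show ?thesis using handshake[OF bd(2), of w] by (simp add: mult.commute)
qed

end

lemma acyc_extend_vertex:
  assumes ac: "acyc (S \<union> C) g'" and S: "\<And>ed. ed \<in> S \<Longrightarrow> g' ed = g ed \<and> v \<notin> g ed" "finite S"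
    and T: "(\<exists>e. T \<subseteq> {e} \<and> v \<in> g e) \<or> (\<exists>c p q e1 e2. C = {c} \<and> c \<notin> S \<and> g' c = {p, q} \<and> p \<noteq> q \<and> v \<noteq> p \<and> v \<noteq> q \<and>
       T = {e1, e2} \<and> g e1 = {v, p} \<and> g e2 = {v, q})"
  shows "acyc (S \<union> T) g"
  using T
proof
  assume "\<exists>e. T \<subseteq> {e} \<and> v \<in> g e"
  then obtain e where e: "T \<subseteq> {e}" "v \<in> g e" by auto
  have acS: "acyc S g" by (rule acyc_mono[OF ac]) (use S in auto)
  show ?thesis
    unfolding acyc_def
  proof (intro allI impI)
    fix U assume U: "U \<subseteq> S \<union> T" "U \<noteq> {}"
    show "\<exists>x. card {ed\<in>U. x \<in> g ed} = 1"
    proof (cases "U \<subseteq> S")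
      case True
      then show ?thesis using acycE[OF acS True U(2)] by blast
    next
      case False
      then have "{ed\<in>U. v \<in> g ed} = {e}" using U e S(1) by blast
      then have "card {ed\<in>U. v \<in> g ed} = 1" by simp
      then show ?thesis by blast
    qed
  qed
next
  assume "\<exists>c p q e1 e2. C = {c} \<and> c \<notin> S \<and> g' c = {p, q} \<and> p \<noteq> q \<and> v \<noteq> p \<and> v \<noteq> q \<and>
       T = {e1, e2} \<and> g e1 = {v, p} \<and> g e2 = {v, q}"
  then obtain c p q e1 e2 where c: "C = {c}" "c \<notin> S" "g' c = {p, q}" "p \<noteq> q" "v \<noteq> p" "v \<noteq> q"
    "T = {e1, e2}" "g e1 = {v, p}" "g e2 = {v, q}" by blast
  have "acyc (insert c S) g'" using ac c(1) by simp
  then have "acyc (insert e1 (insert e2 S)) g"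
    by (rule acyc_subdivide) (use c S in auto)
  moreover have "S \<union> T = insert e1 (insert e2 S)" using c by auto
  ultimately show ?thesis by simp
qed

lemma wf_graph_add_edge:
  assumes "wf_graph A E g" "c \<notin> E" "p \<in> A" "q \<in> A" "p \<noteq> q"
  shows "wf_graph A (insert c E) (g(c := {p, q}))"
  using assms by (auto simp: wf_graph_def)

lemma edges_in_add_edge:
  assumes "c \<notin> E"
  shows "edges_in (insert c E) (g(c := {p, q})) B = edges_in E g B \<union> (if p \<in> B \<and> q \<in> B then {c} else {})"
  using assms by (auto simp: edges_in_def)

context forest_coloring begin

lemma pot_add_edge:
  assumes "c \<notin> E" "finite E"
  shows "po (insert c E) (g(c := {p, q})) w B = po E g w B - (if p \<in> B \<and> q \<in> B then \<epsilon> else 0)"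
proof -
  have "c \<notin> edges_in E g B" "finite (edges_in E g B)" using assms by (auto simp: edges_in_def)
  then show ?thesis unfolding pot_def edges_in_add_edge[OF assms(1)] by (simp add: algebra_simps)
qed

lemma col_criterion2:
  assumes "IH n" "wf_graph V E g" "cls V E g" "range w V" "card V < n"
    and pos: "\<And>B. B \<subseteq> V \<Longrightarrow> 2 \<le> card B \<Longrightarrow> - \<tau> < po E g w B"
  shows "col E g w V"
proof (rule col_criterion[OF assms(1-5)])
  fix B assume B: "B \<subseteq> V" "B \<noteq> {}"
  have finB: "finite B" using B assms(2) by (auto simp: wf_graph_def intro: finite_subset)
  show "- \<tau> < po E g w B"
  proof (cases "2 \<le> card B")
    case False
    moreover have "card B \<noteq> 0" using B finB by simp
    ultimately have "card B = 1" by linarith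
    then obtain v where v: "B = {v}" using card_1_singletonE by blast
    have r: "range w {v}" using assms(4) B v by (auto simp: range_def)
    have "card (g ed) = 2" if "ed \<in> E" for ed using that assms(2) by (auto simp: wf_graph_def)
    then show ?thesis using pot_single_gt[of E g w v] r v by blast
  qed (use pos B in blast)
qed

lemma colors_sub_edges:
  assumes "colors E g w A M F" "finite A" "\<And>B. B \<subseteq> A \<Longrightarrow> edges_in E' g' B \<subseteq> edges_in E g B"
    "\<And>ed. ed \<in> edges_in E' g' A \<Longrightarrow> g ed = g' ed"
  shows "colors E' g' w A M F"
proof -
  have s: "M \<subseteq> A" "F \<subseteq> A" using assms(1) by (auto simp: colors_def)
  have eq: "g' ed = g ed" if "ed \<in> edges_in E' g' N" "N \<subseteq> A" for ed N
    using assms(4)[of ed] subsetD[OF edges_in_mono[OF that(2)] that(1)] by simp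
  have c: "acyc (edges_in E g M) g" "acyc (edges_in E g F) g" "good E g w M" using assms(1) by (auto simp: colors_def)
  have 1: "acyc (edges_in E' g' M) g'" by (rule acyc_mono[OF c(1) assms(3)[OF s(1)]]) (rule eq[OF _ s(1)])
  have 2: "acyc (edges_in E' g' F) g'" by (rule acyc_mono[OF c(2) assms(3)[OF s(2)]]) (rule eq[OF _ s(2)])
  have 3: "good E' g' w M"
  proof (rule good_mono[OF c(3) finite_subset[OF s(1) assms(2)] subset_refl])
    fix ed assume "ed \<in> E'" "g' ed \<subseteq> M"
    then have a: "ed \<in> edges_in E' g' M" by (simp add: edges_in_def)
    then have "ed \<in> edges_in E g M" using assms(3)[OF s(1)] by blast
    then show "ed \<in> E \<and> g ed = g' ed" using eq[OF a s(1)] by (simp add: edges_in_def)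
  qed simp
  show ?thesis using assms(1) 1 2 3 by (simp add: colors_def)
qed

lemma good_raise_isolated:
  assumes M: "finite M" "good E g w M" "z \<in> M" and iso: "\<And>ed. ed \<in> E \<Longrightarrow> z \<in> g ed \<Longrightarrow> \<not> g ed \<subseteq> M"
    and card2: "\<And>ed. ed \<in> E \<Longrightarrow> card (g ed) = 2" and w: "w z + k \<le> D + 1"
  shows "good E g (w(z := w z + k)) M"
proof -
  have "good E g (w(z := w z + k)) ((M - {z}) \<union> {z})"
  proof (rule good_union)
    show "good E g (w(z := w z + k)) (M - {z})"
      by (rule good_weaken[OF M(2,1)]) auto
    show "good E g (w(z := w z + k)) {z}" by (rule good_single[of E g, OF card2]) (use w in auto)
    fix ed assume "ed \<in> E" "g ed \<subseteq> M - {z} \<union> {z}"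
    then show "g ed \<subseteq> M - {z} \<or> g ed \<subseteq> {z}" using iso[of ed] M(3) by blast
  qed (use M in auto)
  then show ?thesis using M(3) by (simp add: insert_absorb)
qed

end

section \<open>Odd component bounds\<close>

locale odd_forest_coloring = forest_coloring +
  fixes H :: nat
  assumes H: "1 \<le> H" "D + 1 = 2 * H" "\<epsilon> = 4 * int H" "\<tau> = 2" "gmax = 4 * int H - 1"
    and fH: "\<And>n. 1 \<le> n \<Longrightarrow> n \<le> D + 2 \<Longrightarrow> f n = 8 * int H + 1 - 2 * int n"
    and hH: "\<And>k. k \<le> D + 1 \<Longrightarrow> h k = 2 * int k"
    and combH: "\<And>a b. 1 \<le> a \<Longrightarrow> 1 \<le> b \<Longrightarrow> a + b = 2 * H \<Longrightarrow> comb a b"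
    and clsH: "\<And>V E g. cls V E g" and bigH: "\<And>E g A. 2 \<le> card A \<Longrightarrow> big E g A" and pxH: "px = 4 * int H - 1"
begin

definition light :: "'v set \<Rightarrow> 'e set \<Rightarrow> ('e \<Rightarrow> 'v set) \<Rightarrow> ('v \<Rightarrow> nat) \<Rightarrow> 'v \<Rightarrow> bool" where
  "light V E g w v \<longleftrightarrow> v \<in> V \<and> card {ed\<in>E. v \<in> g ed} = 3 \<and> w v \<le> H"

lemma odd_gap: "bad V E g w \<Longrightarrow> A \<subseteq> V \<Longrightarrow> A \<noteq> V \<Longrightarrow> 2 \<le> card A \<Longrightarrow> 4 * int H \<le> po E g w A"
  using bad_gap[of V E g w A] H(5) by linarith

lemma odd_pot: "bad V E g w \<Longrightarrow> -1 \<le> po E g w V"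
  using badD(5)[of V E g w] H(4) by linarith

lemma light_weight:
  assumes b: "bad V E g w" and l: "light V E g w v"
  shows "w v = H" "card (nbrs E g v) = 3"
proof -
  note bd = badD[OF b]
  have v: "v \<in> V" "card {ed\<in>E. v \<in> g ed} = 3" "w v \<le> H" using l by (auto simp: light_def)
  have r: "1 \<le> w v" "w v \<le> D + 2" using bd(4) v by (auto simp: range_def)
  have k: "comb (w v) (2 * H - w v)" "w v + (2 * H - w v) \<le> D + 1" using combH[of "w v" "2 * H - w v"] v(3) r(1) H(1,2) by auto
  have hv: "h (w v) = 2 * int (w v)" using hH[of "w v"] v(3) H(2) by simp
  have h2: "2 * h (w v) < gmax + 1 + \<tau>" using v(3) by (simp add: hv H)
  show "w v = H"
  proof (rule ccontr)
    assume "w v \<noteq> H"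
    then have "int (w v) \<le> int H - 1" using v(3) by linarith
    then show False
      using no_light_three_vertex[OF b v(1,2) k h2] odd_pot[OF b] by (simp add: hv H fH[OF r])
  qed
  show "card (nbrs E g v) = 3"
  proof (rule ccontr)
    assume n: "card (nbrs E g v) \<noteq> 3"
    have N: "card (nbrs E g v) \<le> 2" "finite (nbrs E g v)" using n card_nbrs[OF bd(2), of v] v(2) by auto
    have "V - {v} \<noteq> V" using v(1) by auto
    then obtain M F where c: "colors E g (raise w (nbrs E g v) (w v)) (V - {v}) M F"
      using raise_two[OF b _ _ N h2, of "V - {v}"] unfolding col_def by blast
    show False
    proof (rule raise_obstruction[OF bd(1,2,4) v(1) c v(2) k])
      fix z e0 assume "e0 \<in> E" "g e0 = {v, z}" "z \<notin> nbrs E g v"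
      then show False by (auto simp: nbrs_def)
    qed
  qed
qed

lemma light_edges:
  assumes b: "bad V E g w" and l: "light V E g w v" and z: "z \<in> nbrs E g v"
  obtains x y ex ey ez where "nbrs E g v = {x, y, z}" "x \<noteq> y" "x \<noteq> z" "y \<noteq> z" "x \<noteq> v" "y \<noteq> v" "z \<noteq> v"
    "x \<in> V" "y \<in> V" "z \<in> V" "{ed\<in>E. v \<in> g ed} = {ex, ey, ez}" "g ex = {v, x}" "g ey = {v, y}" "g ez = {v, z}"
    "ex \<noteq> ey" "ex \<noteq> ez" "ey \<noteq> ez"
proof -
  note bd = badD[OF b]
  have c3: "card (nbrs E g v) = 3" using light_weight[OF b l] by simp
  have "card (nbrs E g v - {z}) = 2" using c3 z card_nbrs(2)[OF bd(2), of v] by simp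
  then obtain x y where xy: "nbrs E g v - {z} = {x, y}" "x \<noteq> y" by (auto simp: card_2_iff)
  then have N: "nbrs E g v = {x, y, z}" "x \<noteq> z" "y \<noteq> z" using z by auto
  have sub: "{x, y, z} \<subseteq> V - {v}" using nbrs_sub[OF bd(2), of v] N by auto
  obtain ex ey ez where e: "ex \<in> E" "g ex = {v, x}" "ey \<in> E" "g ey = {v, y}" "ez \<in> E" "g ez = {v, z}"
  proof -
    have "x \<in> nbrs E g v" "y \<in> nbrs E g v" "z \<in> nbrs E g v" using N by auto
    then show ?thesis using that unfolding nbrs_def by blast
  qed
  have ne: "ex \<noteq> ey" "ex \<noteq> ez" "ey \<noteq> ez" using e xy(2) N(2,3) by (auto simp: doubleton_eq_iff)
  have "{ex, ey, ez} = {ed\<in>E. v \<in> g ed}"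
  proof (rule card_subset_eq)
    show "finite {ed\<in>E. v \<in> g ed}" using bd(8) by simp
    show "card {ex, ey, ez} = card {ed\<in>E. v \<in> g ed}" using ne l by (simp add: light_def)
  qed (use e in auto)
  then show ?thesis using that[of x y ex ey ez] N xy(2) sub e ne by auto
qed

lemma light_coloring:
  assumes b: "bad V E g w" and l: "light V E g w v" and z: "z \<in> nbrs E g v"
  obtains M F e0 where "colors E g w (V - {v}) M F" "z \<in> M" "g e0 = {v, z}" "star E g v M = {e0}"
    "\<not> good E g (w(z := w z + H)) M"
proof -
  note bd = badD[OF b]
  have v: "v \<in> V" "card {ed\<in>E. v \<in> g ed} = 3" using l by (auto simp: light_def)
  note wv = light_weight[OF b l]
  have k: "comb H H" "w v + H \<le> D + 1" using combH[of H H] wv H(1,2) by auto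
  let ?N = "nbrs E g v - {z}"
  have N: "card ?N \<le> 2" "finite ?N" using wv z card_nbrs(2)[OF bd(2), of v] by auto
  have h2: "2 * h H < gmax + 1 + \<tau>" using hH[of H] H(2,4,5) by simp
  have "V - {v} \<noteq> V" using v(1) by auto
  then obtain M F where c: "colors E g (raise w ?N H) (V - {v}) M F"
    using raise_two[OF b _ _ N h2, of "V - {v}"] unfolding col_def by blast
  show ?thesis
  proof (rule raise_obstruction[OF bd(1,2,4) v(1) c v(2) k])
    fix z' e0 assume a: "z' \<in> M" "e0 \<in> E" "g e0 = {v, z'}" "z' \<notin> ?N" "star E g v M = {e0}"
      "\<not> good E g (w(z' := w z' + H)) M" "colors E g w (V - {v}) M F"
    then have "z' = z" by (auto simp: nbrs_def)
    then show ?thesis using that a by blast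
  qed
qed

lemma light_nbr:
  assumes b: "bad V E g w" and l: "light V E g w v" and z: "z \<in> nbrs E g v"
  shows "w z \<le> D + 1" "\<not> light V E g w z"
proof -
  note bd = badD[OF b]
  obtain M F e0 where c: "colors E g w (V - {v}) M F" "z \<in> M" "g e0 = {v, z}" "star E g v M = {e0}"
    "\<not> good E g (w(z := w z + H)) M" using light_coloring[OF assms] .
  have vV: "v \<in> V" using l by (simp add: light_def)
  have fin: "finite (V - {v})" using bd(7) by simp
  have cd: "M \<union> F = V - {v}" "M \<inter> F = {}" "good E g w M" "finite M" using c(1) fin by (auto simp: colors_def intro: finite_subset)
  show "w z \<le> D + 1" using good_bound[OF cd(3,4) c(2)] .
  have zv: "z \<noteq> v" "z \<notin> F" "v \<notin> F" "v \<notin> M" using cd c(2) by auto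
  have e0: "e0 \<in> E" "v \<in> g e0" using c(3,4) by (auto simp: star_def)
  have F2: "2 \<le> card (star E g z F)"
  proof (rule ccontr)
    assume "\<not> ?thesis"
    then have s1: "card (star E g z F) \<le> 1" by simp
    have "colors E g w (V - {v} - {z}) (M - {z}) F"
    proof -
      have "acyc (edges_in E g (M - {z})) g"
        by (rule acyc_mono[of "edges_in E g M" g]) (use c(1) in \<open>auto simp: colors_def edges_in_def\<close>)
      moreover have "good E g w (M - {z})" by (rule good_weaken[OF cd(3,4)]) auto
      ultimately show ?thesis using c(1) c(2) unfolding colors_def by auto
    qed
    then have "colors E g w (insert z (V - {v} - {z})) (M - {z}) (insert z F)"
      by (rule colors_addF) (use s1 bd(8) in auto)
    moreover have "insert z (V - {v} - {z}) = V - {v}" using c(2) cd(1) by auto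
    ultimately have c': "colors E g w (V - {v}) (M - {z}) (insert z F)" by simp
    have "w v \<le> D + 1" using light_weight[OF b l] H by simp
    then have "1 \<le> card (star E g v (M - {z}))" by (rule crit_star(2)[OF bd(1,2) vV c'])
    moreover have "star E g v (M - {z}) \<subseteq> star E g v M" by (auto simp: star_def)
    then have "star E g v (M - {z}) \<subseteq> {e0}" using c(4) by simp
    moreover have "e0 \<notin> star E g v (M - {z})" using c(3) zv by (auto simp: star_def)
    ultimately show False by (metis card.empty not_one_le_zero subset_insert subset_empty insert_absorb)
  qed
  show "\<not> light V E g w z"
  proof
    assume lz: "light V E g w z"
    have "star E g z F \<union> {e0} \<subseteq> {ed\<in>E. z \<in> g ed}" using e0 c(3) by (auto simp: star_def)
    moreover have "e0 \<notin> star E g z F" using e0(2) zv by (auto simp: star_def)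
    then have "card (star E g z F \<union> {e0}) \<ge> 3" using F2 finite_star[OF bd(8), of g z F] by simp
    moreover have "card {ed\<in>E. z \<in> g ed} = 3" using lz by (simp add: light_def)
    ultimately have eq: "star E g z F \<union> {e0} = {ed\<in>E. z \<in> g ed}"
      using bd(8) by (intro card_seteq) auto
    have "good E g (w(z := w z + H)) M"
    proof (rule good_raise_isolated[OF cd(4,3) c(2) _ bd(9)])
      show "w z + H \<le> D + 1" using lz H(2) by (simp add: light_def)
      fix ed assume ed: "ed \<in> E" "z \<in> g ed"
      show "\<not> g ed \<subseteq> M"
      proof
        assume gM: "g ed \<subseteq> M"
        have "ed \<in> star E g z F \<union> {e0}" using eq ed by blast
        moreover have "ed \<noteq> e0" using gM e0(2) zv(4) by auto
        ultimately have "g ed \<subseteq> insert z F" by (auto simp: star_def)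
        then have "g ed \<subseteq> {z}" using gM cd(2) by auto
        then have "card (g ed) \<le> card {z}" by (intro card_mono) auto
        then show False using bd(9)[OF ed(1)] by simp
      qed
    qed
    then show False using c(5) by blast
  qed
qed

end

lemma acyc_Un_subdivide:
  assumes ac: "acyc (S \<union> (if p \<in> F \<and> q \<in> F then {c} else {})) g'"
    and S: "\<And>ed. ed \<in> S \<Longrightarrow> g' ed = g ed \<and> v \<notin> g ed" "finite S" "c \<notin> S" "g' c = {p, q}"
    and T: "g e1 = {v, p}" "g e2 = {v, q}" "T \<subseteq> {e1, e2}" "e1 \<in> T \<longleftrightarrow> p \<in> F" "e2 \<in> T \<longleftrightarrow> q \<in> F"
    and pq: "p \<noteq> q" "p \<noteq> v" "q \<noteq> v"
  shows "acyc (S \<union> T) g"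
proof (rule acyc_extend_vertex[OF ac S(1,2)])
  show "(\<exists>e. T \<subseteq> {e} \<and> v \<in> g e) \<or>
    (\<exists>c' p' q' e1 e2. (if p \<in> F \<and> q \<in> F then {c} else {}) = {c'} \<and> c' \<notin> S \<and>
       g' c' = {p', q'} \<and> p' \<noteq> q' \<and> v \<noteq> p' \<and> v \<noteq> q' \<and>
       T = {e1, e2} \<and> g e1 = {v, p'} \<and> g e2 = {v, q'})"
  proof (cases "p \<in> F \<and> q \<in> F")
    case True
    then have "T = {e1, e2}" using T by blast
    then have "(if p \<in> F \<and> q \<in> F then {c} else {}) = {c} \<and> c \<notin> S \<and>
       g' c = {p, q} \<and> p \<noteq> q \<and> v \<noteq> p \<and> v \<noteq> q \<and> T = {e1, e2} \<and> g e1 = {v, p} \<and> g e2 = {v, q}"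
      using True S T pq by simp
    then show ?thesis by blast
  next
    case False
    then have "T \<subseteq> {e1} \<or> T \<subseteq> {e2}" using T by blast
    then show ?thesis using T(1,2) by blast
  qed
qed

lemma acyc_insert_subdivide:
  assumes ac: "acyc (edges_in E g F \<union> (if p \<in> F \<and> q \<in> F then {c} else {})) g'"
    and g': "\<And>ed. ed \<in> edges_in E g F \<Longrightarrow> g' ed = g ed" "g' c = {p, q}" "c \<notin> edges_in E g F" and v: "v \<notin> F" "finite E"
    and e: "e1 \<in> E" "e2 \<in> E" "g e1 = {v, p}" "g e2 = {v, q}" "star E g v F \<subseteq> {e1, e2}"
    and pq: "p \<noteq> q" "p \<noteq> v" "q \<noteq> v"
  shows "acyc (edges_in E g (insert v F)) g"
  unfolding edges_in_insert
proof (rule acyc_Un_subdivide[OF ac _ _ g'(3,2) e(3-5) _ _ pq])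
  show "finite (edges_in E g F)" using v(2) by (rule finite_edges_in)
  fix ed assume a: "ed \<in> edges_in E g F"
  then have "v \<notin> g ed" using v(1) by (auto simp: edges_in_def)
  then show "g' ed = g ed \<and> v \<notin> g ed" using g'(1)[OF a] by blast
qed (use e pq in \<open>auto simp: star_def\<close>)

context odd_forest_coloring begin

lemma colors_insertF:
  "colors E g w U M F \<Longrightarrow> v \<notin> U \<Longrightarrow> acyc (edges_in E g (insert v F)) g \<Longrightarrow> colors E g w (insert v U) M (insert v F)"
  unfolding colors_def by blast

lemma f_H: "f H = 6 * int H + 1"
  using fH[of H] H by simp

lemma light_pot_insert:
  assumes b: "bad V E g w" and l: "light V E g w v" and B: "B \<subseteq> V" "v \<notin> B" and S: "S \<subseteq> star E g v B"
  shows "po E g w (insert v B) \<le> po E g w B + 6 * int H + 1 - 4 * int H * int (card S)"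
proof -
  note bd = badD[OF b]
  have "finite B" using B(1) bd(7) finite_subset by blast
  from pot_insert_le[of B v E g S w, OF this B(2) bd(8,9) S] show ?thesis
    using light_weight(1)[OF b l] f_H H(3) by simp
qed

text \<open>
  If \<open>z\<close> had degree three, delete \<open>v\<close> and \<open>z\<close> and add an edge between the other two neighbors
  of \<open>z\<close> or, if these coincide, of \<open>v\<close>.
\<close>

lemma light_nbr_degree:
  assumes b: "bad V E g w" and l: "light V E g w v" and z: "z \<in> nbrs E g v"
  shows "4 \<le> card {ed\<in>E. z \<in> g ed}"
proof (rule ccontr)
  assume n4: "\<not> ?thesis"
  note bd = badD[OF b]
  obtain x y ex ey ez where N: "nbrs E g v = {x, y, z}" "x \<noteq> y" "x \<noteq> z" "y \<noteq> z" "x \<noteq> v" "y \<noteq> v" "z \<noteq> v"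
    "x \<in> V" "y \<in> V" "z \<in> V" and inc: "{ed\<in>E. v \<in> g ed} = {ex, ey, ez}" and ge: "g ex = {v, x}" "g ey = {v, y}" "g ez = {v, z}"
    and ne: "ex \<noteq> ey" "ex \<noteq> ez" "ey \<noteq> ez" using light_edges[OF b l z] .
  have vV: "v \<in> V" and d3: "card {ed\<in>E. v \<in> g ed} = 3" using l by (auto simp: light_def)
  have eE: "ex \<in> E" "ey \<in> E" "ez \<in> E" using inc by blast+
  have wz: "w z \<le> D + 1" and nl: "\<not> light V E g w z" using light_nbr[OF b l z] by auto
  have "3 \<le> card {ed\<in>E. z \<in> g ed}" using crit_degree(2)[OF bd(1,2) N(10) wz] .
  then have dz: "card {ed\<in>E. z \<in> g ed} = 3" using n4 by linarith
  then have wH: "H + 1 \<le> w z" using nl N(10) by (auto simp: light_def)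
  have wv: "w v = H" using light_weight[OF b l] by simp
  have fz: "f (w z) \<le> 6 * int H - 1" using fH[of "w z"] wz wH by auto
  have "ez \<in> {ed\<in>E. z \<in> g ed}" using eE ge by auto
  then have "card ({ed\<in>E. z \<in> g ed} - {ez}) = 2" using dz bd(8) by simp
  then obtain b1 b2 where bb: "{ed\<in>E. z \<in> g ed} - {ez} = {b1, b2}" "b1 \<noteq> b2" by (auto simp: card_2_iff)
  then have b12: "b1 \<in> E" "z \<in> g b1" "b1 \<noteq> ez" "b2 \<in> E" "z \<in> g b2" "b2 \<noteq> ez" by auto
  have incz: "{ed\<in>E. z \<in> g ed} = {ez, b1, b2}" using bb \<open>ez \<in> {ed\<in>E. z \<in> g ed}\<close> by blast
  obtain a where a: "g b1 = {z, a}" "a \<noteq> z" using card2_other[OF bd(9)[OF b12(1)] b12(2)] by metis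
  obtain a' where a': "g b2 = {z, a'}" "a' \<noteq> z" using card2_other[OF bd(9)[OF b12(4)] b12(5)] by metis
  have notv: "v \<notin> g ed" if "ed = b1 \<or> ed = b2" for ed
  proof
    assume "v \<in> g ed"
    then have "ed \<in> {ex, ey, ez}" using that b12 inc by blast
    moreover have "z \<in> g ed" "ed \<noteq> ez" using that b12 by auto
    ultimately show False using ge N(3,4,7) by auto
  qed
  have av: "a \<noteq> v" "a' \<noteq> v" using notv[of b1] notv[of b2] a a' by auto
  have aV: "a \<in> V" "a' \<in> V" using bd(2) b12 a a' by (auto simp: wf_graph_def)
  define A where "A = V - {v, z}"
  have A: "A \<subseteq> V" "A \<noteq> V" "v \<notin> A" "z \<notin> A" "finite A" "insert z A = V - {v}" using vV N bd(7) unfolding A_def by auto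
  have inA: "a \<in> A" "a' \<in> A" "x \<in> A" "y \<in> A" using a a' av aV N unfolding A_def by auto
  define E0 where "E0 = edges_in E g A"
  have E0: "wf_graph A E0 g" "finite E0" "b1 \<notin> E0" "E0 \<subseteq> E"
    using wf_graph_edges_in[OF bd(2) A(1)] b12 A(4) bd(8) unfolding E0_def by (auto simp: edges_in_def)
  have cardA: "card A < card V" using A bd(7) by (simp add: psubset_card_mono psubsetI)
  have rA: "range w A" using bd(4) A(1) by (auto simp: range_def)
  have starz: "star E g z B \<subseteq> {b1, b2}" if "v \<notin> B" for B
  proof
    fix d assume d: "d \<in> star E g z B"
    then have "d \<in> {ez, b1, b2}" using incz by (auto simp: star_def)
    moreover have "d \<noteq> ez" using d that ge N(7) by (auto simp: star_def)
    ultimately show "d \<in> {b1, b2}" by blast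
  qed
  have starv: "star E g v B \<subseteq> {ex, ey}" if "z \<notin> B" for B
    using inc that ge N(7) by (auto simp: star_def)
  have down: "colors E g w' A M F" "acyc (edges_in E g F \<union> (if p \<in> F \<and> q \<in> F then {b1} else {})) (g(b1 := {p, q}))"
    if "colors (insert b1 E0) (g(b1 := {p, q})) w' A M F" "p \<in> A" "q \<in> A" for p q w' M F
  proof -
    have s: "M \<subseteq> A" "F \<subseteq> A" using that(1) by (auto simp: colors_def)
    have ein: "edges_in (insert b1 E0) (g(b1 := {p, q})) B = edges_in E g B \<union> (if p \<in> B \<and> q \<in> B then {b1} else {})" if "B \<subseteq> A" for B
      using edges_in_add_edge[OF E0(3)] edges_in_idem[OF that] unfolding E0_def by metis
    show "acyc (edges_in E g F \<union> (if p \<in> F \<and> q \<in> F then {b1} else {})) (g(b1 := {p, q}))"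
      using that(1) ein[OF s(2)] by (simp add: colors_def)
    show "colors E g w' A M F"
    proof (rule colors_sub_edges[OF that(1) A(5)])
      show "edges_in E g B \<subseteq> edges_in (insert b1 E0) (g(b1 := {p, q})) B" if "B \<subseteq> A" for B using ein[OF that] by auto
      fix ed assume "ed \<in> edges_in E g A"
      then have "ed \<noteq> b1" using E0(3) unfolding E0_def by blast
      then show "(g(b1 := {p, q})) ed = g ed" by simp
    qed
  qed
  have potE0: "po (insert b1 E0) (g(b1 := {p, q})) w' B = po E g w' B - (if p \<in> B \<and> q \<in> B then \<epsilon> else 0)" if "B \<subseteq> A" for B p q w'
    using pot_add_edge[OF E0(3,2), of g p q w' B] pot_edges_in[OF that, of E g w'] unfolding E0_def by simp
  have gapB: "4 * int H \<le> po E g w B" if "B \<subseteq> A" "2 \<le> card B" for B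
  proof -
    have "B \<subseteq> V" "B \<noteq> V" using that A by auto
    then show ?thesis using odd_gap[OF b] that by blast
  qed
  show False
  proof (cases "a = a'")
    case False
    define w' where "w' = raise w {x, y} H"
    have "col (insert b1 E0) (g(b1 := {a, a'})) w' A"
    proof (rule col_criterion2[OF bd(6) wf_graph_add_edge[OF E0(1,3) inA(1,2) False] clsH _ cardA])
      show "range w' A" unfolding w'_def by (rule range_raise[OF rA])
      fix B assume B: "B \<subseteq> A" "2 \<le> card B"
      have BV: "B \<subseteq> V" "v \<notin> B" "z \<notin> B" "finite B" using B A finite_subset by blast+
      define j where "j = card (B \<inter> {x, y})"
      have "range w B" using rA B by (auto simp: range_def)
      then have pr: "po E g w B - 2 * int H * int j \<le> po E g w' B"
        using pot_raise'[OF BV(4), of w E g H "{x, y}"] hH[of H] H(2) unfolding w'_def j_def by simp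
      have j2: "j \<le> 2" unfolding j_def using card_mono[of "{x, y}" "B \<inter> {x, y}"] N(2) by simp
      have val: "-1 \<le> po E g w B - 2 * int H * int j - (if a \<in> B \<and> a' \<in> B then 4 * int H else 0)"
      proof (cases "(a \<in> B \<and> a' \<in> B) \<and> j \<noteq> 0")
        case False
        have "2 * int H * int j \<le> 2 * int H * 2" using j2 by (intro mult_left_mono) auto
        then show ?thesis using gapB[OF B] False by auto
      next
        case True
        have s1: "{b1, b2} \<subseteq> star E g z B" using True a a' b12 by (auto simp: star_def)
        have p1: "po E g w (insert z B) \<le> po E g w B + f (w z) - 4 * int H * 2"
          using pot_insert_le[of B z E g "{b1, b2}" w, OF BV(4,3) bd(8,9) s1] bb(2) H(3) by simp
        let ?S = "insert ez ((\<lambda>u. if u = x then ex else ey) ` (B \<inter> {x, y}))"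
        have S: "?S \<subseteq> star E g v (insert z B)" using eE ge by (auto simp: star_def)
        have "card ((\<lambda>u. if u = x then ex else ey) ` (B \<inter> {x, y})) = j"
          unfolding j_def by (rule card_image) (use ne(1) in \<open>auto simp: inj_on_def\<close>)
        moreover have "ez \<notin> (\<lambda>u. if u = x then ex else ey) ` (B \<inter> {x, y})" using ne by auto
        ultimately have cS: "card ?S = j + 1" by simp
        have zB: "insert z B \<subseteq> V" "v \<notin> insert z B" using BV N by auto
        let ?U = "insert v (insert z B)"
        have p2: "po E g w ?U \<le> po E g w (insert z B) + 6 * int H + 1 - 4 * int H * (int j + 1)"
          using light_pot_insert[OF b l zB S] by (simp only: cS of_nat_add of_nat_1)
        have U: "?U \<subseteq> V" "2 \<le> card ?U"
        proof -
          show "?U \<subseteq> V" using zB vV by auto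
          have "card B \<le> card ?U" using BV(4) by (intro card_mono) auto
          then show "2 \<le> card ?U" using B(2) by linarith
        qed
        have "j = 1 \<or> j = 2" using True j2 by linarith
        then show ?thesis
        proof
          assume j1: "j = 1"
          have "?U \<noteq> V"
          proof
            assume "?U = V"
            then have "x \<in> B" "y \<in> B" using N by auto
            then have "B \<inter> {x, y} = {x, y}" by auto
            then show False using j1 N(2) unfolding j_def by simp
          qed
          then have "4 * int H \<le> po E g w ?U" using odd_gap[OF b U(1) _ U(2)] by blast
          then show ?thesis using p1 p2 fz j1 True by simp
        next
          assume j2: "j = 2"
          have "-1 \<le> po E g w ?U"
          proof (cases "?U = V")
            case True then show ?thesis using odd_pot[OF b] by simp
          next
            case False
            then have "4 * int H \<le> po E g w ?U" using odd_gap[OF b U(1) _ U(2)] by blast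
            then show ?thesis by linarith
          qed
          then show ?thesis using p1 p2 fz j2 True by simp
        qed
      qed
      show "- \<tau> < po (insert b1 E0) (g(b1 := {a, a'})) w' B"
        using potE0[OF B(1), of a a' w'] val pr H(3,4) by (auto split: if_splits)
    qed
    then obtain M F where c1: "colors (insert b1 E0) (g(b1 := {a, a'})) w' A M F" unfolding col_def by blast
    note c = down[OF c1 inA(1,2)]
    have FA: "F \<subseteq> A" using c(1) by (auto simp: colors_def)
    have "acyc (edges_in E g (insert z F)) g"
    proof (rule acyc_insert_subdivide[OF c(2)])
      show "star E g z F \<subseteq> {b1, b2}" using starz FA A(3) by blast
      show "z \<notin> F" using FA A(4) by blast
      show "b1 \<notin> edges_in E g F" using b12(2) FA A(4) by (auto simp: edges_in_def)
      then show "(g(b1 := {a, a'})) ed = g ed" if "ed \<in> edges_in E g F" for ed using that by auto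
    qed (use a a' b12 False bd(8) in auto)
    then have "colors E g w' (insert z A) M (insert z F)" by (rule colors_insertF[OF c(1) A(4)])
    then have cc: "colors E g (raise w {x, y} H) (V - {v}) M (insert z F)" using A(6) unfolding w'_def by simp
    have k: "comb H H" "w v + H \<le> D + 1" using combH[of H H] wv H(1,2) by auto
    show False
    proof (rule raise_obstruction[OF bd(1,2,4) vV cc d3 k])
      fix z' e0 assume z': "z' \<in> M" "e0 \<in> E" "g e0 = {v, z'}" "z' \<notin> {x, y}"
      then have "z' \<in> nbrs E g v" by (auto simp: nbrs_def)
      then have "z' = z" using N(1) z'(4) by auto
      then show False using z'(1) cc by (auto simp: colors_def)
    qed
  next
    case aa: True
    have "col (insert b1 E0) (g(b1 := {x, y})) w A"
    proof (rule col_criterion2[OF bd(6) wf_graph_add_edge[OF E0(1,3) inA(3,4) N(2)] clsH rA cardA])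
      fix B assume B: "B \<subseteq> A" "2 \<le> card B"
      then show "- \<tau> < po (insert b1 E0) (g(b1 := {x, y})) w B"
        using potE0[OF B(1), of x y w] gapB[OF B] H(3,4) by auto
    qed
    then obtain M F where c1: "colors (insert b1 E0) (g(b1 := {x, y})) w A M F" unfolding col_def by blast
    note c = down[OF c1 inA(3,4)]
    have MF: "F \<subseteq> A" "M \<subseteq> A" "M \<inter> F = {}" "M \<union> F = A" using c(1) by (auto simp: colors_def)
    have VV: "insert v (insert z A) = V" "insert z (insert v A) = V" using A(6) vV by auto
    have wz': "w v \<le> D + 1" using wv H(2) by simp
    have sz: "star E g z B = {}" if "v \<notin> B" "a \<notin> B" for B
    proof (intro equals0I)
      fix d assume d: "d \<in> star E g z B"
      then have "d = b1 \<or> d = b2" using starz[OF that(1)] by blast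
      then have "g d = {z, a}" using a a' aa by auto
      then show False using d that(2) a(2) by (auto simp: star_def)
    qed
    have "col E g w V"
    proof (cases "a \<in> F")
      case True
      have "star E g z M = {}" using sz[of M] MF A(3) True by blast
      then have c2: "colors E g w (insert z A) (insert z M) F"
        by (intro colors_addM0[OF c(1) A(4) _ bd(8) A(5) bd(9) wz]) auto
      have "acyc (edges_in E g (insert v F)) g"
      proof (rule acyc_insert_subdivide[OF c(2)])
        show "star E g v F \<subseteq> {ex, ey}" using starv MF A(4) by blast
        show "v \<notin> F" using MF A(3) by blast
        show "b1 \<notin> edges_in E g F" using b12(2) MF A(4) by (auto simp: edges_in_def)
        then show "(g(b1 := {x, y})) ed = g ed" if "ed \<in> edges_in E g F" for ed using that by auto
      qed (use N ge eE bd(8) in auto)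
      then have "colors E g w (insert v (insert z A)) (insert z M) (insert v F)"
        using A(3) N(7) by (intro colors_insertF[OF c2]) auto
      then show ?thesis using VV unfolding col_def by auto
    next
      case False
      then have aM: "a \<in> M" using MF inA by auto
      show ?thesis
      proof (cases "x \<in> F \<and> y \<in> F")
        case True
        have "star E g z F = {}" using sz[of F] MF A(3) False by blast
        then have c2: "colors E g w (insert z A) M (insert z F)"
          by (intro colors_addF[OF c(1) A(4) _ bd(8)]) simp
        have "x \<notin> M" "y \<notin> M" using True MF by auto
        have "star E g v M = {}"
        proof (intro equals0I)
          fix d assume d: "d \<in> star E g v M"
          have "z \<notin> M" using MF A(4) by blast
          then have "d = ex \<or> d = ey" using starv[of M] d by blast
          then have "x \<in> M \<or> y \<in> M" using d ge N(5,6) by (auto simp: star_def)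
          then show False using \<open>x \<notin> M\<close> \<open>y \<notin> M\<close> by blast
        qed
        then have "colors E g w (insert v (insert z A)) (insert v M) (insert z F)"
          using A N(7) wz' bd(7) by (intro colors_addM0[OF c2 _ _ bd(8) _ bd(9)]) auto
        then show ?thesis using VV unfolding col_def by auto
      next
        case nf: False
        have "ex \<notin> star E g v F \<or> ey \<notin> star E g v F" using nf ge N(5,6) by (auto simp: star_def)
        moreover have "star E g v F \<subseteq> {ex, ey}" using starv[of F] MF A(4) by blast
        ultimately have "star E g v F \<subseteq> {ex} \<or> star E g v F \<subseteq> {ey}" by blast
        then have "card (star E g v F) \<le> 1" by (auto dest: subset_singletonD)
        then have c2: "colors E g w (insert v A) M (insert v F)"
          by (rule colors_addF[OF c(1) A(3) _ bd(8)])
        have "star E g z (insert v F) \<subseteq> {ez}"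
        proof
          fix d assume d: "d \<in> star E g z (insert v F)"
          then have "d = ez \<or> d = b1 \<or> d = b2" using incz by (auto simp: star_def)
          moreover have "d \<noteq> b1" "d \<noteq> b2" using d a a' aa False av by (auto simp: star_def)
          ultimately show "d \<in> {ez}" by blast
        qed
        then have "card (star E g z (insert v F)) \<le> 1" by (auto dest: subset_singletonD)
        then have "colors E g w (insert z (insert v A)) M (insert z (insert v F))"
          using A(4) N(7) by (intro colors_addF[OF c2 _ _ bd(8)]) auto
        then show ?thesis using VV unfolding col_def by auto
      qed
    qed
    then show False using bd(10) by blast
  qed
qed

text \<open>
  Color \<open>C\<close> with \<open>u\<close> forced into \<open>F\<close>, contract it, and color \<open>G - v2\<close> with reserves at the
  other two neighbors of \<open>v2\<close>. The vertex \<open>v3\<close> is only needed to keep the relevant sets proper.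
\<close>

lemma no_tight_set:
  assumes b: "bad V E g w" and C: "C \<subseteq> V" "2 \<le> card C" "po E g w C \<le> 4 * int H" "u \<in> C"
    and l2: "light V E g w v2" "u \<in> nbrs E g v2" "v2 \<notin> C"
    and l3: "light V E g w v3" "u \<in> nbrs E g v3" "v3 \<notin> C" and ne23: "v2 \<noteq> v3"
  shows False
proof -
  note bd = badD[OF b]
  obtain p q ep eq eu where N: "nbrs E g v2 = {p, q, u}" "p \<noteq> q" "p \<noteq> u" "q \<noteq> u" "p \<noteq> v2" "q \<noteq> v2" "u \<noteq> v2"
    "p \<in> V" "q \<in> V" "u \<in> V" and inc: "{ed\<in>E. v2 \<in> g ed} = {ep, eq, eu}" and ge: "g ep = {v2, p}" "g eq = {v2, q}" "g eu = {v2, u}"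
    and ne: "ep \<noteq> eq" "ep \<noteq> eu" "eq \<noteq> eu" using light_edges[OF b l2(1,2)] .
  have eE: "ep \<in> E" "eq \<in> E" "eu \<in> E" using inc by blast+
  have vV: "v2 \<in> V" "v3 \<in> V" and d3: "card {ed\<in>E. v2 \<in> g ed} = 3" using l2 l3 by (auto simp: light_def)
  have wv: "w v2 = H" using light_weight[OF b l2(1)] by simp
  have finC: "finite C" using C(1) bd(7) finite_subset by blast
  have "x \<notin> C" if x: "x = p \<or> x = q" for x
  proof
    assume xC: "x \<in> C"
    obtain e' where e': "e' \<in> E" "g e' = {v2, x}" "e' \<noteq> eu" using x eE ge ne by auto
    have "{eu, e'} \<subseteq> star E g v2 C" using e' xC C(4) eE ge by (auto simp: star_def)
    from light_pot_insert[OF b l2(1) C(1) l2(3) this]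
    have "po E g w (insert v2 C) \<le> 4 * int H + 6 * int H + 1 - 4 * int H * 2" using C(3) e'(3) by simp
    moreover have "4 * int H \<le> po E g w (insert v2 C)"
    proof (rule odd_gap[OF b])
      show "insert v2 C \<subseteq> V" using C vV by auto
      show "insert v2 C \<noteq> V" using l3(3) vV ne23 by auto
      show "2 \<le> card (insert v2 C)" using C(2) finC l2(3) by simp
    qed
    ultimately show False using H(1) by linarith
  qed
  then have pqC: "p \<notin> C" "q \<notin> C" by auto
  have CneV: "C \<noteq> V" using vV l2 by auto
  have "col E g (raise w {u} (D + 2)) C"
  proof (rule bad_col[OF b C(1) CneV])
    show "range (raise w {u} (D + 2)) C" by (rule range_raise) (use bd(4) C(1) in \<open>auto simp: range_def\<close>)
    fix B assume B: "B \<subseteq> C" "2 \<le> card B"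
    have "4 * int H \<le> po E g w B" using odd_gap[OF b _ _ B(2)] B(1) C(1) CneV by blast
    moreover have "finite B" "range w B" using B C(1) bd(4) finC by (auto simp: range_def intro: finite_subset)
    then have "po E g w B - h (D + 2) * int (card (B \<inter> {u})) \<le> po E g (raise w {u} (D + 2)) B" by (rule pot_raise')
    moreover have "card (B \<inter> {u}) \<le> 1" using card_mono[of "{u}" "B \<inter> {u}"] by simp
    then have "h (D + 2) * int (card (B \<inter> {u})) \<le> h (D + 2) * 1" using h_nonneg by (intro mult_left_mono) auto
    ultimately show "- \<tau> < po E g (raise w {u} (D + 2)) B" using h_top H(3,4) by linarith
  qed
  then obtain MA FA where cA: "colors E g (raise w {u} (D + 2)) C MA FA" unfolding col_def by blast
  have MFA: "MA \<union> FA = C" "MA \<inter> FA = {}" "good E g (raise w {u} (D + 2)) MA" "finite MA"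
    using cA finC by (auto simp: colors_def intro: finite_subset)
  have "1 \<le> w u" using bd(4) N(10) by (auto simp: range_def)
  then have uF: "u \<in> FA" using good_bound[OF MFA(3,4), of u] MFA(1) C(4) by (auto simp: raise_def)
  define V0 where "V0 = V - {v2}"
  define E0 where "E0 = edges_in E g V0"
  define w0 where "w0 = raise w {p, q} H"
  have V0: "V0 \<subseteq> V" "C \<subseteq> V0" "v3 \<in> V0 - C" "card V0 < card V"
    using C l2 l3 vV ne23 card_Diff1_less[OF bd(7) vV(1)] unfolding V0_def by auto
  have wf0: "wf_graph V0 E0 g" unfolding E0_def by (rule wf_graph_edges_in[OF bd(2) V0(1)])
  have r0: "range w0 V0" unfolding w0_def by (rule range_raise) (use bd(4) V0(1) in \<open>auto simp: range_def\<close>)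
  have cA0: "colors E0 g w0 C MA FA"
  proof -
    have "colors E g w0 C MA FA"
      by (rule colors_weaken[OF cA finC]) (use pqC C(1) bd(4) in \<open>auto simp: w0_def raise_def range_def\<close>)
    then show ?thesis
      by (rule colors_sub_edges[OF _ finC]) (auto simp: E0_def edges_in_def)
  qed
  obtain X E' g' where con: "contraction \<epsilon> px V0 E0 g C FA X E' g'"
    using contr[OF wf0 clsH V0(2) bigH[OF C(2)], of FA] MFA by blast
  have X: "X \<subseteq> C" "card X < card C" "wf_graph (V0 - C \<union> X) E' g'" using con by (simp_all add: contraction_def)
  define w' where "w' = cweight E0 g w0 MA X u v3 (D + 2)"
  have rw': "range w' (V0 - C \<union> X)" unfolding w'_def by (rule range_cweight[OF r0 V0(2) X(1)])
  have "\<not> col E' g' w' (V0 - C \<union> X)"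
  proof
    assume "col E' g' w' (V0 - C \<union> X)"
    then obtain M' F' where col': "colors E' g' w' (V0 - C \<union> X) M' F'" unfolding col_def by blast
    have g0: "good E0 g (w0(u := w0 u + 0)) MA" using cA0 by (simp add: colors_def)
    have "\<exists>M F. colors E0 g w0 V0 M F \<and> M \<inter> C = MA \<and> F \<inter> C = FA"
    proof (rule contraction_extend[OF wf0 V0(2) cA0 g0 comb0 C(4) V0(3) con _ _ _ col'])
      show "D + 2 \<le> w' v" if "v \<in> X" for v using that unfolding w'_def cweight_def by simp
      show "w0 v \<le> w' v" if "v \<in> V0 - C" for v
        using that r0 X(1) unfolding w'_def cweight_def range_def by auto
      fix v d m assume v: "v \<in> V0 - C" "d \<in> E0" "m \<in> MA" "g d = {v, m}"
      then have "d \<in> between E0 g {v} MA" by (auto simp: between_def)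
      moreover have "1 \<le> w0 v" using r0 v(1) by (auto simp: range_def)
      ultimately have "D + 2 \<le> w' v" unfolding w'_def cweight_def by auto
      then show "D + 2 \<le> w' v \<or> v = v3 \<and> m = u \<and> min (w0 v + (D + 2)) (D + 2) \<le> w' v \<and> (\<forall>ed'\<in>E0. \<forall>m'\<in>MA. g ed' = {v3, m'} \<longrightarrow> ed' = d)"
        by blast
    qed
    then obtain M F where cM: "colors E0 g w0 V0 M F" "F \<inter> C = FA" by blast
    have "colors E g w0 V0 M F"
      using colors_edges_in[of E g V0] cM(1) bd(7) V0(1) finite_subset unfolding E0_def by blast
    then have cc: "colors E g (raise w {p, q} H) (V - {v2}) M F" unfolding w0_def V0_def .
    have k: "comb H H" "w v2 + H \<le> D + 1" using combH[of H H] wv H(1,2) by auto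
    show False
    proof (rule raise_obstruction[OF bd(1,2,4) vV(1) cc d3 k])
      fix z' e0 assume z': "z' \<in> M" "e0 \<in> E" "g e0 = {v2, z'}" "z' \<notin> {p, q}"
      then have "z' \<in> nbrs E g v2" by (auto simp: nbrs_def)
      then have "z' = u" using N(1) z'(4) by auto
      then show False using z'(1) cc uF cM(2) by (auto simp: colors_def)
    qed
  qed
  moreover have "card (V0 - C \<union> X) < card V"
  proof -
    have "card (V0 - C \<union> X) \<le> card (V0 - C) + card X" by (rule card_Un_le)
    also have "\<dots> < card (V0 - C) + card C" using X(2) by simp
    also have "\<dots> = card V0" using V0(1,2) bd(7) by (metis card_Diff_subset card_mono finC finite_subset le_add_diff_inverse2)
    finally show ?thesis using V0(4) by linarith
  qed
  ultimately obtain B' where B': "B' \<subseteq> V0 - C \<union> X" "B' \<noteq> {}" "po E' g' w' B' \<le> - \<tau>"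
    using col_criterion[OF bd(6) X(3) clsH rw'] by (meson not_less)
  note pc = pot_contract[OF wf0 r0 V0(2) MFA(1,2) con B'(1), where y = u and z = v3 and kz = "D + 2", folded w'_def]
  define Y where "Y = C \<union> (B' - X)"
  define j where "j = card (Y \<inter> {p, q})"
  have Y: "Y \<subseteq> V0" "C \<subseteq> Y" "v2 \<notin> Y" "Y \<subseteq> V" "u \<in> Y" using B'(1) V0 C(4) X(1) unfolding Y_def V0_def by auto
  have finY: "finite Y" using Y(4) bd(7) finite_subset by blast
  have cY: "2 \<le> card Y" using card_mono[OF finY Y(2)] C(2) by linarith
  have YneV: "Y \<noteq> V" using Y(3) vV by auto
  have gY: "4 * int H \<le> po E g w Y" by (rule odd_gap[OF b Y(4) YneV cY])
  have poC: "po E0 g w0 C \<le> 4 * int H"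
  proof -
    have "(\<Sum>v\<in>C. f (w0 v)) = (\<Sum>v\<in>C. f (w v))" by (rule sum.cong) (use pqC in \<open>auto simp: w0_def raise_def\<close>)
    then have "po E g w0 C = po E g w C" by (simp add: pot_def)
    then show ?thesis using C(3) pot_edges_in[OF V0(2), of E g w0] unfolding E0_def by simp
  qed
  have poY: "po E g w Y \<le> po E0 g w0 Y + 2 * int H * int j"
  proof -
    have "range w Y" using bd(4) Y(4) by (auto simp: range_def)
    from pot_raise'[OF finY this, of E g H "{p, q}"] show ?thesis
      using pot_edges_in[OF Y(1), of E g w0] hH[of H] H(2) unfolding E0_def w0_def j_def by simp
  qed
  have j2: "j \<le> 2" unfolding j_def using card_mono[of "{p, q}" "Y \<inter> {p, q}"] N(2) by simp
  let ?Z = "insert v2 Y"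
  let ?S = "insert eu ((\<lambda>x. if x = p then ep else eq) ` (Y \<inter> {p, q}))"
  have S: "?S \<subseteq> star E g v2 Y" using eE ge Y(5) by (auto simp: star_def)
  have "card ((\<lambda>x. if x = p then ep else eq) ` (Y \<inter> {p, q})) = j"
    unfolding j_def by (rule card_image) (use ne(1) in \<open>auto simp: inj_on_def\<close>)
  moreover have "eu \<notin> (\<lambda>x. if x = p then ep else eq) ` (Y \<inter> {p, q})" using ne by auto
  ultimately have cS: "card ?S = j + 1" by simp
  have poZ: "po E g w ?Z \<le> po E g w Y + 6 * int H + 1 - 4 * int H * (int j + 1)"
    using light_pot_insert[OF b l2(1) Y(4,3) S] by (simp only: cS of_nat_add of_nat_1)
  have Z: "?Z \<subseteq> V" "2 \<le> card ?Z" using Y(3,4) vV cY finY by auto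
  have gZ: "4 * int H \<le> po E g w ?Z" if "?Z \<noteq> V" using odd_gap[OF b Z(1) that Z(2)] .
  have main: "po E0 g w0 Y \<le> 4 * int H - 2" "?Z = V \<Longrightarrow> po E0 g w0 Y \<le> -1"
  proof -
    have "po E0 g w0 Y \<le> 4 * int H - 2 \<and> (?Z = V \<longrightarrow> po E0 g w0 Y \<le> -1)"
    proof (cases "B' \<inter> X = {}")
      case False
      have "po E0 g w0 Y \<le> po E0 g w0 C + po E' g' w' B' - px" using pc(1)[OF False] unfolding Y_def .
      then show ?thesis using poC B'(3) H(1,4) pxH by linarith
    next
      case True
      have YB: "Y = C \<union> B'" using True unfolding Y_def by auto
      have le: "po E0 g w0 Y \<le> 4 * int H - 2 - \<epsilon> * int (card (between E0 g B' FA))"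
        using pc(2)[OF True] poC B'(3) H(4) unfolding YB by linarith
      have "0 \<le> \<epsilon> * int (card (between E0 g B' FA))" using eps by simp
      then have 1: "po E0 g w0 Y \<le> 4 * int H - 2" using le by linarith
      have "po E0 g w0 Y \<le> -1" if Zv: "?Z = V"
      proof -
        have "v3 \<in> B'" using Zv YB vV(2) l3(3) ne23 by blast
        moreover obtain e3 where e3: "e3 \<in> E" "g e3 = {v3, u}" using l3(2) by (auto simp: nbrs_def)
        moreover have "e3 \<in> E0" using e3 vV N(7,10) ne23 unfolding E0_def V0_def by (auto simp: edges_in_def)
        ultimately have "e3 \<in> between E0 g B' FA" using uF by (auto simp: between_def)
        then have "1 \<le> card (between E0 g B' FA)"
          using finite_between[of E0 g B' FA] wf0 by (metis One_nat_def Suc_leI card_gt_0_iff empty_iff wf_graph_finE)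
        then have "\<epsilon> * 1 \<le> \<epsilon> * int (card (between E0 g B' FA))" using eps by (intro mult_left_mono) auto
        then show ?thesis using le H(3) by linarith
      qed
      then show ?thesis using 1 by blast
    qed
    then show "po E0 g w0 Y \<le> 4 * int H - 2" "?Z = V \<Longrightarrow> po E0 g w0 Y \<le> -1" by auto
  qed
  consider "j = 0" | "j = 1" | "j = 2" using j2 by linarith
  then show False
  proof cases
    case 1
    then show False using main(1) poY gY by simp
  next
    case 2
    have "?Z \<noteq> V"
    proof
      assume "?Z = V"
      then have "p \<in> Y" "q \<in> Y" using N by auto
      then have "Y \<inter> {p, q} = {p, q}" by auto
      then show False using 2 N(2) unfolding j_def by simp
    qed
    then show False using gZ main(1) poY poZ 2 by simp
  next
    case 3
    show False
    proof (cases "?Z = V")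
      case True
      then have "-1 \<le> po E g w ?Z" using odd_pot[OF b] by simp
      then show False using main(2)[OF True] poY poZ 3 H(1) by simp
    next
      case False
      then show False using gZ main(1) poY poZ 3 H(1) by simp
    qed
  qed
qed

lemma light_pair:
  assumes b: "bad V E g w" and l: "light V E g w v" and u: "u \<in> nbrs E g v"
  obtains p q ep eq eu where "p \<noteq> q" "p \<noteq> u" "q \<noteq> u" "p \<in> V" "q \<in> V" "\<not> light V E g w p" "\<not> light V E g w q"
    "{ed\<in>E. v \<in> g ed} = {ep, eq, eu}" "g ep = {v, p}" "g eq = {v, q}" "g eu = {v, u}" "ep \<noteq> eq" "ep \<noteq> eu" "eq \<noteq> eu"
proof (rule light_edges[OF assms])
  fix x y ex ey ez
  assume a: "nbrs E g v = {x, y, u}" "x \<noteq> y" "x \<noteq> u" "y \<noteq> u" "x \<in> V" "y \<in> V" "{ed\<in>E. v \<in> g ed} = {ex, ey, ez}"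
    "g ex = {v, x}" "g ey = {v, y}" "g ez = {v, u}" "ex \<noteq> ey" "ex \<noteq> ez" "ey \<noteq> ez"
  have "x \<in> nbrs E g v" "y \<in> nbrs E g v" using a(1) by auto
  then have "\<not> light V E g w x" "\<not> light V E g w y" using light_nbr(2)[OF b l] by blast+
  then show ?thesis using that a by blast
qed

text \<open>
  Delete \<open>u\<close> and the light vertices, join the other neighbors of \<open>v1\<close> and those of \<open>v2\<close> by
  new edges, and reserve \<open>H + 1\<close> at the fourth neighbor \<open>r\<close> of \<open>u\<close>. Then \<open>v1\<close>, \<open>v2\<close> subdivide
  the new edges in \<open>F\<close>, \<open>u\<close> joins \<open>M\<close> with reserve \<open>H\<close>, and \<open>v3\<close> fits into either part.
\<close>

lemma no_three_lights:
  assumes b: "bad V E g w" and u: "u \<in> V" "card {ed\<in>E. u \<in> g ed} = 4" "w u = 1"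
    and l1: "light V E g w v1" "u \<in> nbrs E g v1" and l2: "light V E g w v2" "u \<in> nbrs E g v2"
    and l3: "light V E g w v3" "u \<in> nbrs E g v3" and ne: "v1 \<noteq> v2" "v1 \<noteq> v3" "v2 \<noteq> v3"
  shows False
proof -
  note bd = badD[OF b]
  obtain p1 q1 ep1 eq1 eu1 where pq1: "p1 \<noteq> q1" "p1 \<noteq> u" "q1 \<noteq> u" "p1 \<in> V" "q1 \<in> V"
    and nl1: "\<not> light V E g w p1" "\<not> light V E g w q1" and inc1: "{ed\<in>E. v1 \<in> g ed} = {ep1, eq1, eu1}"
    and ge1: "g ep1 = {v1, p1}" "g eq1 = {v1, q1}" "g eu1 = {v1, u}" and ne1: "ep1 \<noteq> eq1" "ep1 \<noteq> eu1" "eq1 \<noteq> eu1"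
    using light_pair[OF b l1] .
  obtain p2 q2 ep2 eq2 eu2 where pq2: "p2 \<noteq> q2" "p2 \<noteq> u" "q2 \<noteq> u" "p2 \<in> V" "q2 \<in> V"
    and nl2: "\<not> light V E g w p2" "\<not> light V E g w q2" and inc2: "{ed\<in>E. v2 \<in> g ed} = {ep2, eq2, eu2}"
    and ge2: "g ep2 = {v2, p2}" "g eq2 = {v2, q2}" "g eu2 = {v2, u}" and ne2: "ep2 \<noteq> eq2" "ep2 \<noteq> eu2" "eq2 \<noteq> eu2"
    using light_pair[OF b l2] .
  obtain p3 q3 ep3 eq3 eu3 where pq3: "p3 \<noteq> q3" "p3 \<noteq> u" "q3 \<noteq> u" "p3 \<in> V" "q3 \<in> V"
    and nl3: "\<not> light V E g w p3" "\<not> light V E g w q3" and inc3: "{ed\<in>E. v3 \<in> g ed} = {ep3, eq3, eu3}"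
    and ge3: "g ep3 = {v3, p3}" "g eq3 = {v3, q3}" "g eu3 = {v3, u}" and ne3: "ep3 \<noteq> eq3" "ep3 \<noteq> eu3" "eq3 \<noteq> eu3"
    using light_pair[OF b l3] .
  have nlu: "\<not> light V E g w u" using light_nbr(2)[OF b l1] .
  have far: "x \<noteq> v1" "x \<noteq> v2" "x \<noteq> v3" if "\<not> light V E g w x" for x using that l1 l2 l3 by auto
  note far1 = far[OF nl1(1)] far[OF nl1(2)] and far2 = far[OF nl2(1)] far[OF nl2(2)] and far3 = far[OF nl3(1)] far[OF nl3(2)]
    and faru = far[OF nlu]
  have vV: "v1 \<in> V" "v2 \<in> V" "v3 \<in> V" using l1 l2 l3 by (auto simp: light_def)
  have eE: "ep1 \<in> E" "eq1 \<in> E" "eu1 \<in> E" "ep2 \<in> E" "eq2 \<in> E" "eu2 \<in> E" "ep3 \<in> E" "eq3 \<in> E" "eu3 \<in> E"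
    using inc1 inc2 inc3 by blast+
  have neu: "eu1 \<noteq> eu2" "eu1 \<noteq> eu3" "eu2 \<noteq> eu3"
    using ge1(3) ge2(3) ge3(3) ne faru by (auto simp: doubleton_eq_iff)
  have eu4: "{eu1, eu2, eu3} \<subseteq> {ed\<in>E. u \<in> g ed}" using eE ge1 ge2 ge3 by auto
  moreover have "card {eu1, eu2, eu3} = 3" using neu by simp
  ultimately have "card ({ed\<in>E. u \<in> g ed} - {eu1, eu2, eu3}) = 1"
    using u(2) card_Diff_subset[of "{eu1, eu2, eu3}" "{ed\<in>E. u \<in> g ed}"] by simp
  then obtain er where "{ed\<in>E. u \<in> g ed} - {eu1, eu2, eu3} = {er}" using card_1_singletonE by blast
  then have incu: "{ed\<in>E. u \<in> g ed} = {eu1, eu2, eu3, er}" "er \<notin> {eu1, eu2, eu3}" using eu4 by blast+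
  then have er: "er \<in> E" "u \<in> g er" "er \<noteq> eu1" "er \<noteq> eu2" "er \<noteq> eu3" by auto
  obtain r where r: "g er = {u, r}" "r \<noteq> u" using card2_other[OF bd(9)[OF er(1)] er(2)] by metis
  have rfar: "r \<noteq> v1" "r \<noteq> v2" "r \<noteq> v3"
  proof -
    have no: "er \<notin> {ep, eq, eu}" if "g ep = {v, p}" "g eq = {v, q}" "p \<noteq> u" "q \<noteq> u" "v \<noteq> u" "er \<noteq> eu" for ep eq eu v p q
      using that r by auto
    show "r \<noteq> v1" using no[OF ge1(1,2) pq1(2,3) faru(1)[symmetric] er(3)] inc1 r(1) er(1) by blast
    show "r \<noteq> v2" using no[OF ge2(1,2) pq2(2,3) faru(2)[symmetric] er(4)] inc2 r(1) er(1) by blast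
    show "r \<noteq> v3" using no[OF ge3(1,2) pq3(2,3) faru(3)[symmetric] er(5)] inc3 r(1) er(1) by blast
  qed
  have rV: "r \<in> V" using bd(2) er(1) r(1) by (auto simp: wf_graph_def)
  define R where "R = V - {u, v1, v2, v3}"
  have R: "R \<subseteq> V" "u \<notin> R" "v1 \<notin> R" "v2 \<notin> R" "v3 \<notin> R" "finite R" using bd(7) by (auto simp: R_def)
  have VR: "insert v3 (insert u (insert v1 (insert v2 R))) = V" using vV u(1) by (auto simp: R_def)
  have inR: "p1 \<in> R" "q1 \<in> R" "p2 \<in> R" "q2 \<in> R" "p3 \<in> R" "q3 \<in> R" "r \<in> R"
    using pq1 pq2 pq3 far1 far2 far3 rfar r rV by (auto simp: R_def)
  have cardR: "card R < card V" using R(1,2) u(1) bd(7) by (intro psubset_card_mono) auto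
  define E0 where "E0 = edges_in E g R"
  define g1 where "g1 = g(ep1 := {p1, q1})"
  define g2 where "g2 = g1(ep2 := {p2, q2})"
  define E1 where "E1 = insert ep1 E0"
  define E2 where "E2 = insert ep2 E1"
  have "v1 \<notin> g ep2" "v1 \<notin> g eq2" "v2 \<notin> g eq1" using ge1(2) ge2(1,2) far1(5) far2(1,4) ne(1) by auto
  moreover have "v1 \<in> g ep1" "v2 \<in> g ep2" using ge1(1) ge2(1) by auto
  ultimately have nep: "ep1 \<noteq> ep2" "eq2 \<noteq> ep1" "eq1 \<noteq> ep2" by blast+
  have new: "ep1 \<notin> E0" "ep2 \<notin> E1" using ge1 ge2 R nep by (auto simp: E0_def E1_def edges_in_def)
  have fin: "finite E0" "finite E1" using finite_edges_in[OF bd(8), of g R] by (auto simp: E0_def E1_def)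
  have wf2: "wf_graph R E2 g2"
    unfolding E2_def g2_def
  proof (rule wf_graph_add_edge[OF _ new(2) inR(3,4) pq2(1)])
    show "wf_graph R E1 g1" unfolding E1_def g1_def
      by (rule wf_graph_add_edge[OF _ new(1) inR(1,2) pq1(1)]) (use wf_graph_edges_in[OF bd(2) R(1)] in \<open>simp add: E0_def\<close>)
  qed
  have ein: "edges_in E2 g2 B = edges_in E g B \<union> (if p1 \<in> B \<and> q1 \<in> B then {ep1} else {}) \<union> (if p2 \<in> B \<and> q2 \<in> B then {ep2} else {})"
    if "B \<subseteq> R" for B
  proof -
    have "edges_in E2 g2 B = edges_in E1 g1 B \<union> (if p2 \<in> B \<and> q2 \<in> B then {ep2} else {})"
      unfolding E2_def g2_def by (rule edges_in_add_edge[OF new(2)])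
    moreover have "edges_in E1 g1 B = edges_in E0 g B \<union> (if p1 \<in> B \<and> q1 \<in> B then {ep1} else {})"
      unfolding E1_def g1_def by (rule edges_in_add_edge[OF new(1)])
    moreover have "edges_in E0 g B = edges_in E g B" unfolding E0_def by (rule edges_in_idem[OF that])
    ultimately show ?thesis by (simp only:)
  qed
  have pot2: "po E2 g2 w' B = po E g w' B - (if p1 \<in> B \<and> q1 \<in> B then 4 * int H else 0) - (if p2 \<in> B \<and> q2 \<in> B then 4 * int H else 0)"
    if "B \<subseteq> R" for B w'
  proof -
    have "po E2 g2 w' B = po E1 g1 w' B - (if p2 \<in> B \<and> q2 \<in> B then \<epsilon> else 0)"
      unfolding E2_def g2_def by (rule pot_add_edge[OF new(2) fin(2)])
    moreover have "po E1 g1 w' B = po E0 g w' B - (if p1 \<in> B \<and> q1 \<in> B then \<epsilon> else 0)"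
      unfolding E1_def g1_def by (rule pot_add_edge[OF new(1) fin(1)])
    moreover have "po E0 g w' B = po E g w' B" unfolding E0_def by (rule pot_edges_in[OF that])
    ultimately show ?thesis by (simp only: H(3))
  qed
  define w' where "w' = raise w {r} (H + 1)"
  have f1: "f (w u) = 8 * int H - 1" using fH[of 1] u(3) by simp
  have "col E2 g2 w' R"
  proof (rule col_criterion2[OF bd(6) wf2 clsH _ cardR])
    show "range w' R" unfolding w'_def by (rule range_raise) (use bd(4) R(1) in \<open>auto simp: range_def\<close>)
    fix B assume B: "B \<subseteq> R" "2 \<le> card B"
    have BV: "B \<subseteq> V" "u \<notin> B" "v1 \<notin> B" "v2 \<notin> B" "v3 \<notin> B" "finite B" using B(1) R finite_subset by blast+
    have card2: "2 \<le> card Y" if "B \<subseteq> Y" "Y \<subseteq> V" for Y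
      using card_mono[OF finite_subset[OF that(2) bd(7)] that(1)] B(2) by linarith
    have gap: "4 * int H \<le> po E g w Y" if "B \<subseteq> Y" "Y \<subseteq> V" "v3 \<notin> Y \<or> v2 \<notin> Y \<or> u \<notin> Y" for Y
    proof (rule odd_gap[OF b that(2) _ card2[OF that(1,2)]])
      show "Y \<noteq> V" using that(3) vV u(1) by blast
    qed
    have rB: "range w B" using bd(4) BV(1) by (auto simp: range_def)
    have pr: "po E g w B - (if r \<in> B then 2 * int H + 2 else 0) \<le> po E g w' B"
    proof -
      have "B \<inter> {r} = (if r \<in> B then {r} else {})" by auto
      then have "int (card (B \<inter> {r})) = (if r \<in> B then 1 else 0)" by simp
      then show ?thesis using pot_raise'[OF BV(6) rB, of E g "H + 1" "{r}"] hH[of "H + 1"] H(1,2) by (simp add: w'_def split: if_splits)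
    qed
    have addv: "po E g w (insert v Y) \<le> po E g w Y - 2 * int H + 1"
      if "light V E g w v" "Y \<subseteq> V" "v \<notin> Y" "p \<in> Y" "q \<in> Y" "g ep = {v, p}" "g eq = {v, q}" "ep \<in> E" "eq \<in> E" "ep \<noteq> eq" for v Y p q ep eq
    proof -
      have "{ep, eq} \<subseteq> star E g v Y" using that by (auto simp: star_def)
      from light_pot_insert[OF b that(1,2,3) this] show ?thesis using that(10) by simp
    qed
    have addu: "po E g w (insert u Y) \<le> po E g w Y + 8 * int H - 1 - 4 * int H * int (card S)"
      if "Y \<subseteq> V" "u \<notin> Y" "S \<subseteq> star E g u Y" for Y S
      using pot_insert_le[of Y u E g S w, OF finite_subset[OF that(1) bd(7)] that(2) bd(8,9) that(3)] f1 H(3) by simp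
    let ?P1 = "p1 \<in> B \<and> q1 \<in> B" and ?P2 = "p2 \<in> B \<and> q2 \<in> B"
    have one: "- 1 \<le> po E g w B - (if r \<in> B then 2 * int H + 2 else 0) - 4 * int H"
      if l: "light V E g w v" "v \<in> V" "v \<notin> B" "v \<noteq> u" and P: "p \<in> B" "q \<in> B"
        and ge: "g ep = {v, p}" "g eq = {v, q}" "g eu = {v, u}" "ep \<in> E" "eq \<in> E" "eu \<in> E" "ep \<noteq> eq" "er \<noteq> eu"
        and o: "light V E g w a" "u \<in> nbrs E g a" "a \<notin> insert v B" "light V E g w a'" "u \<in> nbrs E g a'" "a' \<notin> insert v B" "a \<noteq> a'"
      for v p q ep eq eu a a'
    proof -
      have p1: "po E g w (insert v B) \<le> po E g w B - 2 * int H + 1"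
        using addv[OF l(1) BV(1) l(3) P ge(1,2,4,5,7)] .
      have sub: "insert v B \<subseteq> V" "u \<notin> insert v B" using l BV by auto
      show ?thesis
      proof (cases "r \<in> B")
        case False
        have "4 * int H \<le> po E g w (insert v B)" by (rule gap) (use sub in auto)
        then show ?thesis using p1 False H(1) by simp
      next
        case True
        have "{er, eu} \<subseteq> star E g u (insert v B)" using True r er ge by (auto simp: star_def)
        from addu[OF sub this] have p2: "po E g w (insert u (insert v B)) \<le> po E g w B - 2 * int H"
          using p1 ge(8) by simp
        have a: "a \<noteq> u" "a' \<noteq> u" using o(1,4) nlu by auto
        have "\<not> po E g w (insert u (insert v B)) \<le> 4 * int H"
        proof
          assume le: "po E g w (insert u (insert v B)) \<le> 4 * int H"
          show False
          proof (rule no_tight_set[OF b _ _ le _ o(1,2) _ o(4,5) _ o(7)])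
            show "insert u (insert v B) \<subseteq> V" using sub u(1) by auto
            show "2 \<le> card (insert u (insert v B))" by (rule card2) (use sub u(1) in auto)
            show "u \<in> insert u (insert v B)" by blast
            show "a \<notin> insert u (insert v B)" "a' \<notin> insert u (insert v B)" using o(3,6) a by blast+
          qed
        qed
        then show ?thesis using p2 True by simp
      qed
    qed
    have both: "- 1 \<le> po E g w B - (if r \<in> B then 2 * int H + 2 else 0) - 8 * int H" if P: ?P1 ?P2
    proof -
      have s1: "insert v1 B \<subseteq> V" "v2 \<notin> insert v1 B" using BV vV ne by auto
      have s2: "insert v2 (insert v1 B) \<subseteq> V" "u \<notin> insert v2 (insert v1 B)" using BV vV faru by auto
      have a1: "po E g w (insert v1 B) \<le> po E g w B - 2 * int H + 1"
        by (rule addv[OF l1(1) BV(1) BV(3) _ _ ge1(1,2) eE(1,2) ne1(1)]) (use P in auto)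
      have a2: "po E g w (insert v2 (insert v1 B)) \<le> po E g w (insert v1 B) - 2 * int H + 1"
        by (rule addv[OF l2(1) s1 _ _ ge2(1,2) eE(4,5) ne2(1)]) (use P in auto)
      let ?C = "insert u (insert v2 (insert v1 B))"
      let ?S = "if r \<in> B then {eu1, eu2, er} else {eu1, eu2}"
      have "?S \<subseteq> star E g u (insert v2 (insert v1 B))" using eE ge1 ge2 r er by (auto simp: star_def)
      from addu[OF s2 this]
      have a3: "po E g w ?C \<le> po E g w (insert v2 (insert v1 B)) + 8 * int H - 1 - 4 * int H * (if r \<in> B then 3 else 2)"
        using neu er by (auto split: if_splits)
      have "4 * int H \<le> po E g w ?C" by (rule gap) (use s2 u(1) BV ne faru in auto)
      then show ?thesis using a1 a2 a3 H(1) by (auto split: if_splits)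
    qed
    have none: "- 1 \<le> po E g w B - (if r \<in> B then 2 * int H + 2 else 0)"
      using gap[OF subset_refl BV(1)] BV(5) H(1) by auto
    have one1: "- 1 \<le> po E g w B - (if r \<in> B then 2 * int H + 2 else 0) - 4 * int H" if ?P1
      by (rule one[OF l1(1) vV(1) BV(3) faru(1)[symmetric] _ _ ge1 eE(1-3) ne1(1) er(3) l2 _ l3 _ ne(3)]) (use that BV ne in simp_all)
    have one2: "- 1 \<le> po E g w B - (if r \<in> B then 2 * int H + 2 else 0) - 4 * int H" if ?P2
      by (rule one[OF l2(1) vV(2) BV(4) faru(2)[symmetric] _ _ ge2 eE(4-6) ne2(1) er(4) l1 _ l3 _ ne(2)]) (use that BV ne in simp_all)
    show "- \<tau> < po E2 g2 w' B"
      using none one1 one2 both pr pot2[OF B(1), of w'] H(4) by (auto split: if_splits)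
  qed
  then obtain M F where c0: "colors E2 g2 w' R M F" unfolding col_def by blast
  have MF: "M \<subseteq> R" "F \<subseteq> R" "M \<union> F = R" "M \<inter> F = {}" "finite M" "finite F" using c0 R(6) by (auto simp: colors_def intro: finite_subset)
  have g2eq: "g2 ed = g ed" if "ed \<in> edges_in E g R" for ed
    using that new unfolding g2_def g1_def E1_def E0_def by auto
  have cR: "colors E g w' R M F"
    by (rule colors_sub_edges[OF c0 R(6)]) (use ein g2eq in auto)
  let ?F2 = "insert v1 (insert v2 F)"
  let ?S = "edges_in E g F"
  have SR: "?S \<subseteq> E0" unfolding E0_def by (rule edges_in_mono[OF MF(2)])
  have nv: "v1 \<notin> g ed" "v2 \<notin> g ed" if "ed \<in> ?S" for ed using that MF(2) R by (auto simp: edges_in_def)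
  have star2: "star E g v2 F \<subseteq> {ep2, eq2}" 
  proof
    fix d assume d: "d \<in> star E g v2 F"
    then have "d \<in> {ep2, eq2, eu2}" using inc2 by (auto simp: star_def)
    moreover have "d \<noteq> eu2" using d ge2(3) MF(2) R faru by (auto simp: star_def)
    ultimately show "d \<in> {ep2, eq2}" by blast
  qed
  have star1: "star E g v1 F \<subseteq> {ep1, eq1}" 
  proof
    fix d assume d: "d \<in> star E g v1 F"
    then have "d \<in> {ep1, eq1, eu1}" using inc1 by (auto simp: star_def)
    moreover have "d \<noteq> eu1" using d ge1(3) MF(2) R faru by (auto simp: star_def)
    ultimately show "d \<in> {ep1, eq1}" by blast
  qed
  have "acyc ((?S \<union> (if p1 \<in> F \<and> q1 \<in> F then {ep1} else {})) \<union> (if p2 \<in> F \<and> q2 \<in> F then {ep2} else {})) g2"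
    using c0 ein[OF MF(2)] by (simp add: colors_def)
  then have "acyc ((?S \<union> (if p1 \<in> F \<and> q1 \<in> F then {ep1} else {})) \<union> star E g v2 F) g1"
  proof (rule acyc_Un_subdivide)
    show "finite (?S \<union> (if p1 \<in> F \<and> q1 \<in> F then {ep1} else {}))" using finite_edges_in[OF bd(8), of g F] by simp
    show "ep2 \<notin> ?S \<union> (if p1 \<in> F \<and> q1 \<in> F then {ep1} else {})" using SR new nep unfolding E1_def by auto
    show "g2 ep2 = {p2, q2}" by (simp add: g2_def)
    show "g1 ep2 = {v2, p2}" "g1 eq2 = {v2, q2}" using ge2 nep by (auto simp: g1_def)
    show "ep2 \<in> star E g v2 F \<longleftrightarrow> p2 \<in> F" "eq2 \<in> star E g v2 F \<longleftrightarrow> q2 \<in> F" using ge2 eE far2 by (auto simp: star_def)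
    fix ed assume ed: "ed \<in> ?S \<union> (if p1 \<in> F \<and> q1 \<in> F then {ep1} else {})"
    show "g2 ed = g1 ed \<and> v2 \<notin> g1 ed"
    proof (cases "ed = ep1")
      case True
      then show ?thesis using far1 nep by (auto simp: g1_def g2_def)
    next
      case False
      then have s: "ed \<in> ?S" using ed by (auto split: if_splits)
      then have "ed \<noteq> ep2" using SR new(2) unfolding E1_def by blast
      then show ?thesis using False nv(2)[OF s] by (simp add: g1_def g2_def)
    qed
  qed (use star2 pq2 far2 in auto)
  moreover have "(?S \<union> (if p1 \<in> F \<and> q1 \<in> F then {ep1} else {})) \<union> star E g v2 F = (?S \<union> star E g v2 F) \<union> (if p1 \<in> F \<and> q1 \<in> F then {ep1} else {})"
    by auto
  ultimately have "acyc ((?S \<union> star E g v2 F) \<union> (if p1 \<in> F \<and> q1 \<in> F then {ep1} else {})) g1" by simp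
  then have "acyc ((?S \<union> star E g v2 F) \<union> star E g v1 F) g"
  proof (rule acyc_Un_subdivide)
    show "finite (?S \<union> star E g v2 F)" using finite_edges_in[OF bd(8), of g F] finite_star[OF bd(8)] by simp
    have n1: "v1 \<notin> g ed" if "ed \<in> ?S \<union> star E g v2 F" for ed
      using that nv(1) star2 ge2 far2 ne(1) by auto
    then show "ep1 \<notin> ?S \<union> star E g v2 F" using ge1 by blast
    then show "g1 ed = g ed \<and> v1 \<notin> g ed" if "ed \<in> ?S \<union> star E g v2 F" for ed
      using that n1[OF that] by (auto simp: g1_def)
    show "g1 ep1 = {p1, q1}" by (simp add: g1_def)
    show "ep1 \<in> star E g v1 F \<longleftrightarrow> p1 \<in> F" "eq1 \<in> star E g v1 F \<longleftrightarrow> q1 \<in> F" using ge1 eE far1 by (auto simp: star_def)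
  qed (use star1 ge1 pq1 far1 in auto)
  moreover have "star E g v1 (insert v2 F) \<subseteq> star E g v1 F"
  proof
    fix d assume d: "d \<in> star E g v1 (insert v2 F)"
    then have "d \<in> {ep1, eq1, eu1}" using inc1 by (auto simp: star_def)
    then have "v2 \<notin> g d" using ge1 far1 faru ne by auto
    then show "d \<in> star E g v1 F" using d by (auto simp: star_def)
  qed
  then have "edges_in E g ?F2 \<subseteq> (?S \<union> star E g v2 F) \<union> star E g v1 F"
    unfolding edges_in_insert by blast
  ultimately have acF2: "acyc (edges_in E g ?F2) g" by (rule acyc_mono) simp
  define U2 where "U2 = insert v1 (insert v2 R)"
  have U2: "u \<notin> U2" "v3 \<notin> U2" "finite U2" using R faru ne by (auto simp: U2_def)
  have c2: "colors E g w' U2 M ?F2" using cR acF2 R MF unfolding colors_def U2_def by blast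
  have uM: "u \<notin> M" "u \<notin> ?F2" "v3 \<notin> M" "v1 \<notin> M" "v2 \<notin> M" using MF R faru by auto
  let ?wu = "w(u := w u + H)"
  have c3: "colors E g ?wu (insert u U2) (insert u M) ?F2"
  proof (rule colors_addM[where ?e0.0 = er and y = r and ky = "H + 1" and kz = "H - 1"])
    show "colors E g ?wu U2 M ?F2"
      by (rule colors_weaken[OF c2 U2(3)]) (use bd(4) rV U2(1) in \<open>auto simp: w'_def raise_def range_def\<close>)
    show "star E g u M \<subseteq> {er}"
    proof
      fix d assume d: "d \<in> star E g u M"
      then have "d \<in> {eu1, eu2, eu3, er}" using incu by (auto simp: star_def)
      moreover have "d \<noteq> eu1" "d \<noteq> eu2" "d \<noteq> eu3" using d ge1(3) ge2(3) ge3(3) uM faru by (auto simp: star_def)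
      ultimately show "d \<in> {er}" by blast
    qed
    show "?wu u + (H - 1) \<le> D + 1" using u(3) H(1,2) by simp
    have "good E g w' M" using c2 by (simp add: colors_def)
    then have "good E g (w(r := w r + (H + 1))) M" unfolding w'_def by (rule raise_good) (use MF in auto)
    then have "good E g (?wu(r := ?wu r + (H + 1))) M"
      by (rule good_weaken[OF _ MF(5) subset_refl]) (use uM(1) r(2) in auto)
    moreover assume "star E g u M = {er}"
    then have "r \<in> M" using r by (auto simp: star_def)
    from good_bound[OF \<open>good E g (w(r := w r + (H + 1))) M\<close> MF(5) this]
    have "w r + (H + 1) \<le> D + 1" by simp
    then have "1 \<le> H - 1" using bd(4) rV H(2) by (auto simp: range_def)
    ultimately show "g er = {u, r} \<and> comb (H + 1) (H - 1) \<and> good E g (?wu(r := ?wu r + (H + 1))) M"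
      using r(1) combH[of "H + 1" "H - 1"] by auto
  qed (use U2 bd in auto)
  have finU: "finite (insert u U2)" using U2(3) by simp
  have c4: "colors E g w (insert u U2) (insert u M) ?F2"
    by (rule colors_weaken[OF c3 finU]) auto
  have v3U: "v3 \<notin> insert u U2" using U2 faru by auto
  have VU: "insert v3 (insert u U2) = V" using VR unfolding U2_def .
  have "col E g w V"
  proof (cases "p3 \<in> F \<and> q3 \<in> F")
    case True
    have "colors E g w (insert v3 (insert u U2)) (insert v3 (insert u M)) ?F2"
    proof (rule colors_addM[OF c4 v3U, where ?e0.0 = eu3 and y = u and ky = H and kz = H])
      show "star E g v3 (insert u M) \<subseteq> {eu3}"
      proof
        fix d assume d: "d \<in> star E g v3 (insert u M)"
        then have "d \<in> {ep3, eq3, eu3}" using inc3 by (auto simp: star_def)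
        moreover have "d \<noteq> ep3" "d \<noteq> eq3" using d ge3 True MF(4) pq3 far3 by (auto simp: star_def)
        ultimately show "d \<in> {eu3}" by blast
      qed
      show "w v3 + H \<le> D + 1" using light_weight(1)[OF b l3(1)] H(2) by simp
      show "g eu3 = {v3, u} \<and> comb H H \<and> good E g ?wu (insert u M)"
        using ge3 combH[of H H] H(1) c3 by (auto simp: colors_def)
    qed (use finU bd in auto)
    then show ?thesis using VU unfolding col_def by auto
  next
    case False
    have "star E g v3 ?F2 \<subseteq> {ep3} \<or> star E g v3 ?F2 \<subseteq> {eq3}"
    proof -
      have "star E g v3 ?F2 \<subseteq> {ep3, eq3}"
      proof
        fix d assume d: "d \<in> star E g v3 ?F2"
        then have "d \<in> {ep3, eq3, eu3}" using inc3 by (auto simp: star_def)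
        moreover have "d \<noteq> eu3" using d ge3 uM(2) faru by (auto simp: star_def)
        ultimately show "d \<in> {ep3, eq3}" by blast
      qed
      moreover have "ep3 \<notin> star E g v3 ?F2 \<or> eq3 \<notin> star E g v3 ?F2"
        using False ge3 far3 by (auto simp: star_def)
      ultimately show ?thesis by blast
    qed
    then have "card (star E g v3 ?F2) \<le> 1" by (auto dest: subset_singletonD)
    then have "colors E g w (insert v3 (insert u U2)) (insert u M) (insert v3 ?F2)"
      by (rule colors_addF[OF c4 v3U _ bd(8)])
    then show ?thesis using VU unfolding col_def by auto
  qed
  then show False using bd(10) by blast
qed

lemma five_vertex_coloring:
  assumes b: "bad V E g w" and V: "V = {x, y, z, v1, v2}" and d: "x \<noteq> y" "x \<noteq> z" "y \<noteq> z" "v1 \<noteq> v2"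
    and l1: "light V E g w v1" "nbrs E g v1 = {x, y, z}" and l2: "light V E g w v2" "nbrs E g v2 = {x, y, z}"
    and w1: "w x = 1" "w y = 1" and xy: "card (star E g x {y}) \<le> 1"
  shows False
proof -
  note bd = badD[OF b]
  have z: "z \<in> nbrs E g v1" "z \<in> nbrs E g v2" using l1 l2 by auto
  have nl: "\<not> light V E g w u" if "u \<in> {x, y, z}" for u using light_nbr(2)[OF b l1(1)] that l1(2) by blast
  have far: "u \<noteq> v1" "u \<noteq> v2" if "u \<in> {x, y, z}" for u using nl[OF that] l1(1) l2(1) by auto
  have far': "v1 \<notin> {x, y, z}" "v2 \<notin> {x, y, z}" using far by blast+
  obtain p1 q1 ep1 eq1 eu1 where pq1': "p1 \<noteq> q1" and pq1: "p1 \<noteq> z" "q1 \<noteq> z" and m1: "p1 \<in> V" "q1 \<in> V" and nl1: "\<not> light V E g w p1" "\<not> light V E g w q1"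
    and inc1: "{ed\<in>E. v1 \<in> g ed} = {ep1, eq1, eu1}" and ge1: "g ep1 = {v1, p1}" "g eq1 = {v1, q1}" and "g eu1 = {v1, z}"
    and "ep1 \<noteq> eq1" "ep1 \<noteq> eu1" "eq1 \<noteq> eu1"
    using light_pair[OF b l1(1) z(1)] .
  obtain p2 q2 ep2 eq2 eu2 where pq2': "p2 \<noteq> q2" and pq2: "p2 \<noteq> z" "q2 \<noteq> z" and m2: "p2 \<in> V" "q2 \<in> V" and nl2: "\<not> light V E g w p2" "\<not> light V E g w q2"
    and inc2: "{ed\<in>E. v2 \<in> g ed} = {ep2, eq2, eu2}" and ge2: "g ep2 = {v2, p2}" "g eq2 = {v2, q2}" and "g eu2 = {v2, z}"
    and "ep2 \<noteq> eq2" "ep2 \<noteq> eu2" "eq2 \<noteq> eu2"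
    using light_pair[OF b l2(1) z(2)] .
  have pf: "p1 \<noteq> v1" "q1 \<noteq> v1" "p2 \<noteq> v1" "q2 \<noteq> v1" "p2 \<noteq> v2" "q2 \<noteq> v2" using nl1 nl2 l1(1) l2(1) by auto
  have st0: "star E g u {} = {}" for u
  proof -
    have "card (g ed) \<le> 1" if "g ed \<subseteq> {u}" for ed using card_mono[OF _ that] by simp
    then show ?thesis using bd(9) by (force simp: star_def)
  qed
  have ed0: "edges_in E g {} = {}" using bd(9) by (force simp: edges_in_def)
  have "colors E g w {} {} {}" unfolding colors_def ed0 by (simp add: acyc_def good_empty)
  then have c1: "colors E g w (insert y {}) (insert y {}) {}"
    by (rule colors_addM0) (use st0 bd(8,9) w1(2) in auto)
  obtain e0 where e0: "star E g x {y} \<subseteq> {e0}"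
  proof (cases "star E g x {y} = {}")
    case False
    then have "card (star E g x {y}) = 1" using xy finite_star[OF bd(8), of g x "{y}"] by (simp add: le_Suc_eq)
    then obtain e where "star E g x {y} = {e}" using card_1_singletonE by blast
    then show ?thesis using that[of e] by simp
  next
    case True
    then show ?thesis using that by simp
  qed
  have "colors E g w (insert x {y}) (insert x {y}) {}"
  proof (rule colors_addM[OF c1 _ e0, where y = y and ky = "2 * H - 1" and kz = 1])
    show "w x + 1 \<le> D + 1" using w1 H(1,2) by linarith
    assume s: "star E g x {y} = {e0}"
    then have "x \<in> g e0" "g e0 \<subseteq> {x, y}" "e0 \<in> E" by (auto simp: star_def)
    then have "g e0 = {x, y}" using bd(9)[of e0] card2_other[of "g e0" x] by auto
    moreover have "good E g (w(y := w y + (2 * H - 1))) {y}"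
      by (rule good_single[of E g, OF bd(9)]) (use w1 H(1,2) in auto)
    ultimately show "g e0 = {x, y} \<and> comb (2 * H - 1) 1 \<and> good E g (w(y := w y + (2 * H - 1))) {y}"
      using combH[of "2 * H - 1" 1] H(1) by simp
  qed (use d bd(8,9) in auto)
  then have c2: "colors E g w (insert z {x, y}) {x, y} (insert z {})"
    by (rule colors_addF) (use d st0 bd(8) in auto)
  have c3: "colors E g w (insert v1 {z, x, y}) {x, y} (insert v1 {z})"
  proof (rule colors_addF[OF c2])
    have "star E g v1 {z} \<subseteq> {eu1}"
    proof
      fix e assume e: "e \<in> star E g v1 {z}"
      then have "e \<in> {ep1, eq1, eu1}" using inc1 by (auto simp: star_def)
      moreover have "e \<noteq> ep1" "e \<noteq> eq1" using e ge1 pq1 pf by (auto simp: star_def)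
      ultimately show "e \<in> {eu1}" by blast
    qed
    then show "card (star E g v1 {z}) \<le> 1" by (auto dest: subset_singletonD)
  qed (use far' bd(8) in auto)
  have "colors E g w (insert v2 {v1, z, x, y}) {x, y} (insert v2 {v1, z})"
  proof (rule colors_addF[OF c3])
    have "star E g v2 {v1, z} \<subseteq> {eu2}"
    proof
      fix e assume e: "e \<in> star E g v2 {v1, z}"
      then have "e \<in> {ep2, eq2, eu2}" using inc2 by (auto simp: star_def)
      moreover have "e \<noteq> ep2" "e \<noteq> eq2" using e ge2 pq2 pf by (auto simp: star_def)
      ultimately show "e \<in> {eu2}" by blast
    qed
    then show "card (star E g v2 {v1, z}) \<le> 1" by (auto dest: subset_singletonD)
  qed (use far' d(4) bd(8) in auto)
  moreover have "insert v2 {v1, z, x, y} = V" using V by auto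
  ultimately show False using bd(10) unfolding col_def by auto
qed

text \<open>
  A light vertex has charge 1 and sends a third of it to each neighbor; charges are tripled.
\<close>

lemma charge:
  assumes b: "bad V E g w" and u: "u \<in> V" "\<not> light V E g w u"
  defines "k \<equiv> card {v\<in>V. light V E g w v \<and> u \<in> nbrs E g v}" and "d \<equiv> card {ed\<in>E. u \<in> g ed}"
  shows "3 * (f (w u) - 2 * int H * int d) + int k \<le> -1"
    and "k = 0 \<Longrightarrow> 3 * (f (w u) - 2 * int H * int d) + int k \<le> -3"
    and "3 * (f (w u) - 2 * int H * int d) + int k = -1 \<Longrightarrow> d = 4 \<and> w u = 1 \<and> k = 2"
proof -
  note bd = badD[OF b]
  let ?K = "{v\<in>V. light V E g w v \<and> u \<in> nbrs E g v}"
  let ?s = "3 * (f (w u) - 2 * int H * int d) + int k"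
  have r: "1 \<le> w u" "w u \<le> D + 2" using bd(4) u by (auto simp: range_def)
  have fu: "f (w u) = 8 * int H + 1 - 2 * int (w u)" using fH[OF r] .
  have finK: "finite ?K" using bd(7) by simp
  have kd: "k \<le> d"
  proof -
    have "?K \<subseteq> nbrs E g u" by (auto simp: nbrs_def insert_commute)
    then have "k \<le> card (nbrs E g u)" unfolding k_def using card_nbrs(2)[OF bd(2)] by (intro card_mono)
    then show ?thesis using card_nbrs(1)[OF bd(2), of u] unfolding d_def by linarith
  qed
  have kpos: "w u \<le> D + 1 \<and> 4 \<le> d" if "k \<noteq> 0"
  proof -
    have "?K \<noteq> {}"
    proof
      assume "?K = {}"
      then show False using that unfolding k_def by (simp only: card.empty)
    qed
    then obtain v where v: "light V E g w v" "u \<in> nbrs E g v" by blast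
    show ?thesis using light_nbr(1)[OF b v] light_nbr_degree[OF b v] unfolding d_def by blast
  qed
  have d2: "2 \<le> d" "w u \<le> D + 1 \<Longrightarrow> 3 \<le> d" using crit_degree[OF bd(1,2) u(1)] unfolding d_def by auto
  have k2: "k \<le> 2" if "d = 4" "w u = 1"
  proof (rule ccontr)
    assume "\<not> ?thesis"
    then have "3 \<le> card ?K" unfolding k_def by simp
    then obtain T where T: "T \<subseteq> ?K" "card T = 3" using obtain_subset_with_card_n[of 3 ?K] by blast
    obtain v1 v2 v3 where t: "T = {v1, v2, v3}" "v1 \<noteq> v2" "v1 \<noteq> v3" "v2 \<noteq> v3" using T(2) by (auto simp: card_3_iff)
    then have "v1 \<in> ?K" "v2 \<in> ?K" "v3 \<in> ?K" using T(1) by auto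
    then show False using no_three_lights[OF b u(1) _ that(2), of v1 v2 v3] that(1) t(2-4) unfolding d_def by blast
  qed
  have "?s \<le> -1 \<and> (k = 0 \<longrightarrow> ?s \<le> -3) \<and> (?s = -1 \<longrightarrow> d = 4 \<and> w u = 1 \<and> k = 2)"
  proof -
    consider "w u = D + 2" | "w u \<le> D + 1" "d = 3" | "d = 4" "w u = 1" | "d = 4" "2 \<le> w u" | "5 \<le> d" "w u \<le> D + 1"
      using d2 r by linarith
    then show ?thesis
    proof cases
      case 1
      then have "k = 0" using kpos by auto
      moreover have "2 * int H * 2 \<le> 2 * int H * int d" using d2(1) by (intro mult_left_mono) auto
      moreover have "int (w u) = 2 * int H + 1" using 1 H(2) by simp
      ultimately have "?s \<le> -3" using fu by (simp add: algebra_simps)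
      then show ?thesis by simp
    next
      case 2
      then have "k = 0" using kpos by auto
      moreover have "H + 1 \<le> w u" using 2(2) u unfolding d_def light_def by auto
      ultimately show ?thesis using fu 2 by auto
    next
      case 3
      then show ?thesis using fu k2 by auto
    next
      case 4
      then show ?thesis using fu kd by auto
    next
      case 5
      have "(6 * int H - 1) * 5 \<le> (6 * int H - 1) * int d" using 5 H(1) by (intro mult_left_mono) auto
      then have "6 * int H * int d - int d \<ge> 30 * int H - 5" by (simp add: algebra_simps)
      moreover have "int k \<le> int d" "1 \<le> int (w u)" "1 \<le> int H" using kd r H(1) by simp_all
      ultimately have "?s \<le> -3" using fu by (simp add: algebra_simps)
      then show ?thesis by simp
    qed
  qed
  then show "?s \<le> -1" "k = 0 \<Longrightarrow> ?s \<le> -3" "?s = -1 \<Longrightarrow> d = 4 \<and> w u = 1 \<and> k = 2" by auto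
qed

lemma no_bad: "\<not> bad V E g w"
proof
  assume b: "bad V E g w"
  note bd = badD[OF b]
  define L where "L = {v\<in>V. light V E g w v}"
  define R where "R = V - L"
  define k where "k u = card {v\<in>V. light V E g w v \<and> u \<in> nbrs E g v}" for u
  define d where "d u = card {ed\<in>E. u \<in> g ed}" for u
  define s where "s u = 3 * (f (w u) - 2 * int H * int (d u)) + int (k u)" for u
  have fin: "finite L" "finite R" "L \<inter> R = {}" "L \<union> R = V" using bd(7) by (auto simp: L_def R_def)
  have nL: "nbrs E g v \<subseteq> R" "card (nbrs E g v) = 3" if "v \<in> L" for v
  proof -
    have l: "light V E g w v" using that by (simp add: L_def)
    show "card (nbrs E g v) = 3" using light_weight(2)[OF b l] .
    show "nbrs E g v \<subseteq> R" using light_nbr(2)[OF b l] nbrs_sub[OF bd(2), of v] by (auto simp: R_def L_def)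
  qed
  have dc: "(\<Sum>u\<in>R. k u) = 3 * card L"
  proof -
    have "(\<Sum>u\<in>R. card {v\<in>L. u \<in> nbrs E g v}) = (\<Sum>v\<in>L. 3)"
    proof (rule sum_multicount_gen)
      show "\<forall>v\<in>L. card {u\<in>R. u \<in> nbrs E g v} = 3"
      proof
        fix v assume "v \<in> L"
        note n = nL[OF this]
        have "{u\<in>R. u \<in> nbrs E g v} = nbrs E g v" using n(1) by blast
        then show "card {u\<in>R. u \<in> nbrs E g v} = 3" using n(2) by simp
      qed
    qed (use fin in auto)
    moreover have "{v\<in>L. u \<in> nbrs E g v} = {v\<in>V. light V E g w v \<and> u \<in> nbrs E g v}" for u by (auto simp: L_def)
    ultimately show ?thesis by (simp add: k_def)
  qed
  have tL: "f (w v) - 2 * int H * int (d v) = 1" if "v \<in> L" for v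
  proof -
    have l: "light V E g w v" using that by (simp add: L_def)
    then have "d v = 3" by (simp add: d_def light_def)
    then show ?thesis using light_weight(1)[OF b l] f_H by simp
  qed
  have "2 * po E g w V = 2 * (\<Sum>v\<in>V. f (w v) - 2 * int H * int (d v))"
    unfolding handshake[OF bd(2)] sum_distrib_left by (rule sum.cong) (auto simp: H(3) d_def)
  also have "(\<Sum>v\<in>V. f (w v) - 2 * int H * int (d v)) =
      (\<Sum>v\<in>L. f (w v) - 2 * int H * int (d v)) + (\<Sum>v\<in>R. f (w v) - 2 * int H * int (d v))"
    using sum.union_disjoint[OF fin(1-3), of "\<lambda>v. f (w v) - 2 * int H * int (d v)"] unfolding fin(4) .
  also have "(\<Sum>v\<in>L. f (w v) - 2 * int H * int (d v)) = int (card L)" using tL by simp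
  finally have po: "po E g w V = int (card L) + (\<Sum>v\<in>R. f (w v) - 2 * int H * int (d v))" by simp
  have "(\<Sum>u\<in>R. s u) = 3 * (\<Sum>v\<in>R. f (w v) - 2 * int H * int (d v)) + int (\<Sum>u\<in>R. k u)"
    unfolding s_def by (simp only: sum.distrib sum_distrib_left of_nat_sum)
  then have "(\<Sum>u\<in>R. s u) = 3 * po E g w V" using po dc by simp
  then have tot: "-3 \<le> (\<Sum>u\<in>R. s u)" using odd_pot[OF b] by linarith
  have ch: "s u \<le> -1" "k u = 0 \<Longrightarrow> s u \<le> -3" "s u = -1 \<Longrightarrow> d u = 4 \<and> w u = 1 \<and> k u = 2" if "u \<in> R" for u
  proof -
    have u: "u \<in> V" "\<not> light V E g w u" using that by (auto simp: R_def L_def)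
    show "s u \<le> -1" "k u = 0 \<Longrightarrow> s u \<le> -3" "s u = -1 \<Longrightarrow> d u = 4 \<and> w u = 1 \<and> k u = 2"
      using charge[OF b u] unfolding s_def k_def d_def by blast+
  qed
  have L: "L \<noteq> {}"
  proof
    assume L0: "L = {}"
    have "k u = 0" for u
    proof -
      have "{v\<in>V. light V E g w v \<and> u \<in> nbrs E g v} = {}" using L0 by (auto simp: L_def)
      then show ?thesis unfolding k_def by (simp only: card.empty)
    qed
    then have "(\<Sum>u\<in>R. s u) \<le> (\<Sum>u\<in>R. -3)" using ch(2) by (intro sum_mono) blast
    moreover have "R = V" using L0 fin(4) by simp
    ultimately show False using tot crit_two(1)[OF bd(1,2)] by simp
  qed
  then obtain v1 where v1: "v1 \<in> L" by blast
  have "(\<Sum>u\<in>R. s u) \<le> (\<Sum>u\<in>R. -1)" using ch(1) by (intro sum_mono) blast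
  then have cR: "card R \<le> 3" using tot by simp
  have R1: "nbrs E g v = R" if "v \<in> L" for v using card_seteq[OF fin(2) nL(1)[OF that]] nL(2)[OF that] cR by simp
  have "card R = 3" using R1[OF v1] nL(2)[OF v1] by simp
  then obtain x y z where R: "R = {x, y, z}" and ne: "x \<noteq> y" "x \<noteq> z" "y \<noteq> z" by (auto simp: card_3_iff)
  have "s x + s y + s z \<ge> -3" using tot ne unfolding R by simp
  moreover have "s x \<le> -1" "s y \<le> -1" "s z \<le> -1" using ch(1) R by auto
  ultimately have "s x = -1" "s y = -1" "s z = -1" by linarith+
  then have X: "d x = 4" "w x = 1" "k x = 2" "w y = 1" "k y = 2" "w z = 1" "k z = 2" using ch(3) R by auto
  have "card L = 2" using dc X ne unfolding R by simp
  then obtain v2 where v2: "L = {v1, v2}" "v1 \<noteq> v2" using v1 card2_other by metis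
  have lt: "light V E g w v1" "light V E g w v2" using v2 by (auto simp: L_def)
  have nb: "nbrs E g v1 = {x, y, z}" "nbrs E g v2 = {x, y, z}" using R1 v2 R by auto
  have VV: "V = {x, y, z, v1, v2}" "V = {x, z, y, v1, v2}" using fin(4) R v2 by auto
  have fresh: "x \<notin> {y, z, v1, v2}" "v1 \<noteq> y" "v1 \<noteq> z" "v2 \<noteq> y" "v2 \<noteq> z" using ne fin(3) R v2 by auto
  have "star E g x (V - {x}) = {ed\<in>E. x \<in> g ed}" by (rule star_all[OF bd(2)])
  moreover have "V - {x} = {y} \<union> ({z} \<union> ({v1} \<union> {v2}))" using VV fresh by auto
  ultimately have "4 = card (star E g x ({y} \<union> ({z} \<union> ({v1} \<union> {v2}))))" using X(1) by (simp add: d_def)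
  also have "\<dots> = card (star E g x {y}) + card (star E g x ({z} \<union> ({v1} \<union> {v2})))"
    by (rule star_Un[OF bd(9) _ _ _ bd(8)]) (use fresh ne in auto)
  also have "card (star E g x ({z} \<union> ({v1} \<union> {v2}))) = card (star E g x {z}) + card (star E g x ({v1} \<union> {v2}))"
    by (rule star_Un[OF bd(9) _ _ _ bd(8)]) (use fresh ne in auto)
  also have "card (star E g x ({v1} \<union> {v2})) = card (star E g x {v1}) + card (star E g x {v2})"
    by (rule star_Un[OF bd(9) _ _ _ bd(8)]) (use fresh v2 in auto)
  finally have sum4: "4 = card (star E g x {y}) + (card (star E g x {z}) + (card (star E g x {v1}) + card (star E g x {v2})))" .
  have pos: "1 \<le> card (star E g x {v})" if v: "x \<in> nbrs E g v" for v
  proof -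
    obtain ed where "ed \<in> E" "g ed = {v, x}" using v by (auto simp: nbrs_def)
    then have "star E g x {v} \<noteq> {}" by (auto simp: star_def)
    then show ?thesis using finite_star[OF bd(8), of g x "{v}"] by (simp add: Suc_le_eq card_gt_0_iff)
  qed
  have "1 \<le> card (star E g x {v1})" "1 \<le> card (star E g x {v2})" using pos nb by blast+
  then consider "card (star E g x {y}) \<le> 1" | "card (star E g x {z}) \<le> 1" using sum4 by linarith
  then show False
  proof cases
    case 1
    show False by (rule five_vertex_coloring[OF b VV(1) ne v2(2) lt(1) nb(1) lt(2) nb(2) X(2,4) 1])
  next
    case 2
    have nb': "nbrs E g v1 = {x, z, y}" "nbrs E g v2 = {x, z, y}" using nb by auto
    show False by (rule five_vertex_coloring[OF b VV(2) ne(2,1) ne(3)[symmetric] v2(2) lt(1) nb'(1) lt(2) nb'(2) X(2,6) 2])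
  qed
qed

end

section \<open>Contractions of multigraphs and simple graphs\<close>

lemma leaf_transfer:
  assumes ac: "acyc T g'" and S: "S \<subseteq> T" "S \<noteq> {}" "finite S"
    and g': "\<And>ed. ed \<in> S \<Longrightarrow> card (g' ed) = 2 \<and> g' ed \<subseteq> insert a F \<and> g' ed \<inter> F = g ed \<inter> F"
  shows "\<exists>v\<in>F. card {ed\<in>S. v \<in> g ed} = 1"
proof -
  obtain v where v: "v \<noteq> a" "card {ed\<in>S. v \<in> g' ed} = 1"
    using acyc_leaf_other[OF ac S, of a] g' by blast
  then obtain e where "{ed\<in>S. v \<in> g' ed} = {e}" using card_1_singletonE by blast
  then have "e \<in> S" "v \<in> g' e" by auto
  then have vF: "v \<in> F" using g'[of e] v(1) by auto
  have "{ed\<in>S. v \<in> g' ed} = {ed\<in>S. v \<in> g ed}" using g' vF by blast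
  then show ?thesis using v(2) vF by auto
qed

lemma cross_edge:
  assumes "card e = 2" "z \<in> e" "m \<in> e" "z \<in> B" "m \<notin> B"
  shows "e = {z, m}"
proof -
  obtain y where "e = {z, y}" using card2_other[OF assms(1,2)] .
  then show ?thesis using assms(3-5) by auto
qed

lemma contraction_multi:
  assumes wf: "wf_graph V E g" and A: "A \<subseteq> V" "2 \<le> card A" and FA: "FA \<subseteq> A" and eps: "0 \<le> \<epsilon>"
  shows "\<exists>X E' g'. contraction \<epsilon> (\<epsilon> - 1) V E g A FA X E' g'"
proof -
  define W where "W = V - A"
  have fin: "finite V" "finite E" and gV: "\<And>ed. ed \<in> E \<Longrightarrow> g ed \<subseteq> V" "\<And>ed. ed \<in> E \<Longrightarrow> card (g ed) = 2"
    using wf by (auto simp: wf_graph_def)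
  obtain a where a: "a \<in> A" using A(2) by fastforce
  then have aW: "a \<notin> W" by (simp add: W_def)
  define E' where "E' = {ed\<in>E. g ed \<subseteq> W \<or> (\<exists>z\<in>W. \<exists>m\<in>FA. g ed = {z, m})}"
  define g' where "g' ed = (if g ed \<subseteq> W then g ed else insert a (g ed \<inter> W))" for ed
  have FW: "FA \<inter> W = {}" using FA by (auto simp: W_def)
  have cross: "g' ed = {a, z}" if "g ed = {z, m}" "z \<in> W" "m \<in> FA" for ed z m
    using that FW by (auto simp: g'_def)
  have inW: "g' ed = g ed" if "g ed \<subseteq> W" for ed using that by (simp add: g'_def)
  have g'2: "card (g' ed) = 2 \<and> g' ed \<subseteq> W \<union> {a} \<and> g' ed \<inter> W = g ed \<inter> W" if ed: "ed \<in> E'" for ed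
  proof (cases "g ed \<subseteq> W")
    case True
    then show ?thesis using ed gV(2)[of ed] inW by (auto simp: E'_def)
  next
    case False
    then obtain z m where zm: "z \<in> W" "m \<in> FA" "g ed = {z, m}" using ed by (auto simp: E'_def)
    have "m \<notin> W" "a \<noteq> z" using zm FW aW by auto
    then show ?thesis using cross[OF zm(3,1,2)] zm aW by (auto simp: card_2_iff)
  qed
  have "contraction \<epsilon> (\<epsilon> - 1) V E g A FA {a} E' g'"
    unfolding contraction_def W_def[symmetric]
  proof (intro conjI)
    show "{a} \<subseteq> A" "card {a} < card A" using a A(2) by auto
    show "wf_graph (W \<union> {a}) E' g'" using fin g'2 by (auto simp: wf_graph_def W_def E'_def)
    show "edges_in E' g' W = edges_in E g W"
    proof (intro equalityI subsetI)
      fix ed assume "ed \<in> edges_in E' g' W"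
      then have ed: "ed \<in> E'" "g' ed \<subseteq> W" by (auto simp: edges_in_def)
      then have "g ed \<subseteq> W" using aW by (auto simp: g'_def split: if_splits)
      then show "ed \<in> edges_in E g W" using ed(1) by (auto simp: edges_in_def E'_def)
    qed (auto simp: edges_in_def E'_def inW)
    show "\<forall>ed\<in>edges_in E g W. g' ed = g ed" by (auto simp: edges_in_def inW)
    show "forest_transfer E g W FA {a} E' g'"
      unfolding forest_transfer_def
    proof (intro allI impI)
      fix F S assume F: "F \<subseteq> W" and ac: "acyc (edges_in E' g' (F \<union> {a})) g'" and S: "S \<subseteq> edges_in E g (F \<union> FA)" "S \<noteq> {}"
        and meet: "\<forall>ed\<in>S. g ed \<inter> F \<noteq> {}"
      have SE: "ed \<in> E' \<and> g' ed \<subseteq> insert a F" if ed: "ed \<in> S" for ed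
      proof -
        have e: "ed \<in> E" "g ed \<subseteq> F \<union> FA" using S ed by (auto simp: edges_in_def)
        show ?thesis
        proof (cases "g ed \<subseteq> F")
          case True
          then have "g ed \<subseteq> W" using F by blast
          then show ?thesis using e True inW[of ed] by (auto simp: E'_def)
        next
          case False
          then obtain m where m: "m \<in> g ed" "m \<notin> F" by blast
          obtain z where z: "z \<in> g ed" "z \<in> F" using meet ed by blast
          have gz: "g ed = {z, m}" by (rule cross_edge[OF gV(2)[OF e(1)] z(1) m(1) z(2) m(2)])
          have "z \<in> W" "m \<in> FA" using m z e F by auto
          then show ?thesis using gz e(1) cross[OF gz] z by (auto simp: E'_def)
        qed
      qed
      show "\<exists>v\<in>F. card {ed\<in>S. v \<in> g ed} = 1"
      proof (rule leaf_transfer[OF ac _ S(2)])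
        show "S \<subseteq> edges_in E' g' (F \<union> {a})" using SE by (auto simp: edges_in_def)
        show "finite S" using S(1) fin(2) finite_subset[OF _ finite_edges_in[OF fin(2)]] by blast
        fix ed assume ed: "ed \<in> S"
        have "g' ed \<inter> W = g ed \<inter> W" "card (g' ed) = 2" using g'2 SE[OF ed] by auto
        then show "card (g' ed) = 2 \<and> g' ed \<subseteq> insert a F \<and> g' ed \<inter> F = g ed \<inter> F" using SE[OF ed] F by blast
      qed
    qed
    show "count_transfer \<epsilon> (\<epsilon> - 1) E g W FA {a} E' g'"
      unfolding count_transfer_def
    proof (intro allI impI)
      fix B X' assume B: "B \<subseteq> W" and X': "X' \<subseteq> {a}" "X' \<noteq> {}"
      then have Xa: "X' = {a}" by blast
      have "edges_in E' g' (B \<union> {a}) \<subseteq> edges_in E g B \<union> between E g B FA"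
      proof
        fix ed assume "ed \<in> edges_in E' g' (B \<union> {a})"
        then have ed: "ed \<in> E'" "g' ed \<subseteq> insert a B" "ed \<in> E" by (auto simp: edges_in_def E'_def)
        show "ed \<in> edges_in E g B \<union> between E g B FA"
        proof (cases "g ed \<subseteq> W")
          case True
          then have "g ed \<subseteq> B" using ed(2) inW[OF True] aW by auto
          then show ?thesis using ed(3) by (auto simp: edges_in_def)
        next
          case False
          then obtain z m where zm: "z \<in> W" "m \<in> FA" "g ed = {z, m}" using ed by (auto simp: E'_def)
          then have "z \<in> B" using cross[OF zm(3,1,2)] ed(2) aW by auto
          then show ?thesis using zm ed(3) by (auto simp: between_def)
        qed
      qed
      then have "card (edges_in E' g' (B \<union> {a})) \<le> card (edges_in E g B \<union> between E g B FA)"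
        using fin(2) by (intro card_mono) (auto simp: finite_edges_in finite_between)
      also have "\<dots> \<le> card (edges_in E g B) + card (between E g B FA)" by (rule card_Un_le)
      finally have "\<epsilon> * int (card (edges_in E' g' (B \<union> {a}))) \<le> \<epsilon> * (int (card (edges_in E g B)) + int (card (between E g B FA)))"
        using eps by (intro mult_left_mono) auto
      then show "\<epsilon> - 1 - \<epsilon> * int (card (edges_in E g B)) - \<epsilon> * int (card (between E g B FA))
         \<le> (\<epsilon> - 1) * int (card X') - \<epsilon> * int (card (edges_in E' g' (B \<union> X')))"
        unfolding Xa by (simp add: algebra_simps)
    qed
  qed
  then show ?thesis by blast
qed

text \<open>
  The edge \<open>e0\<close> becomes \<open>ab\<close>. An outside vertex \<open>z\<close> keeps at most two of its edges to \<open>FA\<close>, one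
  ending in \<open>a\<close> and one in \<open>b\<close>, which suffices since the triangle \<open>abz\<close> then keeps \<open>z\<close> out of \<open>F\<close>.
\<close>

lemma contraction_simple:
  assumes wf: "wf_graph V E g" and inj: "inj_on g E" and A: "A \<subseteq> V" "3 \<le> card A" "e0 \<in> E" "g e0 \<subseteq> A"
    and FA: "FA \<subseteq> A" and eps: "0 \<le> \<epsilon>"
  shows "\<exists>X E' g'. contraction \<epsilon> (\<epsilon> - 2) V E g A FA X E' g' \<and> inj_on g' E'"
proof -
  define W where "W = V - A"
  have fin: "finite V" "finite E" and gV: "\<And>ed. ed \<in> E \<Longrightarrow> g ed \<subseteq> V" "\<And>ed. ed \<in> E \<Longrightarrow> card (g ed) = 2"
    using wf by (auto simp: wf_graph_def)
  obtain a b where ab: "g e0 = {a, b}" "a \<noteq> b" using gV(2)[OF A(3)] by (auto simp: card_2_iff)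
  have abA: "a \<in> A" "b \<in> A" using ab A(4) by auto
  then have aW: "a \<notin> W" "b \<notin> W" by (auto simp: W_def)
  have FW: "FA \<inter> W = {}" using FA by (auto simp: W_def)
  define N where "N z = {ed\<in>E. \<exists>m\<in>FA. g ed = {z, m}}" for z
  have finN: "finite (N z)" for z using fin(2) by (simp add: N_def)
  have "\<exists>c1 c2. (N z \<noteq> {} \<longrightarrow> c1 \<in> N z) \<and> (2 \<le> card (N z) \<longrightarrow> c2 \<in> N z \<and> c2 \<noteq> c1)" for z
  proof (cases "N z = {}")
    case True
    then show ?thesis by simp
  next
    case False
    then obtain c1 where c1: "c1 \<in> N z" by blast
    show ?thesis
    proof (cases "2 \<le> card (N z)")
      case True
      then have "\<not> N z \<subseteq> {c1}" using card_mono[of "{c1}" "N z"] by auto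
      then obtain c2 where "c2 \<in> N z" "c2 \<noteq> c1" by blast
      then show ?thesis using c1 by blast
    next
      case False
      then show ?thesis using c1 by blast
    qed
  qed
  then obtain c1 c2 where c: "\<And>z. N z \<noteq> {} \<Longrightarrow> c1 z \<in> N z" "\<And>z. 2 \<le> card (N z) \<Longrightarrow> c2 z \<in> N z \<and> c2 z \<noteq> c1 z"
    by metis
  define C1 where "C1 = {ed. \<exists>z\<in>W. N z \<noteq> {} \<and> ed = c1 z}"
  define C2 where "C2 = {ed. \<exists>z\<in>W. 2 \<le> card (N z) \<and> ed = c2 z}"
  define E' where "E' = edges_in E g W \<union> {e0} \<union> C1 \<union> C2"
  define g' where "g' ed = (if ed = e0 \<or> g ed \<subseteq> W then g ed else if ed \<in> C1 then insert a (g ed \<inter> W) else insert b (g ed \<inter> W))" for ed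
  have Nz: "ed \<in> E \<and> (\<exists>m\<in>FA. g ed = {z, m}) \<and> g ed \<inter> W = {z} \<and> ed \<noteq> e0 \<and> \<not> g ed \<subseteq> W" if zn: "z \<in> W" "ed \<in> N z" for ed z
  proof -
    obtain m where m: "m \<in> FA" "g ed = {z, m}" "ed \<in> E" using zn(2) by (auto simp: N_def)
    then have "m \<notin> W" "z \<notin> g e0" using FW aW ab zn(1) by auto
    then show ?thesis using m zn(1) by auto
  qed
  have Nuniq: "z = z'" if "z \<in> W" "z' \<in> W" "ed \<in> N z" "ed \<in> N z'" for z z' ed
    using Nz[OF that(1,3)] Nz[OF that(2,4)] by auto
  have C1: "\<exists>z\<in>W. ed \<in> N z \<and> ed = c1 z \<and> g' ed = {a, z}" if ed: "ed \<in> C1" for ed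
  proof -
    obtain z where z: "z \<in> W" "N z \<noteq> {}" "ed = c1 z" using ed by (auto simp: C1_def)
    have n: "ed \<in> N z" using c(1)[OF z(2)] z(3) by simp
    then show ?thesis using z Nz[OF z(1) n] ed by (auto simp: g'_def)
  qed
  have C2: "\<exists>z\<in>W. ed \<in> N z \<and> ed = c2 z \<and> 2 \<le> card (N z) \<and> g' ed = {b, z}" if ed: "ed \<in> C2" for ed
  proof -
    obtain z where z: "z \<in> W" "2 \<le> card (N z)" "ed = c2 z" using ed by (auto simp: C2_def)
    have n: "ed \<in> N z" "ed \<noteq> c1 z" using c(2)[OF z(2)] z(3) by auto
    have "ed \<notin> C1"
    proof
      assume "ed \<in> C1"
      then obtain z' where z': "z' \<in> W" "ed \<in> N z'" "ed = c1 z'" using C1 by blast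
      then show False using Nuniq[OF z(1) z'(1) n(1) z'(2)] n(2) by blast
    qed
    then show ?thesis using z n Nz[OF z(1) n(1)] by (auto simp: g'_def)
  qed
  have g'0: "g' e0 = {a, b}" using ab by (simp add: g'_def)
  have inW: "g' ed = g ed" if "g ed \<subseteq> W" for ed using that by (simp add: g'_def)
  have E'E: "ed \<in> E" if "ed \<in> E'" for ed
    using that C1 C2 A(3) by (auto simp: E'_def edges_in_def N_def)
  have kinds: "g ed \<subseteq> W \<or> ed = e0 \<or> ed \<in> C1 \<or> ed \<in> C2" if "ed \<in> E'" for ed
    using that by (auto simp: E'_def edges_in_def)
  have g'2: "card (g' ed) = 2 \<and> g' ed \<subseteq> W \<union> {a, b}" if ed: "ed \<in> E'" for ed
    using kinds[OF ed]
  proof (elim disjE)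
    assume "g ed \<subseteq> W" then show ?thesis using inW[of ed] gV(2)[OF E'E[OF ed]] by auto
  next
    assume "ed = e0" then show ?thesis using g'0 ab(2) by auto
  next
    assume "ed \<in> C1"
    then obtain z where z: "z \<in> W" "g' ed = {a, z}" using C1 by blast
    then have "a \<noteq> z" using aW by auto
    then show ?thesis using z by auto
  next
    assume "ed \<in> C2"
    then obtain z where z: "z \<in> W" "g' ed = {b, z}" using C2 by blast
    then have "b \<noteq> z" using aW by auto
    then show ?thesis using z by auto
  qed
  have "inj_on g' E'"
  proof (rule inj_onI)
    fix e e' assume e: "e \<in> E'" "e' \<in> E'" and eq: "g' e = g' e'"
    have inW0: "g e \<subseteq> W \<longleftrightarrow> g' e \<subseteq> W" if "e \<in> E'" for e
      using kinds[OF that] C1[of e] C2[of e] g'0 aW inW[of e] ab(1) Nz by (auto simp: g'_def)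
    show "e = e'"
    proof (cases "g' e \<subseteq> W")
      case True
      then have "g e \<subseteq> W" "g e' \<subseteq> W" using inW0 e eq by auto
      then have "g e = g e'" using inW eq by auto
      then show ?thesis using inj E'E e by (auto dest: inj_onD)
    next
      case False
      have k: "(d = e0 \<and> a \<in> g' d \<and> b \<in> g' d) \<or> (\<exists>z\<in>W. d = c1 z \<and> g' d = {a, z}) \<or> (\<exists>z\<in>W. d = c2 z \<and> g' d = {b, z})"
        if "d \<in> E'" "\<not> g' d \<subseteq> W" for d
      proof -
        have "d = e0 \<or> d \<in> C1 \<or> d \<in> C2" using kinds[OF that(1)] inW0[OF that(1)] that(2) by blast
        then show ?thesis using C1[of d] C2[of d] g'0 by blast
      qed
      from k[OF e(1) False] k[OF e(2)] False eq have "(e = e0 \<and> a \<in> g' e \<and> b \<in> g' e) \<or> (\<exists>z\<in>W. e = c1 z \<and> g' e = {a, z}) \<or> (\<exists>z\<in>W. e = c2 z \<and> g' e = {b, z})"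
         and "(e' = e0 \<and> a \<in> g' e \<and> b \<in> g' e) \<or> (\<exists>z\<in>W. e' = c1 z \<and> g' e = {a, z}) \<or> (\<exists>z\<in>W. e' = c2 z \<and> g' e = {b, z})"
        by simp_all
      then show ?thesis using aW ab(2) by (elim disjE bexE conjE) (auto simp: doubleton_eq_iff)
    qed
  qed
  moreover have "contraction \<epsilon> (\<epsilon> - 2) V E g A FA {a, b} E' g'"
    unfolding contraction_def W_def[symmetric]
  proof (intro conjI)
    show "{a, b} \<subseteq> A" "card {a, b} < card A" using abA ab(2) A(2) by auto
    have "E' \<subseteq> E" using E'E by blast
    then show "wf_graph (W \<union> {a, b}) E' g'" using fin g'2 finite_subset by (auto simp: wf_graph_def W_def)
    show "edges_in E' g' W = edges_in E g W"
    proof (intro equalityI subsetI)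
      fix ed assume "ed \<in> edges_in E' g' W"
      then have ed: "ed \<in> E'" "g' ed \<subseteq> W" by (auto simp: edges_in_def)
      have "ed \<noteq> e0" "ed \<notin> C1" "ed \<notin> C2" using ed(2) g'0 C1[of ed] C2[of ed] aW by auto
      then show "ed \<in> edges_in E g W" using ed(1) by (auto simp: E'_def)
    next
      fix ed assume "ed \<in> edges_in E g W"
      then show "ed \<in> edges_in E' g' W" using inW[of ed] by (auto simp: edges_in_def E'_def)
    qed
    show "\<forall>ed\<in>edges_in E g W. g' ed = g ed" by (auto simp: edges_in_def inW)
    show "forest_transfer E g W FA {a, b} E' g'"
      unfolding forest_transfer_def
    proof (intro allI impI)
      fix F S assume F: "F \<subseteq> W" and ac: "acyc (edges_in E' g' (F \<union> {a, b})) g'" and S: "S \<subseteq> edges_in E g (F \<union> FA)" "S \<noteq> {}"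
        and meet: "\<forall>ed\<in>S. g ed \<inter> F \<noteq> {}"
      have one: "card (N z) \<le> 1" if z: "z \<in> F" for z
      proof (rule ccontr)
        assume "\<not> ?thesis"
        then have two: "2 \<le> card (N z)" by simp
        then have ne: "N z \<noteq> {}" by auto
        have zW: "z \<in> W" using z F by auto
        have "c1 z \<in> C1" "c2 z \<in> C2" using zW two ne unfolding C1_def C2_def by blast+
        have n: "c1 z \<in> N z" "c2 z \<in> N z" using c(1)[OF ne] c(2)[OF two] by auto
        have gc: "g' (c1 z) = {a, z}" "g' (c2 z) = {b, z}"
        proof -
          obtain z1 where z1: "z1 \<in> W" "c1 z \<in> N z1" "g' (c1 z) = {a, z1}" using C1[OF \<open>c1 z \<in> C1\<close>] by blast
          then show "g' (c1 z) = {a, z}" using Nuniq[OF zW z1(1) n(1) z1(2)] by simp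
          obtain z2 where z2: "z2 \<in> W" "c2 z \<in> N z2" "g' (c2 z) = {b, z2}" using C2[OF \<open>c2 z \<in> C2\<close>] by blast
          then show "g' (c2 z) = {b, z}" using Nuniq[OF zW z2(1) n(2) z2(2)] by simp
        qed
        let ?T = "{e0, c1 z, c2 z}"
        have "?T \<subseteq> edges_in E' g' (F \<union> {a, b})"
          using \<open>c1 z \<in> C1\<close> \<open>c2 z \<in> C2\<close> gc g'0 z by (auto simp: edges_in_def E'_def)
        then obtain v where v: "card {ed\<in>?T. v \<in> g' ed} = 1" using acycE[OF ac] by blast
        then obtain e where e: "{ed\<in>?T. v \<in> g' ed} = {e}" using card_1_singletonE by blast
        have "c1 z \<noteq> e0" "c2 z \<noteq> e0" "c2 z \<noteq> c1 z" using Nz[OF zW n(1)] Nz[OF zW n(2)] c(2)[OF two] by blast+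
        then have ned: "e0 \<noteq> c1 z" "e0 \<noteq> c2 z" "c1 z \<noteq> c2 z" by simp_all
        have zab: "z \<noteq> a" "z \<noteq> b" using zW aW by auto
        have "e \<in> ?T" "v \<in> g' e" using e by blast+
        then have "v = a \<or> v = b \<or> v = z" using g'0 gc by auto
        moreover have "\<exists>d d'. d \<in> ?T \<and> d' \<in> ?T \<and> d \<noteq> d' \<and> v \<in> g' d \<and> v \<in> g' d'"
        proof -
          consider "v = a" | "v = b" | "v = z" using \<open>v = a \<or> v = b \<or> v = z\<close> by blast
          then show ?thesis
          proof cases
            case 1 then show ?thesis using g'0 gc ned by (intro exI[of _ e0] exI[of _ "c1 z"]) simp
          next
            case 2 then show ?thesis using g'0 gc ned by (intro exI[of _ e0] exI[of _ "c2 z"]) simp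
          next
            case 3 then show ?thesis using g'0 gc ned by (intro exI[of _ "c1 z"] exI[of _ "c2 z"]) simp
          qed
        qed
        then obtain d d' where "d \<in> {ed\<in>?T. v \<in> g' ed}" "d' \<in> {ed\<in>?T. v \<in> g' ed}" "d \<noteq> d'" by blast
        then show False unfolding e by simp
      qed
      have SE: "ed \<in> E' \<and> g' ed \<subseteq> insert a F \<and> g' ed \<inter> F = g ed \<inter> F" if ed: "ed \<in> S" for ed
      proof -
        have e: "ed \<in> E" "g ed \<subseteq> F \<union> FA" using S ed by (auto simp: edges_in_def)
        show ?thesis
        proof (cases "g ed \<subseteq> F")
          case True
          then have "g ed \<subseteq> W" using F by blast
          then show ?thesis using e True inW[of ed] by (auto simp: E'_def edges_in_def)
        next
          case False
          then obtain m where m: "m \<in> g ed" "m \<notin> F" by blast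
          obtain z where z: "z \<in> g ed" "z \<in> F" using meet ed by blast
          have gz: "g ed = {z, m}" by (rule cross_edge[OF gV(2)[OF e(1)] z(1) m(1) z(2) m(2)])
          have zW: "z \<in> W" "m \<in> FA" using m z e F by auto
          then have n: "ed \<in> N z" using gz e(1) by (auto simp: N_def)
          then have ne: "N z \<noteq> {}" by auto
          have "card (N z) = 1" using one[OF z(2)] ne finN[of z] by (simp add: le_Suc_eq)
          then obtain e' where "N z = {e'}" using card_1_singletonE by blast
          then have "ed = c1 z" using c(1)[OF ne] n by simp
          then have "ed \<in> C1" using zW ne by (auto simp: C1_def)
          moreover from this obtain z' where z': "z' \<in> W" "ed \<in> N z'" "g' ed = {a, z'}" using C1 by blast
          moreover have "z' = z" by (rule Nuniq[OF z'(1) zW(1) z'(2) n])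
          moreover have "a \<notin> F" using aW F by auto
          ultimately show ?thesis using z gz m by (auto simp: E'_def)
        qed
      qed
      show "\<exists>v\<in>F. card {ed\<in>S. v \<in> g ed} = 1"
      proof (rule leaf_transfer[OF ac _ S(2)])
        show "S \<subseteq> edges_in E' g' (F \<union> {a, b})" using SE by (auto simp: edges_in_def)
        show "finite S" using S(1) fin(2) finite_subset[OF _ finite_edges_in[OF fin(2)]] by blast
        fix ed assume ed: "ed \<in> S"
        show "card (g' ed) = 2 \<and> g' ed \<subseteq> insert a F \<and> g' ed \<inter> F = g ed \<inter> F" using SE[OF ed] g'2 by blast
      qed
    qed
    show "count_transfer \<epsilon> (\<epsilon> - 2) E g W FA {a, b} E' g'"
      unfolding count_transfer_def
    proof (intro allI impI)
      fix B X' assume B: "B \<subseteq> W" and X': "X' \<subseteq> {a, b}" "X' \<noteq> {}"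
      let ?U = "edges_in E g B \<union> between E g B FA"
      have cov: "ed \<in> ?U \<or> (ed = e0 \<and> X' = {a, b})" if ed0: "ed \<in> edges_in E' g' (B \<union> X')" for ed
      proof -
        have ed: "ed \<in> E'" "g' ed \<subseteq> B \<union> X'" "ed \<in> E" using ed0 E'E by (auto simp: edges_in_def)
        have XW: "x \<notin> X'" if "x \<in> W" for x using X'(1) aW that by auto
        have bt: ?thesis if "z \<in> W" "ed \<in> N z" "z \<in> g' ed" for z
        proof -
          have "z \<in> B" using that(1,3) ed(2) XW by blast
          then show ?thesis using that(2) by (auto simp: between_def N_def)
        qed
        show ?thesis using kinds[OF ed(1)]
        proof (elim disjE)
          assume gW: "g ed \<subseteq> W"
          then have "g ed \<subseteq> B" using ed(2) inW[OF gW] XW by blast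
          then show ?thesis using ed(3) by (auto simp: edges_in_def)
        next
          assume "ed = e0"
          moreover have "a \<notin> B" "b \<notin> B" using B aW by auto
          ultimately show ?thesis using ed(2) g'0 X'(1) by auto
        next
          assume "ed \<in> C1" then show ?thesis using C1[of ed] bt by blast
        next
          assume "ed \<in> C2" then show ?thesis using C2[of ed] bt by blast
        qed
      qed
      have finU: "finite ?U" using fin(2) by (simp add: finite_edges_in finite_between)
      have cU: "card ?U \<le> card (edges_in E g B) + card (between E g B FA)" by (rule card_Un_le)
      let ?n = "if X' = {a, b} then 1 else (0::nat)"
      have "edges_in E' g' (B \<union> X') \<subseteq> (if X' = {a, b} then insert e0 ?U else ?U)"
      proof
        fix ed assume "ed \<in> edges_in E' g' (B \<union> X')"
        from cov[OF this] show "ed \<in> (if X' = {a, b} then insert e0 ?U else ?U)" by auto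
      qed
      then have "card (edges_in E' g' (B \<union> X')) \<le> card (if X' = {a, b} then insert e0 ?U else ?U)"
        using finU by (intro card_mono) auto
      also have "\<dots> \<le> card ?U + ?n" using finU by (simp add: card_insert_if)
      finally have "card (edges_in E' g' (B \<union> X')) \<le> card (edges_in E g B) + card (between E g B FA) + ?n" using cU by linarith
      then have "int (card (edges_in E' g' (B \<union> X'))) \<le> int (card (edges_in E g B)) + int (card (between E g B FA)) + int ?n" by linarith
      then have le: "\<epsilon> * int (card (edges_in E' g' (B \<union> X'))) \<le> \<epsilon> * (int (card (edges_in E g B)) + int (card (between E g B FA)) + int ?n)"
        using eps by (intro mult_left_mono) auto
      have cX: "card X' = 1 + ?n"
      proof -
        have "X' = {a} \<or> X' = {b} \<or> X' = {a, b}" using X' by blast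
        then show ?thesis using ab(2) by (auto simp: doubleton_eq_iff)
      qed
      show "\<epsilon> - 2 - \<epsilon> * int (card (edges_in E g B)) - \<epsilon> * int (card (between E g B FA))
         \<le> (\<epsilon> - 1) * int (card X') - \<epsilon> * int (card (edges_in E' g' (B \<union> X')))"
        using le unfolding cX by (cases "X' = {a, b}") (simp_all add: algebra_simps)
    qed
  qed
  ultimately show ?thesis by blast
qed

section \<open>The two coloring conditions\<close>

definition degree_bounded :: "nat \<Rightarrow> 'e set \<Rightarrow> ('e \<Rightarrow> 'v set) \<Rightarrow> ('v \<Rightarrow> nat) \<Rightarrow> 'v set \<Rightarrow> bool" where
  "degree_bounded D E g w M \<longleftrightarrow> (\<forall>v\<in>M. w v + card {u\<in>M. \<exists>ed\<in>E. g ed = {v, u}} \<le> D + 1)"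

text \<open>Raising a weight by \<open>D + 2\<close> violates every bound, so the last two disjuncts are vacuous in the join lemma.\<close>

definition degree_comb :: "nat \<Rightarrow> nat \<Rightarrow> nat \<Rightarrow> bool" where
  "degree_comb D ky kz \<longleftrightarrow> 1 \<le> ky \<and> 1 \<le> kz \<or> ky = D + 2 \<or> kz = D + 2"

lemma degree_bounded_mono:
  assumes M: "degree_bounded D E g w M" "finite M" "M' \<subseteq> M"
    and e: "\<And>ed. ed \<in> E' \<Longrightarrow> g' ed \<subseteq> M' \<Longrightarrow> ed \<in> E \<and> g ed = g' ed"
    and w: "\<And>v. v \<in> M' \<Longrightarrow> w' v \<le> w v"
  shows "degree_bounded D E' g' w' M'"
  unfolding degree_bounded_def
proof
  fix v assume v: "v \<in> M'"
  have "{u\<in>M'. \<exists>ed\<in>E'. g' ed = {v, u}} \<subseteq> {u\<in>M. \<exists>ed\<in>E. g ed = {v, u}}"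
  proof
    fix u assume "u \<in> {u\<in>M'. \<exists>ed\<in>E'. g' ed = {v, u}}"
    then obtain ed where u: "u \<in> M'" "ed \<in> E'" "g' ed = {v, u}" by blast
    then have "g' ed \<subseteq> M'" using v by auto
    from e[OF u(2) this] show "u \<in> {u\<in>M. \<exists>ed\<in>E. g ed = {v, u}}" using u M(3) by auto
  qed
  then have "card {u\<in>M'. \<exists>ed\<in>E'. g' ed = {v, u}} \<le> card {u\<in>M. \<exists>ed\<in>E. g ed = {v, u}}"
    using M(2) by (intro card_mono) auto
  moreover have "w v + card {u\<in>M. \<exists>ed\<in>E. g ed = {v, u}} \<le> D + 1"
    using M(1,3) v by (auto simp: degree_bounded_def)
  ultimately show "w' v + card {u\<in>M'. \<exists>ed\<in>E'. g' ed = {v, u}} \<le> D + 1" using w[OF v] by linarith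
qed

lemma degree_bounded_single:
  assumes "\<And>ed. ed \<in> E \<Longrightarrow> card (g ed) = 2" "w v \<le> D + 1"
  shows "degree_bounded D E g w {v}"
proof -
  have "{u\<in>{v}. \<exists>ed\<in>E. g ed = {v, u}} = {}" using assms(1) by force
  then have c: "card {u\<in>{v}. \<exists>ed\<in>E. g ed = {v, u}} = 0" by (simp only: card.empty)
  show ?thesis unfolding degree_bounded_def
  proof
    fix x assume "x \<in> {v}"
    then have x: "x = v" by simp
    show "w x + card {u\<in>{v}. \<exists>ed\<in>E. g ed = {x, u}} \<le> D + 1" unfolding x c using assms(2) by simp
  qed
qed

lemma degree_bounded_union:
  assumes M: "M1 \<inter> M2 = {}" "degree_bounded D E g w M1" "degree_bounded D E g w M2"
    and e: "\<And>ed. ed \<in> E \<Longrightarrow> g ed \<subseteq> M1 \<union> M2 \<Longrightarrow> g ed \<subseteq> M1 \<or> g ed \<subseteq> M2"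
  shows "degree_bounded D E g w (M1 \<union> M2)"
proof -
  have eq: "{u\<in>M1 \<union> M2. \<exists>ed\<in>E. g ed = {v, u}} = {u\<in>N. \<exists>ed\<in>E. g ed = {v, u}}" if N: "N = M1 \<or> N = M2" "v \<in> N" for v N
  proof (intro equalityI subsetI)
    fix u assume "u \<in> {u\<in>M1 \<union> M2. \<exists>ed\<in>E. g ed = {v, u}}"
    then obtain ed where u: "u \<in> M1 \<union> M2" "ed \<in> E" "g ed = {v, u}" by blast
    then have "g ed \<subseteq> M1 \<or> g ed \<subseteq> M2" using e[OF u(2)] N by auto
    then show "u \<in> {u\<in>N. \<exists>ed\<in>E. g ed = {v, u}}" using u N M(1) by auto
  qed (use N in auto)
  show ?thesis
    unfolding degree_bounded_def
  proof
    fix v assume "v \<in> M1 \<union> M2"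
    then show "w v + card {u\<in>M1 \<union> M2. \<exists>ed\<in>E. g ed = {v, u}} \<le> D + 1"
    proof
      assume v: "v \<in> M1"
      show ?thesis unfolding eq[OF disjI1[OF refl] v] using M(2) v by (simp add: degree_bounded_def)
    next
      assume v: "v \<in> M2"
      show ?thesis unfolding eq[OF disjI2[OF refl] v] using M(3) v by (simp add: degree_bounded_def)
    qed
  qed
qed

lemma degree_bounded_join:
  assumes M: "finite M1" "finite M2" "M1 \<inter> M2 = {}" and yz: "y \<in> M1" "z \<in> M2" and k: "degree_comb D ky kz"
    and g: "degree_bounded D E g (w(y := w y + ky)) M1" "degree_bounded D E g (w(z := w z + kz)) M2"
    and e: "\<And>ed. ed \<in> E \<Longrightarrow> g ed \<subseteq> M1 \<union> M2 \<Longrightarrow> g ed \<subseteq> M1 \<or> g ed \<subseteq> M2 \<or> g ed = {y, z}"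
  shows "degree_bounded D E g w (M1 \<union> M2)"
proof -
  have half: "w v + card {u\<in>N1 \<union> N2. \<exists>ed\<in>E. g ed = {v, u}} \<le> D + 1"
    if N: "finite N1" "N1 \<inter> N2 = {}" "y \<in> N1" "z \<in> N2" "1 \<le> ky" "degree_bounded D E g (w(y := w y + ky)) N1" "v \<in> N1"
      and e: "\<And>ed. ed \<in> E \<Longrightarrow> g ed \<subseteq> N1 \<union> N2 \<Longrightarrow> g ed \<subseteq> N1 \<or> g ed \<subseteq> N2 \<or> g ed = {y, z}"
    for v N1 N2 y z ky
  proof -
    let ?n = "{u\<in>N1. \<exists>ed\<in>E. g ed = {v, u}}"
    have sub: "{u\<in>N1 \<union> N2. \<exists>ed\<in>E. g ed = {v, u}} \<subseteq> ?n \<union> (if v = y then {z} else {})"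
    proof
      fix u assume "u \<in> {u\<in>N1 \<union> N2. \<exists>ed\<in>E. g ed = {v, u}}"
      then obtain ed where u: "u \<in> N1 \<union> N2" "ed \<in> E" "g ed = {v, u}" by blast
      then have "g ed \<subseteq> N1 \<or> g ed \<subseteq> N2 \<or> g ed = {y, z}" using e[OF u(2)] N(7) by auto
      moreover have "\<not> g ed \<subseteq> N2" "v \<noteq> z" using u(3) N by auto
      ultimately show "u \<in> ?n \<union> (if v = y then {z} else {})" using u by (auto simp: doubleton_eq_iff)
    qed
    have "card {u\<in>N1 \<union> N2. \<exists>ed\<in>E. g ed = {v, u}} \<le> card (?n \<union> (if v = y then {z} else {}))"
      using N(1) by (intro card_mono[OF _ sub]) auto
    also have "\<dots> \<le> card ?n + card (if v = y then {z} else {})" by (rule card_Un_le)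
    finally have "card {u\<in>N1 \<union> N2. \<exists>ed\<in>E. g ed = {v, u}} \<le> card ?n + (if v = y then 1 else 0)" by (simp split: if_splits)
    moreover have "(w(y := w y + ky)) v + card ?n \<le> D + 1" using N(6,7) by (simp add: degree_bounded_def)
    ultimately show ?thesis using N(5) by (auto split: if_splits)
  qed
  have "w y + ky \<le> D + 1" "w z + kz \<le> D + 1" using g yz by (fastforce simp: degree_bounded_def)+
  then have k1: "1 \<le> ky" "1 \<le> kz" using k by (auto simp: degree_comb_def)
  show ?thesis
    unfolding degree_bounded_def
  proof
    fix v assume "v \<in> M1 \<union> M2"
    then show "w v + card {u\<in>M1 \<union> M2. \<exists>ed\<in>E. g ed = {v, u}} \<le> D + 1"
    proof
      assume v: "v \<in> M1"
      show ?thesis by (rule half[OF M(1,3) yz k1(1) g(1) v e])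
    next
      assume v: "v \<in> M2"
      have M21: "M2 \<inter> M1 = {}" using M(3) by auto
      have e': "g ed \<subseteq> M2 \<or> g ed \<subseteq> M1 \<or> g ed = {z, y}" if "ed \<in> E" "g ed \<subseteq> M2 \<union> M1" for ed
        using e[OF that(1)] that(2) by (auto simp: Un_commute insert_commute)
      have "w v + card {u\<in>M2 \<union> M1. \<exists>ed\<in>E. g ed = {v, u}} \<le> D + 1"
        by (rule half[OF M(2) M21 yz(2,1) k1(2) g(2) v e'])
      then show ?thesis by (simp only: Un_commute)
    qed
  qed
qed

definition adj :: "'e set \<Rightarrow> ('e \<Rightarrow> 'v set) \<Rightarrow> 'v set \<Rightarrow> ('v \<times> 'v) set" where
  "adj E g M = {(u, v). u \<in> M \<and> v \<in> M \<and> (\<exists>ed\<in>E. g ed = {u, v})}"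

definition reach :: "'e set \<Rightarrow> ('e \<Rightarrow> 'v set) \<Rightarrow> 'v set \<Rightarrow> 'v \<Rightarrow> 'v set" where
  "reach E g M v = {u. (v, u) \<in> (adj E g M)\<^sup>*}"

definition weight_bounded :: "nat \<Rightarrow> 'e set \<Rightarrow> ('e \<Rightarrow> 'v set) \<Rightarrow> ('v \<Rightarrow> nat) \<Rightarrow> 'v set \<Rightarrow> bool" where
  "weight_bounded D E g w M \<longleftrightarrow> (\<forall>v\<in>M. (\<Sum>u\<in>reach E g M v. w u) \<le> D + 1)"

lemma reach_sub: "v \<in> M \<Longrightarrow> reach E g M v \<subseteq> M"
proof
  fix u assume v: "v \<in> M" and "u \<in> reach E g M v"
  then have "(v, u) \<in> (adj E g M)\<^sup>*" by (simp add: reach_def)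
  then show "u \<in> M" by (induction rule: rtrancl_induct) (auto simp: v adj_def)
qed

lemma reach_self: "v \<in> reach E g M v"
  by (simp add: reach_def)

lemma reach_step: "u \<in> reach E g M v \<Longrightarrow> (u, u') \<in> adj E g M \<Longrightarrow> u' \<in> reach E g M v"
  unfolding reach_def by (auto intro: rtrancl_into_rtrancl)

lemma weight_bounded_mono:
  assumes M: "weight_bounded D E g w M" "finite M" "M' \<subseteq> M"
    and e: "\<And>ed. ed \<in> E' \<Longrightarrow> g' ed \<subseteq> M' \<Longrightarrow> ed \<in> E \<and> g ed = g' ed"
    and w: "\<And>v. v \<in> M' \<Longrightarrow> w' v \<le> w v"
  shows "weight_bounded D E' g' w' M'"
  unfolding weight_bounded_def
proof
  fix v assume v: "v \<in> M'"
  have "adj E' g' M' \<subseteq> adj E g M"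
  proof
    fix p assume "p \<in> adj E' g' M'"
    then obtain x y ed where p: "p = (x, y)" "x \<in> M'" "y \<in> M'" "ed \<in> E'" "g' ed = {x, y}" by (auto simp: adj_def)
    then have "g' ed \<subseteq> M'" by auto
    from e[OF p(4) this] show "p \<in> adj E g M" using p M(3) by (auto simp: adj_def)
  qed
  then have sub: "reach E' g' M' v \<subseteq> reach E g M v" unfolding reach_def using rtrancl_mono by blast
  have fin: "finite (reach E g M v)" using reach_sub[of v M] v M(2,3) finite_subset by blast
  have "(\<Sum>u\<in>reach E' g' M' v. w' u) \<le> (\<Sum>u\<in>reach E' g' M' v. w u)"
    using w reach_sub[OF v] by (intro sum_mono) blast
  also have "\<dots> \<le> (\<Sum>u\<in>reach E g M v. w u)" by (rule sum_mono2[OF fin sub]) simp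
  also have "\<dots> \<le> D + 1" using M v by (auto simp: weight_bounded_def)
  finally show "(\<Sum>u\<in>reach E' g' M' v. w' u) \<le> D + 1" .
qed

lemma weight_bounded_vertex:
  assumes "weight_bounded D E g w M" "finite M" "v \<in> M"
  shows "w v \<le> D + 1"
proof -
  have "finite (reach E g M v)" using reach_sub[OF assms(3)] assms(2) by (rule finite_subset)
  then have "w v \<le> (\<Sum>u\<in>reach E g M v. w u)" using reach_self by (intro member_le_sum) auto
  then show ?thesis using assms(1,3) by (force simp: weight_bounded_def)
qed

lemma weight_bounded_single:
  assumes "\<And>ed. ed \<in> E \<Longrightarrow> card (g ed) = 2" "w v \<le> D + 1"
  shows "weight_bounded D E g w {v}"
proof -
  have "adj E g {v} = {}" using assms(1) by (force simp: adj_def)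
  then show ?thesis using assms(2) by (simp add: weight_bounded_def reach_def)
qed

lemma reach_join:
  assumes N: "N1 \<inter> N2 = {}" "y \<in> N1" "z \<in> N2" "v \<in> N1"
    and e: "\<And>ed. ed \<in> E \<Longrightarrow> g ed \<subseteq> N1 \<union> N2 \<Longrightarrow> g ed \<subseteq> N1 \<or> g ed \<subseteq> N2 \<or> g ed = {y, z}"
  shows "reach E g (N1 \<union> N2) v \<subseteq> reach E g N1 v \<union> (if y \<in> reach E g N1 v then reach E g N2 z else {})"
proof
  fix u assume "u \<in> reach E g (N1 \<union> N2) v"
  then have "(v, u) \<in> (adj E g (N1 \<union> N2))\<^sup>*" by (simp add: reach_def)
  then show "u \<in> reach E g N1 v \<union> (if y \<in> reach E g N1 v then reach E g N2 z else {})"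
  proof (induction rule: rtrancl_induct)
    case base
    show ?case by (rule UnI1[OF reach_self])
  next
    case (step a b)
    obtain ed where ed: "ed \<in> E" "g ed = {a, b}" "a \<in> N1 \<union> N2" "b \<in> N1 \<union> N2" using step(2) by (auto simp: adj_def)
    then have k: "g ed \<subseteq> N1 \<or> g ed \<subseteq> N2 \<or> g ed = {y, z}" using e[OF ed(1)] by auto
    have r1: "reach E g N1 v \<subseteq> N1" "reach E g N2 z \<subseteq> N2" using reach_sub[OF N(4)] reach_sub[OF N(3)] by blast+
    show ?case
    proof (cases "a \<in> reach E g N1 v")
      case True
      then have a: "a \<in> N1" "a \<notin> N2" using r1 N(1) by auto
      show ?thesis
      proof (cases "b \<in> N1")
        case b: True
        then have "(a, b) \<in> adj E g N1" using a ed by (auto simp: adj_def)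
        then show ?thesis using reach_step[OF True] by blast
      next
        case False
        then have "{a, b} = {y, z}" using k ed(2) a by auto
        then have "a = y" "b = z" using a N(3) by (auto simp: doubleton_eq_iff)
        then show ?thesis using True reach_self[of z E g N2] by simp
      qed
    next
      case False
      then have P: "y \<in> reach E g N1 v" and az: "a \<in> reach E g N2 z" using step.IH by (auto split: if_splits)
      then have a: "a \<in> N2" "a \<notin> N1" using r1 N(1) by auto
      show ?thesis
      proof (cases "b \<in> N2")
        case b: True
        then have "(a, b) \<in> adj E g N2" using a ed by (auto simp: adj_def)
        then show ?thesis using reach_step[OF az] P by simp
      next
        case False
        then have "{a, b} = {y, z}" using k ed(2) a by auto
        then have "b = y" using a N(2) by (auto simp: doubleton_eq_iff)
        then show ?thesis using P by simp
      qed
    qed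
  qed
qed

lemma weight_bounded_union:
  assumes M: "finite M1" "finite M2" "M1 \<inter> M2 = {}" "weight_bounded D E g w M1" "weight_bounded D E g w M2"
    and e: "\<And>ed. ed \<in> E \<Longrightarrow> g ed \<subseteq> M1 \<union> M2 \<Longrightarrow> g ed \<subseteq> M1 \<or> g ed \<subseteq> M2"
  shows "weight_bounded D E g w (M1 \<union> M2)"
proof -
  have half: "(\<Sum>u\<in>reach E g (N1 \<union> N2) v. w u) \<le> D + 1"
    if N: "finite N1" "N1 \<inter> N2 = {}" "weight_bounded D E g w N1" "v \<in> N1"
      and e: "\<And>ed. ed \<in> E \<Longrightarrow> g ed \<subseteq> N1 \<union> N2 \<Longrightarrow> g ed \<subseteq> N1 \<or> g ed \<subseteq> N2" for v N1 N2
  proof -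
    have ind: "b \<in> reach E g N1 v" if "(v, b) \<in> (adj E g (N1 \<union> N2))\<^sup>*" for b
      using that
    proof (induction rule: rtrancl_induct)
      case base
      then show ?case by (rule reach_self)
    next
      case (step a b)
      obtain ed where ed: "ed \<in> E" "g ed = {a, b}" "a \<in> N1 \<union> N2" "b \<in> N1 \<union> N2" using step(2) by (auto simp: adj_def)
      have "a \<in> N1" using step.IH reach_sub[OF N(4)] by blast
      then have "g ed \<subseteq> N1" using e[OF ed(1)] ed N(2) by auto
      then have "(a, b) \<in> adj E g N1" using ed by (auto simp: adj_def)
      then show ?case using reach_step[OF step.IH] by blast
    qed
    have "reach E g (N1 \<union> N2) v \<subseteq> reach E g N1 v" using ind unfolding reach_def by blast
    moreover have "finite (reach E g N1 v)" using reach_sub[OF N(4)] N(1) by (rule finite_subset)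
    ultimately have "(\<Sum>u\<in>reach E g (N1 \<union> N2) v. w u) \<le> (\<Sum>u\<in>reach E g N1 v. w u)" by (intro sum_mono2) auto
    then show ?thesis using N(3,4) by (force simp: weight_bounded_def)
  qed
  show ?thesis
    unfolding weight_bounded_def
  proof
    fix v assume "v \<in> M1 \<union> M2"
    then show "(\<Sum>u\<in>reach E g (M1 \<union> M2) v. w u) \<le> D + 1"
    proof
      assume v: "v \<in> M1"
      show ?thesis by (rule half[OF M(1,3,4) v e])
    next
      assume v: "v \<in> M2"
      have M21: "M2 \<inter> M1 = {}" using M(3) by auto
      have e': "g ed \<subseteq> M2 \<or> g ed \<subseteq> M1" if "ed \<in> E" "g ed \<subseteq> M2 \<union> M1" for ed
        using e[OF that(1)] that(2) by auto
      have "(\<Sum>u\<in>reach E g (M2 \<union> M1) v. w u) \<le> D + 1" by (rule half[OF M(2) M21 M(5) v e'])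
      then show ?thesis by (simp only: Un_commute)
    qed
  qed
qed

lemma weight_bounded_join:
  assumes M: "finite M1" "finite M2" "M1 \<inter> M2 = {}" and yz: "y \<in> M1" "z \<in> M2" and k: "D + 1 \<le> ky + kz"
    and g: "weight_bounded D E g (w(y := w y + ky)) M1" "weight_bounded D E g (w(z := w z + kz)) M2"
    and e: "\<And>ed. ed \<in> E \<Longrightarrow> g ed \<subseteq> M1 \<union> M2 \<Longrightarrow> g ed \<subseteq> M1 \<or> g ed \<subseteq> M2 \<or> g ed = {y, z}"
  shows "weight_bounded D E g w (M1 \<union> M2)"
proof -
  have raised: "(\<Sum>u\<in>reach E g N v. w u) + (if y \<in> reach E g N v then ky else 0) \<le> D + 1"
    if N: "finite N" "v \<in> N" "weight_bounded D E g (w(y := w y + ky)) N" for N v y ky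
  proof -
    have fin: "finite (reach E g N v)" using reach_sub[OF N(2)] N(1) by (rule finite_subset)
    have "(w(y := w y + ky)) u = w u + (if u = y then ky else 0)" for u by simp
    then have "(\<Sum>u\<in>reach E g N v. (w(y := w y + ky)) u) = (\<Sum>u\<in>reach E g N v. w u) + (\<Sum>u\<in>reach E g N v. if u = y then ky else 0)"
      by (simp only: sum.distrib)
    moreover have "(\<Sum>u\<in>reach E g N v. if u = y then ky else 0) = (if y \<in> reach E g N v then ky else 0)"
      using fin by (simp add: sum.delta')
    moreover have "(\<Sum>u\<in>reach E g N v. (w(y := w y + ky)) u) \<le> D + 1"
      using N(2,3) unfolding weight_bounded_def by blast
    ultimately show ?thesis by linarith
  qed
  have half: "(\<Sum>u\<in>reach E g (N1 \<union> N2) v. w u) \<le> D + 1"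
    if N: "finite N1" "finite N2" "N1 \<inter> N2 = {}" "y \<in> N1" "z \<in> N2" "D + 1 \<le> ky + kz" "v \<in> N1"
      "weight_bounded D E g (w(y := w y + ky)) N1" "weight_bounded D E g (w(z := w z + kz)) N2"
      and e: "\<And>ed. ed \<in> E \<Longrightarrow> g ed \<subseteq> N1 \<union> N2 \<Longrightarrow> g ed \<subseteq> N1 \<or> g ed \<subseteq> N2 \<or> g ed = {y, z}"
    for v N1 N2 y z ky kz
  proof -
    let ?Y = "reach E g N1 v" and ?Z = "reach E g N2 z"
    let ?U = "?Y \<union> (if y \<in> ?Y then ?Z else {})"
    have sub: "reach E g (N1 \<union> N2) v \<subseteq> ?U"
      by (rule reach_join[OF N(3-5,7) e])
    have fin: "finite ?Y" "finite ?Z"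
      using finite_subset[OF reach_sub[OF N(7)] N(1)] finite_subset[OF reach_sub[OF N(5)] N(2)] by blast+
    have "(\<Sum>u\<in>reach E g (N1 \<union> N2) v. w u) \<le> (\<Sum>u\<in>?U. w u)" using fin by (intro sum_mono2[OF _ sub]) auto
    also have "\<dots> \<le> (\<Sum>u\<in>?Y. w u) + (\<Sum>u\<in>(if y \<in> ?Y then ?Z else {}). w u)"
      using fin by (simp add: sum_Un_nat)
    finally have le: "(\<Sum>u\<in>reach E g (N1 \<union> N2) v. w u) \<le> (\<Sum>u\<in>?Y. w u) + (\<Sum>u\<in>(if y \<in> ?Y then ?Z else {}). w u)" .
    have "(\<Sum>u\<in>?Z. w u) + kz \<le> D + 1" using raised[OF N(2,5,9)] reach_self[of z E g N2] by simp
    then show ?thesis using le raised[OF N(1,7,8)] N(6) by (auto split: if_splits)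
  qed
  show ?thesis
    unfolding weight_bounded_def
  proof
    fix v assume "v \<in> M1 \<union> M2"
    then show "(\<Sum>u\<in>reach E g (M1 \<union> M2) v. w u) \<le> D + 1"
    proof
      assume v: "v \<in> M1"
      show ?thesis by (rule half[OF M yz k v g e])
    next
      assume v: "v \<in> M2"
      have M21: "M2 \<inter> M1 = {}" using M(3) by auto
      have k': "D + 1 \<le> kz + ky" using k by simp
      have e': "g ed \<subseteq> M2 \<or> g ed \<subseteq> M1 \<or> g ed = {z, y}" if "ed \<in> E" "g ed \<subseteq> M2 \<union> M1" for ed
        using e[OF that(1)] that(2) by (auto simp: Un_commute insert_commute)
      have "(\<Sum>u\<in>reach E g (M2 \<union> M1) v. w u) \<le> D + 1" by (rule half[OF M(2,1) M21 yz(2,1) k' v g(2,1) e'])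
      then show ?thesis by (simp only: Un_commute)
    qed
  qed
qed

lemma good_scheme_degree: "good_scheme D (degree_bounded D) (degree_comb D)"
proof (rule good_scheme.intro)
  show "degree_comb D 0 (D + 2)" by (simp add: degree_comb_def)
  show "degree_bounded D E' g' w' M'"
    if "degree_bounded D E g w M" "finite M" "M' \<subseteq> M" "\<And>ed. ed \<in> E' \<Longrightarrow> g' ed \<subseteq> M' \<Longrightarrow> ed \<in> E \<and> g ed = g' ed" "\<And>v. v \<in> M' \<Longrightarrow> w' v \<le> w v"
    for E E' :: "'e set" and g g' :: "'e \<Rightarrow> 'v set" and w w' M M' by (rule degree_bounded_mono[OF that])
  show "w v \<le> D + 1" if "degree_bounded D E g w M" "v \<in> M" for E :: "'e set" and g :: "'e \<Rightarrow> 'v set" and w M v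
    using that by (force simp: degree_bounded_def)
  show "degree_bounded D E g w {v}" if "\<And>ed. ed \<in> E \<Longrightarrow> card (g ed) = 2" "w v \<le> D + 1"
    for E :: "'e set" and g :: "'e \<Rightarrow> 'v set" and w v by (rule degree_bounded_single[of E g w v D, OF that])
  show "degree_bounded D E g w {}" for E :: "'e set" and g :: "'e \<Rightarrow> 'v set" and w by (simp add: degree_bounded_def)
  show "degree_bounded D E g w (M1 \<union> M2)"
    if "finite M1" "finite M2" "M1 \<inter> M2 = {}" "degree_bounded D E g w M1" "degree_bounded D E g w M2"
      "\<And>ed. ed \<in> E \<Longrightarrow> g ed \<subseteq> M1 \<union> M2 \<Longrightarrow> g ed \<subseteq> M1 \<or> g ed \<subseteq> M2"
    for E :: "'e set" and g :: "'e \<Rightarrow> 'v set" and w M1 M2 by (rule degree_bounded_union[OF that(3-6)])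
  show "degree_bounded D E g w (M1 \<union> M2)"
    if "finite M1" "finite M2" "M1 \<inter> M2 = {}" "y \<in> M1" "z \<in> M2" "degree_comb D ky kz"
      "degree_bounded D E g (w(y := w y + ky)) M1" "degree_bounded D E g (w(z := w z + kz)) M2"
      "\<And>ed. ed \<in> E \<Longrightarrow> g ed \<subseteq> M1 \<union> M2 \<Longrightarrow> g ed \<subseteq> M1 \<or> g ed \<subseteq> M2 \<or> g ed = {y, z}"
    for E :: "'e set" and g :: "'e \<Rightarrow> 'v set" and w M1 M2 y z ky kz by (rule degree_bounded_join[OF that])
qed

lemma good_scheme_weight: "good_scheme D (weight_bounded D) (\<lambda>a b. D + 1 \<le> a + b)"
proof (rule good_scheme.intro)
  show "D + 1 \<le> 0 + (D + 2)" by simp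
  show "weight_bounded D E' g' w' M'"
    if "weight_bounded D E g w M" "finite M" "M' \<subseteq> M" "\<And>ed. ed \<in> E' \<Longrightarrow> g' ed \<subseteq> M' \<Longrightarrow> ed \<in> E \<and> g ed = g' ed" "\<And>v. v \<in> M' \<Longrightarrow> w' v \<le> w v"
    for E E' :: "'e set" and g g' :: "'e \<Rightarrow> 'v set" and w w' M M' by (rule weight_bounded_mono[OF that])
  show "w v \<le> D + 1" if "weight_bounded D E g w M" "finite M" "v \<in> M" for E :: "'e set" and g :: "'e \<Rightarrow> 'v set" and w M v
    by (rule weight_bounded_vertex[OF that])
  show "weight_bounded D E g w {v}" if "\<And>ed. ed \<in> E \<Longrightarrow> card (g ed) = 2" "w v \<le> D + 1"
    for E :: "'e set" and g :: "'e \<Rightarrow> 'v set" and w v by (rule weight_bounded_single[of E g w v D, OF that])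
  show "weight_bounded D E g w {}" for E :: "'e set" and g :: "'e \<Rightarrow> 'v set" and w by (simp add: weight_bounded_def)
  show "weight_bounded D E g w (M1 \<union> M2)"
    if "finite M1" "finite M2" "M1 \<inter> M2 = {}" "weight_bounded D E g w M1" "weight_bounded D E g w M2"
      "\<And>ed. ed \<in> E \<Longrightarrow> g ed \<subseteq> M1 \<union> M2 \<Longrightarrow> g ed \<subseteq> M1 \<or> g ed \<subseteq> M2"
    for E :: "'e set" and g :: "'e \<Rightarrow> 'v set" and w M1 M2 by (rule weight_bounded_union[OF that])
  show "weight_bounded D E g w (M1 \<union> M2)"
    if "finite M1" "finite M2" "M1 \<inter> M2 = {}" "y \<in> M1" "z \<in> M2" "D + 1 \<le> ky + kz"
      "weight_bounded D E g (w(y := w y + ky)) M1" "weight_bounded D E g (w(z := w z + kz)) M2"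
      "\<And>ed. ed \<in> E \<Longrightarrow> g ed \<subseteq> M1 \<union> M2 \<Longrightarrow> g ed \<subseteq> M1 \<or> g ed \<subseteq> M2 \<or> g ed = {y, z}"
    for E :: "'e set" and g :: "'e \<Rightarrow> 'v set" and w M1 M2 y z ky kz by (rule weight_bounded_join[OF that])
qed

lemma potential_scheme_multi:
  assumes "f (D + 2) = \<epsilon> - 1" "\<And>n. 1 \<le> n \<Longrightarrow> n \<le> D + 2 \<Longrightarrow> \<epsilon> - 1 \<le> f n \<and> f n \<le> 2 * \<epsilon> - 1"
    "\<And>n k. 1 \<le> n \<Longrightarrow> n \<le> D + 2 \<Longrightarrow> f n - f (min (n + k) (D + 2)) \<le> h k" "\<And>k. 0 \<le> h k" "h (D + 2) \<le> \<epsilon>"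
    "2 \<le> \<epsilon>" "2 \<le> \<tau>" "gmax \<le> \<epsilon> - 1"
  shows "potential_scheme D \<epsilon> \<tau> gmax (\<epsilon> - 1) f h (\<lambda>_ _ _. True) (\<lambda>_ _ A. 2 \<le> card A)"
proof (rule potential_scheme.intro)
  show "\<exists>X E' g'. contraction \<epsilon> (\<epsilon> - 1) V E g A FA X E' g' \<and> True"
    if "wf_graph V E g" "A \<subseteq> V" "2 \<le> card A" "FA \<subseteq> A" for V E g A FA
    using contraction_multi[OF that, of \<epsilon>] assms(6) by simp
qed (use assms in auto)

lemma potential_scheme_simple:
  assumes "f (D + 2) = \<epsilon> - 1" and f: "\<And>n. 1 \<le> n \<Longrightarrow> n \<le> D + 2 \<Longrightarrow> \<epsilon> - 1 \<le> f n \<and> f n \<le> 2 * \<epsilon> - 1"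
    and "\<And>n k. 1 \<le> n \<Longrightarrow> n \<le> D + 2 \<Longrightarrow> f n - f (min (n + k) (D + 2)) \<le> h k" "\<And>k. 0 \<le> h k" "h (D + 2) \<le> \<epsilon>"
    and eps: "2 \<le> \<epsilon>" and "2 \<le> \<tau>" and gm: "gmax < \<epsilon> - 2"
  shows "potential_scheme D \<epsilon> \<tau> gmax (\<epsilon> - 2) f h (\<lambda>_ E g. inj_on g E) (\<lambda>E g A. 3 \<le> card A \<and> (\<exists>ed\<in>E. g ed \<subseteq> A))"
proof (rule potential_scheme.intro)
  show "\<exists>X E' g'. contraction \<epsilon> (\<epsilon> - 2) V E g A FA X E' g' \<and> inj_on g' E'"
    if "wf_graph V E g" "inj_on g E" "A \<subseteq> V" "3 \<le> card A \<and> (\<exists>ed\<in>E. g ed \<subseteq> A)" "FA \<subseteq> A" for V E g A FA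
    using contraction_simple[OF that(1-3) _ _ _ that(5), of _ \<epsilon>] that(4) eps by force
  show "3 \<le> card A \<and> (\<exists>ed\<in>E. g ed \<subseteq> A)"
    if wf: "wf_graph V E g" and inj: "inj_on g E" and A: "A \<subseteq> V" "2 \<le> card A"
      and r: "\<forall>v\<in>V. 1 \<le> w v \<and> w v \<le> D + 2" and p: "pot \<epsilon> f E g w A \<le> gmax" for V E g A w
  proof -
    have fin: "finite A" using wf A(1) by (auto simp: wf_graph_def intro: finite_subset)
    have "(\<Sum>v\<in>A. \<epsilon> - 1) \<le> (\<Sum>v\<in>A. f (w v))" using f r A(1) by (intro sum_mono) blast
    then have s: "int (card A) * (\<epsilon> - 1) \<le> (\<Sum>v\<in>A. f (w v))" by simp
    have "2 * (\<epsilon> - 1) \<le> int (card A) * (\<epsilon> - 1)" using A(2) eps by (intro mult_right_mono) auto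
    then have s2: "2 * (\<epsilon> - 1) \<le> (\<Sum>v\<in>A. f (w v))" using s by linarith
    have ex: "edges_in E g A \<noteq> {}"
    proof
      assume "edges_in E g A = {}"
      then show False using s2 p gm eps by (simp add: pot_def)
    qed
    have "card A \<noteq> 2"
    proof
      assume c2: "card A = 2"
      have "g ed = A" if "ed \<in> edges_in E g A" for ed
        using that wf c2 fin by (intro card_subset_eq) (auto simp: edges_in_def wf_graph_def)
      then have "g ` edges_in E g A \<subseteq> {A}" by blast
      then have "card (g ` edges_in E g A) \<le> 1" using card_mono[of "{A}"] by fastforce
      moreover have "card (g ` edges_in E g A) = card (edges_in E g A)"
        by (rule card_image) (use inj in \<open>auto simp: edges_in_def inj_on_def\<close>)
      ultimately have "\<epsilon> * int (card (edges_in E g A)) \<le> \<epsilon> * 1" using eps by (intro mult_left_mono) auto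
      then show False using s2 p gm by (simp add: pot_def)
    qed
    then show ?thesis using A(2) ex by (auto simp: edges_in_def)
  qed
qed (use assms in \<open>auto intro: inj_on_subset\<close>)

section \<open>Weight functions\<close>

definition lin_f :: "int \<Rightarrow> nat \<Rightarrow> nat \<Rightarrow> int" where
  "lin_f q D n = q * (int D + 1) - 1 + q * (int D + 2 - int n)"

definition lin_h :: "int \<Rightarrow> nat \<Rightarrow> nat \<Rightarrow> int" where
  "lin_h q D k = q * int (min k (D + 1))"

lemma lin:
  assumes "1 \<le> q"
  shows "lin_f q D (D + 2) = q * (int D + 1) - 1"
    and "1 \<le> n \<Longrightarrow> n \<le> D + 2 \<Longrightarrow> q * (int D + 1) - 1 \<le> lin_f q D n \<and> lin_f q D n \<le> 2 * (q * (int D + 1)) - 1"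
    and "1 \<le> n \<Longrightarrow> n \<le> D + 2 \<Longrightarrow> lin_f q D n - lin_f q D (min (n + k) (D + 2)) \<le> lin_h q D k"
    and "0 \<le> lin_h q D k" and "lin_h q D (D + 2) \<le> q * (int D + 1)"
proof -
  show "lin_f q D (D + 2) = q * (int D + 1) - 1" by (simp add: lin_f_def)
  show "0 \<le> lin_h q D k" "lin_h q D (D + 2) \<le> q * (int D + 1)" using assms by (auto simp: lin_h_def algebra_simps)
  assume n: "1 \<le> n" "n \<le> D + 2"
  have "0 \<le> q * (int D + 2 - int n)" using assms n by (intro mult_nonneg_nonneg) auto
  moreover have "q * (int D + 2 - int n) \<le> q * (int D + 1)" using assms n by (intro mult_left_mono) auto
  ultimately show "q * (int D + 1) - 1 \<le> lin_f q D n \<and> lin_f q D n \<le> 2 * (q * (int D + 1)) - 1" by (simp add: lin_f_def)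
  have "q * (int (min (n + k) (D + 2)) - int n) \<le> q * int (min k (D + 1))" using assms n by (intro mult_left_mono) auto
  then show "lin_f q D n - lin_f q D (min (n + k) (D + 2)) \<le> lin_h q D k"
    unfolding lin_f_def lin_h_def by (simp only: right_diff_distrib)
qed

text \<open>
  The jump lies between capacities \<open>m\<close> and \<open>m + 1\<close> rather than \<open>m - 1\<close> and \<open>m\<close>, so that
  \<open>even_h m k + even_h m (2 * m + 1 - k) = 4 * m + 1\<close>; this only increases the potential.
\<close>

definition even_h :: "nat \<Rightarrow> nat \<Rightarrow> int" where
  "even_h m k = (if k \<le> m then 2 * int k else 2 * int (min k (2 * m + 1)) - 1)"

definition even_f :: "nat \<Rightarrow> nat \<Rightarrow> int" where
  "even_f m n = 4 * int m + even_h m (2 * m + 2 - n)"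

lemma even_weights:
  assumes "1 \<le> m"
  shows "even_f m (2 * m + 2) = 4 * int m + 1 - 1"
    and "1 \<le> n \<Longrightarrow> n \<le> 2 * m + 2 \<Longrightarrow> 4 * int m + 1 - 1 \<le> even_f m n \<and> even_f m n \<le> 2 * (4 * int m + 1) - 1"
    and "1 \<le> n \<Longrightarrow> n \<le> 2 * m + 2 \<Longrightarrow> even_f m n - even_f m (min (n + k) (2 * m + 2)) \<le> even_h m k"
    and "0 \<le> even_h m k" and "even_h m (2 * m + 2) \<le> 4 * int m + 1"
  using assms by (auto simp: even_f_def even_h_def min_def)

lemma forest_coloring_linear:
  assumes "2 \<le> D"
  shows "forest_coloring D (2 * (int D + 1)) 2 (2 * int D) (2 * (int D + 1) - 1) (lin_f 2 D) (lin_h 2 D)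
    (\<lambda>_ _ _. True) (\<lambda>_ _ A. 2 \<le> card A) (degree_bounded D) (degree_comb D)"
proof (rule forest_coloring.intro[OF potential_scheme_multi good_scheme_degree forest_coloring_axioms.intro])
  show "\<exists>ky kz. degree_comb D ky kz \<and> lin_h 2 D ky < \<gamma> + 2 \<and> lin_h 2 D kz \<le> 2 * (int D + 1) - \<gamma>" if "1 \<le> \<gamma>" "\<gamma> \<le> 2 * int D" for \<gamma>
    using that by (intro exI[of _ 1]) (auto simp: degree_comb_def lin_h_def)
qed (use lin[where q = 2 and D = D] in auto)

lemma forest_coloring_simple:
  assumes "2 \<le> D"
  shows "forest_coloring D (3 * (int D + 1)) 3 (3 * int D) (3 * (int D + 1) - 2) (lin_f 3 D) (lin_h 3 D)
    (\<lambda>_ E g. inj_on g E) (\<lambda>E g A. 3 \<le> card A \<and> (\<exists>ed\<in>E. g ed \<subseteq> A)) (degree_bounded D) (degree_comb D)"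
proof (rule forest_coloring.intro[OF potential_scheme_simple good_scheme_degree forest_coloring_axioms.intro])
  show "\<exists>ky kz. degree_comb D ky kz \<and> lin_h 3 D ky < \<gamma> + 3 \<and> lin_h 3 D kz \<le> 3 * (int D + 1) - \<gamma>" if "1 \<le> \<gamma>" "\<gamma> \<le> 3 * int D" for \<gamma>
    using that by (intro exI[of _ 1]) (auto simp: degree_comb_def lin_h_def)
qed (use lin[where q = 3 and D = D] in auto)

lemma lin_K:
  assumes "2 \<le> D" "q = 2 \<or> q = 3" "1 \<le> n" "n \<le> D + 1" "- 2 < 2 * lin_f q D n - 3 * (q * (int D + 1))"
  shows "\<exists>ky kz. degree_comb D ky kz \<and> n + kz \<le> D + 1 \<and> 2 * lin_h q D ky < q * int D + 1 + q \<and>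
    3 * lin_h q D ky < q * int D + 1 + q + 3 * (q * (int D + 1)) - lin_f q D n \<and> 3 * lin_h q D ky \<le> 3 * (q * (int D + 1)) - lin_f q D n"
  using assms by (intro exI[of _ 1]) (auto simp: degree_comb_def lin_h_def lin_f_def)

lemma odd_forest_coloringI:
  assumes g: "good_scheme D good comb" and H: "D + 1 = 2 * H" and c: "\<And>a b. 1 \<le> a \<Longrightarrow> 1 \<le> b \<Longrightarrow> a + b = 2 * H \<Longrightarrow> comb a b"
    and pick: "\<And>\<gamma>. 1 \<le> \<gamma> \<Longrightarrow> \<gamma> \<le> 2 * int D + 1 \<Longrightarrow>
      \<exists>ky kz. comb ky kz \<and> lin_h 2 D ky < \<gamma> + 2 \<and> lin_h 2 D kz \<le> 2 * (int D + 1) - \<gamma>"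
  shows "odd_forest_coloring D (2 * (int D + 1)) 2 (2 * int D + 1) (2 * (int D + 1) - 1) (lin_f 2 D) (lin_h 2 D)
    (\<lambda>_ _ _. True) (\<lambda>_ _ A. 2 \<le> card A) good comb H"
proof (rule odd_forest_coloring.intro)
  show "forest_coloring D (2 * (int D + 1)) 2 (2 * int D + 1) (2 * (int D + 1) - 1) (lin_f 2 D) (lin_h 2 D)
    (\<lambda>_ _ _. True) (\<lambda>_ _ A. 2 \<le> card A) good comb"
    by (rule forest_coloring.intro[OF potential_scheme_multi g forest_coloring_axioms.intro]) (use lin[where q = 2 and D = D] pick in auto)
  have "1 \<le> H" using H by linarith
  moreover have "int D + 1 = 2 * int H" using H by linarith
  ultimately show "odd_forest_coloring_axioms D (2 * (int D + 1)) 2 (2 * int D + 1) (2 * (int D + 1) - 1) (lin_f 2 D) (lin_h 2 D)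
    (\<lambda>_ _ _. True) (\<lambda>_ _ A. 2 \<le> card A) comb H"
    by (intro odd_forest_coloring_axioms.intro) (use c H in \<open>auto simp: lin_f_def lin_h_def\<close>)
qed

lemma odd_forest_coloring_degree:
  "odd_forest_coloring 1 (2 * (int 1 + 1)) 2 (2 * int 1 + 1) (2 * (int 1 + 1) - 1) (lin_f 2 1) (lin_h 2 1)
    (\<lambda>_ _ _. True) (\<lambda>_ _ A. 2 \<le> card A) (degree_bounded 1) (degree_comb 1) 1"
proof (rule odd_forest_coloringI[OF good_scheme_degree])
  fix \<gamma> :: int
  assume g: "1 \<le> \<gamma>" "\<gamma> \<le> 2 * int 1 + 1"
  show "\<exists>ky kz. degree_comb 1 ky kz \<and> lin_h 2 1 ky < \<gamma> + 2 \<and> lin_h 2 1 kz \<le> 2 * (int 1 + 1) - \<gamma>"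
  proof (cases "\<gamma> = 3")
    case True
    then show ?thesis by (intro exI[of _ 3] exI[of _ 0]) (simp add: degree_comb_def lin_h_def)
  next
    case False
    then show ?thesis using g by (intro exI[of _ 1]) (auto simp: degree_comb_def lin_h_def)
  qed
qed (auto simp: degree_comb_def)

lemma odd_forest_coloring_weight:
  assumes "D + 1 = 2 * H"
  shows "odd_forest_coloring D (2 * (int D + 1)) 2 (2 * int D + 1) (2 * (int D + 1) - 1) (lin_f 2 D) (lin_h 2 D)
    (\<lambda>_ _ _. True) (\<lambda>_ _ A. 2 \<le> card A) (weight_bounded D) (\<lambda>a b. D + 1 \<le> a + b) H"
proof (rule odd_forest_coloringI[OF good_scheme_weight assms])
  fix \<gamma> :: int
  assume g: "1 \<le> \<gamma>" "\<gamma> \<le> 2 * int D + 1"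
  define k where "k = nat ((\<gamma> + 1) div 2)"
  have "k \<le> D + 1" "\<gamma> \<le> 2 * int k" "2 * int k \<le> \<gamma> + 1" using g unfolding k_def by auto
  then show "\<exists>ky kz. D + 1 \<le> ky + kz \<and> lin_h 2 D ky < \<gamma> + 2 \<and> lin_h 2 D kz \<le> 2 * (int D + 1) - \<gamma>"
    by (intro exI[of _ k] exI[of _ "D + 1 - k"]) (auto simp: lin_h_def)
qed (use assms in auto)

lemma forest_coloring_even:
  assumes "1 \<le> m"
  shows "forest_coloring (2 * m) (4 * int m + 1) 2 (4 * int m) (4 * int m + 1 - 1) (even_f m) (even_h m)
    (\<lambda>_ _ _. True) (\<lambda>_ _ A. 2 \<le> card A) (weight_bounded (2 * m)) (\<lambda>a b. 2 * m + 1 \<le> a + b)"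
proof (rule forest_coloring.intro[OF potential_scheme_multi good_scheme_weight forest_coloring_axioms.intro])
  fix \<gamma> :: int
  assume g: "1 \<le> \<gamma>" "\<gamma> \<le> 4 * int m"
  define k where "k = (if \<gamma> \<le> 2 * int m then nat ((\<gamma> + 1) div 2) else nat ((\<gamma> + 2) div 2))"
  have "k \<le> 2 * m + 1" "\<gamma> \<le> even_h m k" "even_h m k \<le> \<gamma> + 1" using g unfolding k_def even_h_def by (auto simp: min_def)
  moreover from this have "even_h m k + even_h m (2 * m + 1 - k) = 4 * int m + 1" by (auto simp: even_h_def)
  ultimately show "\<exists>ky kz. 2 * m + 1 \<le> ky + kz \<and> even_h m ky < \<gamma> + 2 \<and> even_h m kz \<le> 4 * int m + 1 - \<gamma>"
    by (intro exI[of _ k] exI[of _ "2 * m + 1 - k"]) auto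
qed (use assms even_weights[OF assms] in auto)

lemma even_K:
  assumes "1 \<le> n" "n \<le> 2 * m + 1" "- 1 < 2 * even_f m n - 3 * (4 * int m + 1)"
  shows "\<exists>ky kz. 2 * m + 1 \<le> ky + kz \<and> n + kz \<le> 2 * m + 1 \<and> 2 * even_h m ky < 4 * int m + 1 + 2 \<and>
    3 * even_h m ky < 4 * int m + 1 + 2 + 3 * (4 * int m + 1) - even_f m n \<and> 3 * even_h m ky \<le> 3 * (4 * int m + 1) - even_f m n"
proof -
  have "n \<le> m" using assms by (auto simp: even_f_def even_h_def min_def split: if_splits)
  then show ?thesis using assms(1)
    by (intro exI[of _ n] exI[of _ "2 * m + 1 - n"]) (auto simp: even_f_def even_h_def min_def)
qed

lemma induced_acyc:
  assumes "loopless_multigraph G"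
  shows "forest (induced G A) \<longleftrightarrow> acyc (edges_in (edges G) (ends G) A) (ends G)"
proof -
  have "loopless_multigraph (induced G A)" using assms by (auto simp: loopless_multigraph_def induced_def)
  from forest_iff_acyc[OF this] show ?thesis by (simp add: induced_def edges_in_def)
qed

lemma DF_coloring_iff:
  "DF_coloring D w G M F \<longleftrightarrow> forest_partition G M F \<and> degree_bounded D (edges G) (ends G) w M"
proof -
  have "neighbors G v \<inter> M = {u\<in>M. \<exists>ed\<in>edges G. ends G ed = {v, u}}" if "M \<subseteq> verts G" "v \<in> M" for v
    using that by (auto simp: neighbors_def adjacency_def)
  moreover have "M \<subseteq> verts G" if "forest_partition G M F" using that by (auto simp: forest_partition_def)
  ultimately show ?thesis by (auto simp: DF_coloring_def degree_bounded_def)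
qed

lemma DFe_coloring_iff:
  "DFe_coloring D w G M F \<longleftrightarrow> forest_partition G M F \<and> weight_bounded D (edges G) (ends G) w M"
proof -
  have "(\<forall>C\<in>component_vertex_sets (induced G M). (\<Sum>v\<in>C. w v) \<le> D + 1) \<longleftrightarrow> weight_bounded D (edges G) (ends G) w M"
    if "M \<subseteq> verts G"
  proof -
    have "adjacency (induced G M) = adj (edges G) (ends G) M" "verts (induced G M) = M"
      using that by (auto simp: adjacency_def adj_def induced_def)
    then show ?thesis by (simp add: component_vertex_sets_def weight_bounded_def reach_def)
  qed
  moreover have "M \<subseteq> verts G" if "forest_partition G M F" using that by (auto simp: forest_partition_def)
  ultimately show ?thesis by (auto simp: DFe_coloring_def)
qed

lemma potential_le_pot:
  assumes "\<And>v. v \<in> verts G \<Longrightarrow> \<rho> v \<le> f (w v)"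
  shows "potential G \<rho> \<epsilon> (verts G) \<le> pot \<epsilon> f (edges G) (ends G) w (verts G)"
proof -
  have "edges (induced G (verts G)) = edges_in (edges G) (ends G) (verts G)" by (simp add: induced_def edges_in_def)
  then show ?thesis using sum_mono[of "verts G" \<rho> "\<lambda>v. f (w v)"] assms by (simp add: potential_def pot_def)
qed

context forest_coloring begin

lemma crit_of_multigraph:
  assumes G: "loopless_multigraph G"
    and C: "\<And>H M F. C H M F \<longleftrightarrow> forest_partition H M F \<and> good (edges H) (ends H) w M"
    and crit: "\<not> (\<exists>M F. C G M F)" "\<forall>H. proper_subgraph H G \<longrightarrow> (\<exists>M F. C H M F)"
  shows "crit (verts G) (edges G) (ends G) w" "wf_graph (verts G) (edges G) (ends G)"
proof -
  show "wf_graph (verts G) (edges G) (ends G)" using G by (simp add: loopless_multigraph_def wf_graph_def)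
  have C_iff: "C H M F \<longleftrightarrow> colors (edges H) (ends H) w (verts H) M F" if "loopless_multigraph H" for H M F
    unfolding C forest_partition_def colors_def induced_acyc[OF that] by blast
  show "crit (verts G) (edges G) (ends G) w"
    unfolding crit_def
  proof (intro conjI allI impI)
    show "\<not> col (edges G) (ends G) w (verts G)" using crit(1) C_iff[OF G] by (simp add: col_def)
    fix V' E'
    assume a: "V' \<subseteq> verts G" "E' \<subseteq> edges G" "\<forall>ed\<in>E'. ends G ed \<subseteq> V'" "V' \<noteq> verts G \<or> E' \<noteq> edges G"
    define H :: "('v, 'e) multigraph" where "H = \<lparr>verts = V', edges = E', ends = ends G\<rparr>"
    have "finite V'" "finite E'" using G a(1,2) finite_subset by (auto simp: loopless_multigraph_def)
    then have "loopless_multigraph H" using G a(2,3) by (auto simp: loopless_multigraph_def H_def)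
    moreover have "proper_subgraph H G" using a by (simp add: proper_subgraph_def subgraph_def H_def)
    then obtain M F where "C H M F" using crit(2) by blast
    ultimately have "colors (edges H) (ends H) w (verts H) M F" using C_iff by blast
    then show "col E' (ends G) w V'" unfolding col_def H_def by auto
  qed
qed

end

lemma DF_multi_bound:
  fixes V :: "'v set" and E :: "'e set"
  assumes D: "2 \<le> D" and c: "forest_coloring.crit (degree_bounded D) V E g w" "wf_graph V E g" "\<forall>v\<in>V. 1 \<le> w v \<and> w v \<le> D + 2"
  shows "pot (2 * (int D + 1)) (lin_f 2 D) E g w V \<le> -2"
proof -
  interpret forest_coloring D "2 * (int D + 1)" 2 "2 * int D" "2 * (int D + 1) - 1" "lin_f 2 D" "lin_h 2 D"
    "\<lambda>(_::'v set) (_::'e set) (_::'e \<Rightarrow> 'v set). True" "\<lambda>_ _ A. 2 \<le> card A" "degree_bounded D" "degree_comb D"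
    by (rule forest_coloring_linear[OF D])
  have "\<not> bad V E g w" for V :: "'v set" and E :: "'e set" and g w
  proof
    assume b: "bad V E g w"
    note bd = badD[OF b]
    have "2 * po E g w V \<le> - 2 * int (card V)"
      by (rule no_bad_easy[OF _ _ b]) (use lin_K[OF D, of 2] in auto)
    then show False using bd(5) crit_two(1)[OF bd(1,2)] by linarith
  qed
  then have "po E g w V \<le> - 2" by (rule main_induct) (use c in \<open>auto simp: range_def\<close>)
  then show ?thesis by simp
qed

lemma DF_simple_bound:
  fixes V :: "'v set" and E :: "'e set"
  assumes D: "2 \<le> D" and c: "forest_coloring.crit (degree_bounded D) V E g w" "wf_graph V E g" "inj_on g E" "\<forall>v\<in>V. 1 \<le> w v \<and> w v \<le> D + 2"
  shows "pot (3 * (int D + 1)) (lin_f 3 D) E g w V \<le> -3"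
proof -
  interpret forest_coloring D "3 * (int D + 1)" 3 "3 * int D" "3 * (int D + 1) - 2" "lin_f 3 D" "lin_h 3 D"
    "\<lambda>(_::'v set) (E::'e set) (g::'e \<Rightarrow> 'v set). inj_on g E" "\<lambda>E g A. 3 \<le> card A \<and> (\<exists>ed\<in>E. g ed \<subseteq> A)" "degree_bounded D" "degree_comb D"
    by (rule forest_coloring_simple[OF D])
  have "\<not> bad V E g w" for V :: "'v set" and E :: "'e set" and g w
  proof
    assume b: "bad V E g w"
    note bd = badD[OF b]
    have "2 * po E g w V \<le> - 2 * int (card V)"
      by (rule no_bad_easy[OF _ _ b]) (use lin_K[OF D, of 3] in auto)
    then have "card V < 3" using bd(5) by linarith
    then have V2: "card V = 2" using crit_two(1)[OF bd(1,2)] by linarith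
    then obtain v where v: "v \<in> V" by fastforce
    have "g ` {ed\<in>E. v \<in> g ed} \<subseteq> {V}"
    proof
      fix A assume "A \<in> g ` {ed\<in>E. v \<in> g ed}"
      then obtain ed where ed: "ed \<in> E" "A = g ed" by blast
      have "g ed \<subseteq> V" using bd(2) ed(1) by (auto simp: wf_graph_def)
      then have "g ed = V" using card_subset_eq[OF bd(7)] bd(9)[OF ed(1)] V2 by simp
      then show "A \<in> {V}" using ed(2) by simp
    qed
    then have "card (g ` {ed\<in>E. v \<in> g ed}) \<le> card {V}" by (intro card_mono) auto
    moreover have "card (g ` {ed\<in>E. v \<in> g ed}) = card {ed\<in>E. v \<in> g ed}"
      by (rule card_image) (use bd(3) in \<open>auto simp: inj_on_def\<close>)
    ultimately show False using crit_degree(1)[OF bd(1,2) v] by simp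
  qed
  then have "po E g w V \<le> - 3" by (rule main_induct) (use c in \<open>auto simp: range_def\<close>)
  then show ?thesis by simp
qed

lemma odd_bound:
  assumes o: "odd_forest_coloring D (2 * (int D + 1)) 2 (2 * int D + 1) (2 * (int D + 1) - 1) (lin_f 2 D) (lin_h 2 D)
      (\<lambda>(_::'v set) (_::'e set) (_::'e \<Rightarrow> 'v set). True) (\<lambda>_ _ A. 2 \<le> card A) good comb H"
    and c: "forest_coloring.crit good V E g w" "wf_graph V E g" "\<forall>v\<in>V. 1 \<le> w v \<and> w v \<le> D + 2"
  shows "pot (2 * (int D + 1)) (lin_f 2 D) E g w V \<le> -2"
proof -
  interpret odd_forest_coloring D "2 * (int D + 1)" 2 "2 * int D + 1" "2 * (int D + 1) - 1" "lin_f 2 D" "lin_h 2 D"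
    "\<lambda>(_::'v set) (_::'e set) (_::'e \<Rightarrow> 'v set). True" "\<lambda>_ _ A. 2 \<le> card A" good comb H by (rule o)
  have "po E g w V \<le> - 2" by (rule main_induct[OF no_bad]) (use c in \<open>auto simp: range_def\<close>)
  then show ?thesis by simp
qed

lemma even_bound:
  fixes V :: "'v set" and E :: "'e set"
  assumes m: "1 \<le> m" and c: "forest_coloring.crit (weight_bounded (2 * m)) V E g w" "wf_graph V E g" "\<forall>v\<in>V. 1 \<le> w v \<and> w v \<le> 2 * m + 2"
  shows "pot (4 * int m + 1) (even_f m) E g w V \<le> -2"
proof -
  interpret forest_coloring "2 * m" "4 * int m + 1" 2 "4 * int m" "4 * int m + 1 - 1" "even_f m" "even_h m"
    "\<lambda>(_::'v set) (_::'e set) (_::'e \<Rightarrow> 'v set). True" "\<lambda>_ _ A. 2 \<le> card A" "weight_bounded (2 * m)" "\<lambda>a b. 2 * m + 1 \<le> a + b"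
    by (rule forest_coloring_even[OF m])
  have "\<not> bad V E g w" for V :: "'v set" and E :: "'e set" and g w
  proof
    assume b: "bad V E g w"
    note bd = badD[OF b]
    have "2 * po E g w V \<le> - 1 * int (card V)"
      by (rule no_bad_easy[OF _ _ b]) (use even_K[of _ m] in auto)
    then have "card V < 3" using bd(5) by linarith
    then have V2: "card V = 2" using crit_two(1)[OF bd(1,2)] by linarith
    have "2 * even_f m (w v) - (4 * int m + 1) * int (card {ed\<in>E. v \<in> g ed}) \<le> - 2" if v: "v \<in> V" for v
    proof -
      have "w v = 2 * m + 2" using crit_two(2)[OF bd(1,2) V2 v] bd(4) v by (auto simp: range_def)
      moreover have "(4 * int m + 1) * 2 \<le> (4 * int m + 1) * int (card {ed\<in>E. v \<in> g ed})"
        using crit_degree(1)[OF bd(1,2) v] by (intro mult_left_mono) auto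
      ultimately show ?thesis using f_top by simp
    qed
    then have "2 * po E g w V \<le> (\<Sum>v\<in>V. - 2)" unfolding handshake[OF bd(2)] by (rule sum_mono)
    then show False using bd(5) V2 by simp
  qed
  then have "po E g w V \<le> - 2" by (rule main_induct) (use c in \<open>auto simp: range_def\<close>)
  then show ?thesis by simp
qed

lemma DF_critical_crit:
  assumes "forest_coloring D \<epsilon> \<tau> gmax px f h (cls :: 'v set \<Rightarrow> 'e set \<Rightarrow> ('e \<Rightarrow> 'v set) \<Rightarrow> bool) big (degree_bounded D) comb"
    and "loopless_multigraph G" "DF_critical D w (G :: ('v, 'e) multigraph)"
  shows "forest_coloring.crit (degree_bounded D) (verts G) (edges G) (ends G) w"
  using forest_coloring.crit_of_multigraph(1)[OF assms(1,2), of "DF_coloring D w" w] assms(3) DF_coloring_iff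
  unfolding DF_critical_def by blast

lemma DFe_critical_crit:
  assumes "forest_coloring D \<epsilon> \<tau> gmax px f h (cls :: 'v set \<Rightarrow> 'e set \<Rightarrow> ('e \<Rightarrow> 'v set) \<Rightarrow> bool) big (weight_bounded D) comb"
    and "loopless_multigraph G" "DFe_critical D w (G :: ('v, 'e) multigraph)"
  shows "forest_coloring.crit (weight_bounded D) (verts G) (edges G) (ends G) w"
  using forest_coloring.crit_of_multigraph(1)[OF assms(1,2), of "DFe_coloring D w" w] assms(3) DFe_coloring_iff
  unfolding DFe_critical_def by blast

theorem theorem3p3:
  fixes D :: nat and G :: "('v, 'e) multigraph" and w :: "'v \<Rightarrow> nat"
  assumes "D \<ge> 1"
    and "loopless_multigraph G"
    and "\<forall>v \<in> verts G. w v \<in> {1..D + 2}"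
  shows
    "(D \<ge> 1 \<and> DF_critical D w G \<and> card (verts G) \<ge> 3 \<longrightarrow>
        potential G (\<lambda>v. 2 * int D + 1 + 2 * capacity D w v) (2 * (int D + 1)) (verts G) \<le> -2)
     \<and>
     (D \<ge> 2 \<and> simple_graph G \<and> DF_critical D w G \<and> card (verts G) \<ge> 3 \<longrightarrow>
        potential G (\<lambda>v. 3 * int D + 2 + 3 * capacity D w v) (3 * (int D + 1)) (verts G) \<le> -3)
     \<and>
     (D \<ge> 1 \<and> odd D \<and> DFe_critical D w G \<and> card (verts G) \<ge> 3 \<longrightarrow>
        potential G (\<lambda>v. 2 * int D + 1 + 2 * capacity D w v) (2 * (int D + 1)) (verts G) \<le> -2)
     \<and>
     (D \<ge> 2 \<and> even D \<and> DFe_critical D w G \<and> card (verts G) \<ge> 3 \<longrightarrow>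
        potential G
          (\<lambda>v. if capacity D w v \<le> (int D - 2) div 2
               then 2 * int D + 2 * capacity D w v
               else 2 * int D + 2 * capacity D w v - 1)
          (2 * int D + 1) (verts G) \<le> -2)"
proof (intro conjI impI; elim conjE)
  have wf: "wf_graph (verts G) (edges G) (ends G)" using assms(2) by (simp add: loopless_multigraph_def wf_graph_def)
  have r: "\<forall>v\<in>verts G. 1 \<le> w v \<and> w v \<le> D + 2" using assms(3) by auto
  have lin_2: "potential G (\<lambda>v. 2 * int D + 1 + 2 * capacity D w v) (2 * (int D + 1)) (verts G)
      \<le> pot (2 * (int D + 1)) (lin_f 2 D) (edges G) (ends G) w (verts G)"
    by (rule potential_le_pot) (simp add: lin_f_def capacity_def)
  {
    assume c: "DF_critical D w G"
    have "pot (2 * (int D + 1)) (lin_f 2 D) (edges G) (ends G) w (verts G) \<le> -2"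
    proof (cases "2 \<le> D")
      case True
      show ?thesis
        by (rule DF_multi_bound[OF True DF_critical_crit[OF forest_coloring_linear[OF True] assms(2) c] wf r])
    next
      case False
      then have D: "D = 1" using assms(1) by simp
      have o: "odd_forest_coloring D (2 * (int D + 1)) 2 (2 * int D + 1) (2 * (int D + 1) - 1) (lin_f 2 D) (lin_h 2 D)
          (\<lambda>(_::'v set) (_::'e set) (_::'e \<Rightarrow> 'v set). True) (\<lambda>_ _ A. 2 \<le> card A) (degree_bounded D) (degree_comb D) 1"
        unfolding D by (rule odd_forest_coloring_degree)
      show ?thesis
        by (rule odd_bound[OF o DF_critical_crit[OF odd_forest_coloring.axioms(1)[OF o] assms(2) c] wf r])
    qed
    then show "potential G (\<lambda>v. 2 * int D + 1 + 2 * capacity D w v) (2 * (int D + 1)) (verts G) \<le> -2"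
      using lin_2 by linarith
  next
    assume D: "2 \<le> D" and s: "simple_graph G" and c: "DF_critical D w G"
    have inj: "inj_on (ends G) (edges G)" using s by (simp add: simple_graph_def no_parallel_edges_def)
    have "pot (3 * (int D + 1)) (lin_f 3 D) (edges G) (ends G) w (verts G) \<le> -3"
      by (rule DF_simple_bound[OF D DF_critical_crit[OF forest_coloring_simple[OF D] assms(2) c] wf inj r])
    moreover have "potential G (\<lambda>v. 3 * int D + 2 + 3 * capacity D w v) (3 * (int D + 1)) (verts G)
        \<le> pot (3 * (int D + 1)) (lin_f 3 D) (edges G) (ends G) w (verts G)"
      by (rule potential_le_pot) (simp add: lin_f_def capacity_def)
    ultimately show "potential G (\<lambda>v. 3 * int D + 2 + 3 * capacity D w v) (3 * (int D + 1)) (verts G) \<le> -3"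
      by linarith
  next
    assume "odd D" and c: "DFe_critical D w G"
    then obtain H where "D + 1 = 2 * H" by (metis even_Suc evenE Suc_eq_plus1)
    note o = odd_forest_coloring_weight[OF this]
    have "pot (2 * (int D + 1)) (lin_f 2 D) (edges G) (ends G) w (verts G) \<le> -2"
      by (rule odd_bound[OF o DFe_critical_crit[OF odd_forest_coloring.axioms(1)[OF o] assms(2) c] wf r])
    then show "potential G (\<lambda>v. 2 * int D + 1 + 2 * capacity D w v) (2 * (int D + 1)) (verts G) \<le> -2"
      using lin_2 by linarith
  next
    assume "2 \<le> D" "even D" and c: "DFe_critical D w G"
    then obtain m where D: "D = 2 * m" and m: "1 \<le> m" by (auto elim: evenE)
    let ?\<rho> = "\<lambda>v. if capacity D w v \<le> (int D - 2) div 2 then 2 * int D + 2 * capacity D w v else 2 * int D + 2 * capacity D w v - 1"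
    have "pot (4 * int m + 1) (even_f m) (edges G) (ends G) w (verts G) \<le> -2"
      by (rule even_bound[OF m DFe_critical_crit[OF forest_coloring_even[OF m] assms(2) c[unfolded D]] wf r[unfolded D]])
    moreover have "potential G ?\<rho> (4 * int m + 1) (verts G) \<le> pot (4 * int m + 1) (even_f m) (edges G) (ends G) w (verts G)"
    proof (rule potential_le_pot)
      fix v assume "v \<in> verts G"
      then have "1 \<le> w v" "w v \<le> 2 * m + 2" using r D by auto
      then show "?\<rho> v \<le> even_f m (w v)" by (auto simp: D capacity_def even_f_def even_h_def)
    qed
    ultimately show "potential G ?\<rho> (2 * int D + 1) (verts G) \<le> -2" by (simp add: D)
  }
qed

end
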